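(* Let $K=(\mathcal{V},\mathcal{E})$ be a finite simple graph that is a tree or a cycle. Then $\mathcal{R}(K,\mathrm{SO}(3))$ has exactly $2^{|\mathcal{E}|}$ connected components.
   Context: For a finite simple graph $K=(\mathcal{V},\mathcal{E})$, the right-angled Artin group $\Gamma_K$ has one generator $x_v$ for each $v\in\mathcal{V}$ and the relation $x_vx_w=x_wx_v$ for each edge $\{v,w\}\in\mathcal{E}$. For a topological group $G$, $\mathcal{R}(K,G)=\mathrm{Hom}(\Gamma_K,G)$ with the compact-open topology ($\Gamma_K$ discrete); equivalently, it is the subspace of $G^{\mathcal{V}}$ of tuples $(g_v)_{v\in\mathcal{V}}$ with $g_vg_w=g_wg_v$ for all $\{v,w\}\in\mathcal{E}$. *)

theory Defs
  imports "HOL-Analysis.Analysis" "HOL-Algebra.Group"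
begin

subsection \<open>Graphs\<close>

definition finite_simple_graph :: "'a set \<Rightarrow> 'a set set \<Rightarrow> bool"
  where "finite_simple_graph V E \<longleftrightarrow> finite V \<and> (\<forall>e\<in>E. e \<subseteq> V \<and> card e = 2)"

definition connected_graph :: "'a set \<Rightarrow> 'a set set \<Rightarrow> bool"
  where "connected_graph V E \<longleftrightarrow>
    V \<noteq> {} \<and> (\<forall>u\<in>V. \<forall>v\<in>V. (u, v) \<in> {(x, y). {x, y} \<in> E}\<^sup>*)"

definition cycle_graph :: "'a set \<Rightarrow> 'a set set \<Rightarrow> bool"
  where "cycle_graph V E \<longleftrightarrow>
    (\<exists>vs. distinct vs \<and> 3 \<le> length vs \<and> V = set vs \<and>
      E = {{vs ! i, vs ! (Suc i mod length vs)} |i. i < length vs})"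

definition tree_graph :: "'a set \<Rightarrow> 'a set set \<Rightarrow> bool"
  where "tree_graph V E \<longleftrightarrow>
    connected_graph V E \<and> \<not> (\<exists>V'\<subseteq>V. \<exists>E'\<subseteq>E. cycle_graph V' E')"

subsection \<open>Right-angled Artin groups\<close>

text \<open>A letter \<open>(v, True)\<close> stands for the generator \<open>x\<^sub>v\<close> and \<open>(v, False)\<close> for its formal
  inverse; the group is the monoid of words modulo the congruence generated by free cancellation
  and the commutation relations.\<close>

type_synonym 'a word = "('a \<times> bool) list"

abbreviation raag_words :: "'a set \<Rightarrow> 'a word set"
  where "raag_words V \<equiv> lists (V \<times> UNIV)"

inductive_set raag_rel :: "'a set \<Rightarrow> 'a set set \<Rightarrow> ('a word \<times> 'a word) set"
  for V :: "'a set" and E :: "'a set set"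
  where
    refl: "w \<in> raag_words V \<Longrightarrow> (w, w) \<in> raag_rel V E"
  | sym: "(u, w) \<in> raag_rel V E \<Longrightarrow> (w, u) \<in> raag_rel V E"
  | trans: "(u, v) \<in> raag_rel V E \<Longrightarrow> (v, w) \<in> raag_rel V E \<Longrightarrow> (u, w) \<in> raag_rel V E"
  | cancel: "a \<in> raag_words V \<Longrightarrow> b \<in> raag_words V \<Longrightarrow> v \<in> V \<Longrightarrow>
      (a @ [(v, s), (v, \<not> s)] @ b, a @ b) \<in> raag_rel V E"
  | commute: "a \<in> raag_words V \<Longrightarrow> b \<in> raag_words V \<Longrightarrow> v \<in> V \<Longrightarrow> w \<in> V \<Longrightarrow> {v, w} \<in> E \<Longrightarrow>
      (a @ [(v, True), (w, True)] @ b, a @ [(w, True), (v, True)] @ b) \<in> raag_rel V E"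

definition RAAG :: "'a set \<Rightarrow> 'a set set \<Rightarrow> 'a word set monoid"
  where "RAAG V E =
    \<lparr>carrier = raag_words V // raag_rel V E,
     mult = (\<lambda>A B. \<Union>a\<in>A. \<Union>b\<in>B. raag_rel V E `` {a @ b}),
     one = raag_rel V E `` {[]}\<rparr>"

definition raag_gen :: "'a set \<Rightarrow> 'a set set \<Rightarrow> 'a \<Rightarrow> 'a word set"
  where "raag_gen V E v = raag_rel V E `` {[(v, True)]}"

subsection \<open>Spaces of homomorphisms\<close>

text \<open>Maps out of a space are represented by functions that are \<open>undefined\<close> outside of it, so
  that distinct points of a function space differ as maps.\<close>

definition compact_open_topology :: "'a topology \<Rightarrow> 'b topology \<Rightarrow> ('a \<Rightarrow> 'b) topology"
  where "compact_open_topology X Y =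
    topology_generated_by
      {{f \<in> extensional (topspace X). continuous_map X Y f \<and> f ` C \<subseteq> U} |C U.
        compactin X C \<and> openin Y U}"

definition raag_rep_space ::
    "'a set \<Rightarrow> 'a set set \<Rightarrow> 'g monoid \<Rightarrow> 'g topology \<Rightarrow> ('a word set \<Rightarrow> 'g) topology"
  where "raag_rep_space V E G T =
    subtopology (compact_open_topology (discrete_topology (carrier (RAAG V E))) T)
      (hom (RAAG V E) G)"

definition SO3 :: "(real^3^3) monoid"
  where "SO3 = \<lparr>carrier = {A. rotation_matrix A}, mult = (**), one = mat 1\<rparr>"

definition SO3_topology :: "(real^3^3) topology"
  where "SO3_topology = top_of_set (carrier SO3)"

subsection \<open>The space of representations as a space of commuting tuples\<close>

lemma raag_rel_words: "(u, w) \<in> raag_rel V E \<Longrightarrow> u \<in> raag_words V \<and> w \<in> raag_words V"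
  by (induction rule: raag_rel.induct) auto

lemma equiv_raag_rel: "equiv (raag_words V) (raag_rel V E)"
proof (rule equivI)
  show "raag_rel V E \<subseteq> raag_words V \<times> raag_words V"
    using raag_rel_words by fast
  show "refl_on (raag_words V) (raag_rel V E)"
    by (rule refl_onI) (rule raag_rel.refl)
  show "sym (raag_rel V E)"
    by (rule symI) (rule raag_rel.sym)
  show "trans (raag_rel V E)"
    by (rule transI) (rule raag_rel.trans)
qed

lemma raag_rel_context:
  assumes "(u, w) \<in> raag_rel V E" "a \<in> raag_words V" "b \<in> raag_words V"
  shows "(a @ u @ b, a @ w @ b) \<in> raag_rel V E"
  using assms
proof (induction rule: raag_rel.induct)
  case (refl w)
  then show ?case by (intro raag_rel.refl) auto
next
  case (sym u w)
  then show ?case by (blast intro: raag_rel.sym)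
next
  case (trans u v w)
  then show ?case by (blast intro: raag_rel.trans)
next
  case (cancel c d v s)
  then show ?case
    using raag_rel.cancel[of "a @ c" V "d @ b" v s E] by simp
next
  case (commute c d v w)
  then show ?case
    using raag_rel.commute[of "a @ c" V "d @ b" v w E] by simp
qed

lemma raag_rel_append:
  assumes "(u, u') \<in> raag_rel V E" "(w, w') \<in> raag_rel V E"
  shows "(u @ w, u' @ w') \<in> raag_rel V E"
proof -
  have "(u @ w, u' @ w) \<in> raag_rel V E"
    using raag_rel_context[OF assms(1), of "[]" w] raag_rel_words[OF assms(2)] by simp
  moreover have "(u' @ w, u' @ w') \<in> raag_rel V E"
    using raag_rel_context[OF assms(2), of u' "[]"] raag_rel_words[OF assms(1)] by simp
  ultimately show ?thesis by (rule raag_rel.trans)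
qed

lemma carrier_RAAG: "carrier (RAAG V E) = raag_words V // raag_rel V E"
  by (simp add: RAAG_def)

lemma RAAG_classE:
  assumes "x \<in> carrier (RAAG V E)"
  obtains w where "w \<in> raag_words V" "x = raag_rel V E `` {w}"
  using assms unfolding carrier_RAAG by (rule quotientE)

lemma RAAG_classI: "w \<in> raag_words V \<Longrightarrow> raag_rel V E `` {w} \<in> carrier (RAAG V E)"
  unfolding carrier_RAAG by (rule quotientI)

lemma one_RAAG: "\<one>\<^bsub>RAAG V E\<^esub> = raag_rel V E `` {[]}"
  by (simp add: RAAG_def)

lemma mult_RAAG:
  assumes "u \<in> raag_words V" "w \<in> raag_words V"
  shows "raag_rel V E `` {u} \<otimes>\<^bsub>RAAG V E\<^esub> raag_rel V E `` {w} = raag_rel V E `` {u @ w}"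
proof -
  have "(\<lambda>u w. raag_rel V E `` {u @ w}) respects2 raag_rel V E"
    by (rule congruent2I')
      (meson raag_rel_append equiv_raag_rel equiv_class_eq_iff)
  then show ?thesis
    using UN_equiv_class2[OF equiv_raag_rel equiv_raag_rel _ assms] by (simp add: RAAG_def)
qed

lemma raag_rel_inverse:
  "w \<in> raag_words V \<Longrightarrow> (rev (map (\<lambda>(v, s). (v, \<not> s)) w) @ w, []) \<in> raag_rel V E"
proof (induction w)
  case Nil
  then show ?case by (auto intro: raag_rel.refl)
next
  case (Cons p w)
  obtain v s where p: "p = (v, s)" by fastforce
  let ?r = "rev (map (\<lambda>(v, s). (v, \<not> s)) w)"
  have w: "w \<in> raag_words V" "v \<in> V" using Cons.prems p by auto
  then have r: "?r \<in> raag_words V" by auto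
  have "(?r @ [(v, \<not> s), (v, \<not> \<not> s)] @ w, ?r @ w) \<in> raag_rel V E"
    using r w by (intro raag_rel.cancel)
  then show ?case
    using Cons.IH[OF w(1)] p by (auto intro: raag_rel.trans)
qed

lemma group_RAAG: "group (RAAG V E)"
proof (rule groupI)
  fix x y assume "x \<in> carrier (RAAG V E)" "y \<in> carrier (RAAG V E)"
  then obtain a b where "a \<in> raag_words V" "b \<in> raag_words V"
    "x = raag_rel V E `` {a}" "y = raag_rel V E `` {b}"
    by (elim RAAG_classE) blast
  then show "x \<otimes>\<^bsub>RAAG V E\<^esub> y \<in> carrier (RAAG V E)"
    using RAAG_classI[of "a @ b" V E] by (simp add: mult_RAAG)
next
  show "\<one>\<^bsub>RAAG V E\<^esub> \<in> carrier (RAAG V E)"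
    using RAAG_classI[of "[]"] by (simp add: one_RAAG)
next
  fix x y z
  assume "x \<in> carrier (RAAG V E)" "y \<in> carrier (RAAG V E)" "z \<in> carrier (RAAG V E)"
  then obtain a b c where "a \<in> raag_words V" "b \<in> raag_words V" "c \<in> raag_words V"
    "x = raag_rel V E `` {a}" "y = raag_rel V E `` {b}" "z = raag_rel V E `` {c}"
    by (elim RAAG_classE) blast
  then show "x \<otimes>\<^bsub>RAAG V E\<^esub> y \<otimes>\<^bsub>RAAG V E\<^esub> z = x \<otimes>\<^bsub>RAAG V E\<^esub> (y \<otimes>\<^bsub>RAAG V E\<^esub> z)"
    by (simp add: mult_RAAG)
next
  fix x assume "x \<in> carrier (RAAG V E)"
  then obtain a where a: "a \<in> raag_words V" "x = raag_rel V E `` {a}"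
    by (elim RAAG_classE)
  then show "\<one>\<^bsub>RAAG V E\<^esub> \<otimes>\<^bsub>RAAG V E\<^esub> x = x"
    by (simp add: one_RAAG mult_RAAG)
  let ?b = "rev (map (\<lambda>(v, s). (v, \<not> s)) a)"
  have b: "?b \<in> raag_words V" using a by auto
  have "raag_rel V E `` {?b} \<otimes>\<^bsub>RAAG V E\<^esub> x = \<one>\<^bsub>RAAG V E\<^esub>"
    using mult_RAAG[OF b a(1)] raag_rel_inverse[OF a(1)] equiv_class_eq[OF equiv_raag_rel]
    by (metis a(2) one_RAAG)
  moreover have "raag_rel V E `` {?b} \<in> carrier (RAAG V E)"
    using b by (rule RAAG_classI)
  ultimately show "\<exists>y\<in>carrier (RAAG V E). y \<otimes>\<^bsub>RAAG V E\<^esub> x = \<one>\<^bsub>RAAG V E\<^esub>"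
    by blast
qed

lemma raag_gen_carrier: "v \<in> V \<Longrightarrow> raag_gen V E v \<in> carrier (RAAG V E)"
  using RAAG_classI[of "[(v, True)]" V E] by (simp add: raag_gen_def)

lemma raag_gen_commute:
  assumes "v \<in> V" "w \<in> V" "{v, w} \<in> E"
  shows "raag_gen V E v \<otimes>\<^bsub>RAAG V E\<^esub> raag_gen V E w = raag_gen V E w \<otimes>\<^bsub>RAAG V E\<^esub> raag_gen V E v"
proof -
  have "([(v, True), (w, True)], [(w, True), (v, True)]) \<in> raag_rel V E"
    using raag_rel.commute[of "[]" V "[]" v w E] assms by simp
  then show ?thesis
    using assms by (simp add: raag_gen_def mult_RAAG equiv_class_eq[OF equiv_raag_rel])
qed

definition word_eval :: "('g, 'm) monoid_scheme \<Rightarrow> ('a \<Rightarrow> 'g) \<Rightarrow> 'a word \<Rightarrow> 'g"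
  where "word_eval G g w =
    foldr (\<lambda>(v, s) x. (if s then g v else inv\<^bsub>G\<^esub> g v) \<otimes>\<^bsub>G\<^esub> x) w \<one>\<^bsub>G\<^esub>"

lemma word_eval_simps [simp]:
  "word_eval G g [] = \<one>\<^bsub>G\<^esub>"
  "word_eval G g ((v, s) # w) = (if s then g v else inv\<^bsub>G\<^esub> g v) \<otimes>\<^bsub>G\<^esub> word_eval G g w"
  by (simp_all add: word_eval_def)

context group
begin

lemma word_eval_closed:
  "g ` V \<subseteq> carrier G \<Longrightarrow> w \<in> raag_words V \<Longrightarrow> word_eval G g w \<in> carrier G"
  by (induction w) (auto simp: image_subset_iff)

lemma word_eval_append:
  "g ` V \<subseteq> carrier G \<Longrightarrow> u \<in> raag_words V \<Longrightarrow> w \<in> raag_words V \<Longrightarrow>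
    word_eval G g (u @ w) = word_eval G g u \<otimes> word_eval G g w"
proof (induction u)
  case Nil
  then show ?case by (simp add: word_eval_closed)
next
  case (Cons p u)
  obtain v s where p: "p = (v, s)" by fastforce
  with Cons have "g v \<in> carrier G" "word_eval G g u \<in> carrier G" "word_eval G g w \<in> carrier G"
    by (auto simp: word_eval_closed)
  with Cons p show ?case by (simp add: m_assoc)
qed

lemma word_eval_rel:
  assumes "(u, w) \<in> raag_rel V E" and g: "g ` V \<subseteq> carrier G"
    and comm: "\<And>v w. v \<in> V \<Longrightarrow> w \<in> V \<Longrightarrow> {v, w} \<in> E \<Longrightarrow> g v \<otimes> g w = g w \<otimes> g v"
  shows "word_eval G g u = word_eval G g w"
  using assms(1)
proof (induction rule: raag_rel.induct)
  case (cancel a b v s)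
  then have "g v \<in> carrier G" "word_eval G g b \<in> carrier G"
    using g by (auto simp: word_eval_closed)
  then have "word_eval G g ([(v, s), (v, \<not> s)] @ b) = word_eval G g b"
    by (cases s) (simp_all add: m_assoc[symmetric])
  then show ?case
    using cancel word_eval_append[OF g] by simp
next
  case (commute a b v w)
  then have "g v \<in> carrier G" "g w \<in> carrier G" "word_eval G g b \<in> carrier G"
    using g by (auto simp: word_eval_closed)
  then have "word_eval G g ([(v, True), (w, True)] @ b) = word_eval G g ([(w, True), (v, True)] @ b)"
    using comm[of v w] commute by (simp add: m_assoc[symmetric])
  then show ?case
    using commute word_eval_append[OF g] by simp
qed simp_all

end

text \<open>The subspace of the product \<open>G\<^sup>V\<close> of tuples that satisfy the commutation relations.\<close>

definition commuting_tuples ::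
    "'a set \<Rightarrow> 'a set set \<Rightarrow> ('g, 'm) monoid_scheme \<Rightarrow> ('a \<Rightarrow> 'g) set"
  where "commuting_tuples V E G =
    {g \<in> V \<rightarrow>\<^sub>E carrier G. \<forall>v\<in>V. \<forall>w\<in>V. {v, w} \<in> E \<longrightarrow> g v \<otimes>\<^bsub>G\<^esub> g w = g w \<otimes>\<^bsub>G\<^esub> g v}"

definition raag_hom :: "'a set \<Rightarrow> 'a set set \<Rightarrow> ('g, 'm) monoid_scheme \<Rightarrow> ('a \<Rightarrow> 'g) \<Rightarrow> 'a word set \<Rightarrow> 'g"
  where "raag_hom V E G g = (\<lambda>A\<in>carrier (RAAG V E). word_eval G g (SOME w. w \<in> A))"

lemma raag_hom_class:
  assumes G: "group G" and g: "g \<in> commuting_tuples V E G" and w: "w \<in> raag_words V"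
  shows "raag_hom V E G g (raag_rel V E `` {w}) = word_eval G g w"
proof -
  have "(SOME u. u \<in> raag_rel V E `` {w}) \<in> raag_rel V E `` {w}"
    by (rule someI[of _ w]) (use w in \<open>auto intro: raag_rel.refl\<close>)
  then have "(w, SOME u. u \<in> raag_rel V E `` {w}) \<in> raag_rel V E" by simp
  from group.word_eval_rel[OF G this, of g] g
  have "word_eval G g w = word_eval G g (SOME u. u \<in> raag_rel V E `` {w})"
    by (auto simp: commuting_tuples_def)
  then show ?thesis
    using RAAG_classI[OF w] by (simp add: raag_hom_def)
qed

lemma raag_hom_hom:
  assumes G: "group G" and g: "g \<in> commuting_tuples V E G"
  shows "raag_hom V E G g \<in> hom (RAAG V E) G"
proof (rule homI)
  have gV: "g ` V \<subseteq> carrier G" using g by (auto simp: commuting_tuples_def)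
  fix x assume "x \<in> carrier (RAAG V E)"
  then obtain a where a: "a \<in> raag_words V" "x = raag_rel V E `` {a}"
    by (elim RAAG_classE)
  then show "raag_hom V E G g x \<in> carrier G"
    using raag_hom_class[OF G g] group.word_eval_closed[OF G gV] by simp
  fix y assume "y \<in> carrier (RAAG V E)"
  then obtain b where b: "b \<in> raag_words V" "y = raag_rel V E `` {b}"
    by (elim RAAG_classE)
  have "a @ b \<in> raag_words V" using a b by simp
  then show "raag_hom V E G g (x \<otimes>\<^bsub>RAAG V E\<^esub> y) = raag_hom V E G g x \<otimes>\<^bsub>G\<^esub> raag_hom V E G g y"
    using raag_hom_class[OF G g] group.word_eval_append[OF G gV] a b by (simp add: mult_RAAG)
qed

lemma raag_hom_gen:
  assumes G: "group G" and g: "g \<in> commuting_tuples V E G" and v: "v \<in> V"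
  shows "raag_hom V E G g (raag_gen V E v) = g v"
proof -
  interpret group G by (rule G)
  have "g v \<in> carrier G" using g v by (auto simp: commuting_tuples_def)
  then show ?thesis
    using raag_hom_class[OF G g, of "[(v, True)]"] v by (simp add: raag_gen_def)
qed

lemma hom_word_eval:
  assumes G: "group G" and f: "f \<in> hom (RAAG V E) G" and w: "w \<in> raag_words V"
  shows "f (raag_rel V E `` {w}) = word_eval G (\<lambda>v\<in>V. f (raag_gen V E v)) w"
proof -
  interpret R: group "RAAG V E" by (rule group_RAAG)
  interpret G: group G by (rule G)
  interpret F: group_hom "RAAG V E" G f
    using f by unfold_locales
  show ?thesis
    using w
  proof (induction w)
    case Nil
    then show ?case using F.hom_one by (simp add: one_RAAG)
  next
    case (Cons p w)
    obtain v s where p: "p = (v, s)" by fastforce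
    have v: "v \<in> V" and w: "w \<in> raag_words V" using Cons.hyps p by auto
    have neg: "raag_rel V E `` {[(v, False)]} = inv\<^bsub>RAAG V E\<^esub> raag_gen V E v"
    proof (rule R.inv_equality[symmetric])
      have "([(v, False), (v, True)], []) \<in> raag_rel V E"
        using raag_rel.cancel[of "[]" V "[]" v False E] v by simp
      then show "raag_rel V E `` {[(v, False)]} \<otimes>\<^bsub>RAAG V E\<^esub> raag_gen V E v = \<one>\<^bsub>RAAG V E\<^esub>"
        using v by (simp add: raag_gen_def mult_RAAG one_RAAG equiv_class_eq[OF equiv_raag_rel])
    qed (use v RAAG_classI[of "[(v, False)]" V E] in \<open>simp_all add: raag_gen_carrier\<close>)
    have s: "raag_rel V E `` {[(v, s)]} \<in> carrier (RAAG V E)"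
      "raag_rel V E `` {w} \<in> carrier (RAAG V E)"
      using v w by (auto intro!: RAAG_classI)
    have "raag_rel V E `` {p # w} = raag_rel V E `` {[(v, s)]} \<otimes>\<^bsub>RAAG V E\<^esub> raag_rel V E `` {w}"
      using v w p by (simp add: mult_RAAG)
    then have "f (raag_rel V E `` {p # w}) = f (raag_rel V E `` {[(v, s)]}) \<otimes>\<^bsub>G\<^esub> f (raag_rel V E `` {w})"
      using s by simp
    moreover have "f (raag_rel V E `` {[(v, s)]}) =
        (if s then f (raag_gen V E v) else inv\<^bsub>G\<^esub> f (raag_gen V E v))"
      using neg v raag_gen_carrier[OF v] by (auto simp: raag_gen_def[symmetric])
    ultimately show ?case
      using Cons.IH p v by simp
  qed
qed

lemma hom_eq_raag_hom:
  assumes G: "group G" and f: "f \<in> hom (RAAG V E) G" "f \<in> extensional (carrier (RAAG V E))"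
  shows "(\<lambda>v\<in>V. f (raag_gen V E v)) \<in> commuting_tuples V E G"
    and "raag_hom V E G (\<lambda>v\<in>V. f (raag_gen V E v)) = f"
proof -
  show *: "(\<lambda>v\<in>V. f (raag_gen V E v)) \<in> commuting_tuples V E G"
    unfolding commuting_tuples_def
  proof (intro CollectI conjI ballI impI)
    show "(\<lambda>v\<in>V. f (raag_gen V E v)) \<in> V \<rightarrow>\<^sub>E carrier G"
      using f(1) by (auto simp: hom_in_carrier raag_gen_carrier)
    fix v w assume vw: "v \<in> V" "w \<in> V" "{v, w} \<in> E"
    have "f (raag_gen V E v \<otimes>\<^bsub>RAAG V E\<^esub> raag_gen V E w) = f (raag_gen V E w \<otimes>\<^bsub>RAAG V E\<^esub> raag_gen V E v)"
      using raag_gen_commute[OF vw] by (rule arg_cong)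
    then show "(\<lambda>v\<in>V. f (raag_gen V E v)) v \<otimes>\<^bsub>G\<^esub> (\<lambda>v\<in>V. f (raag_gen V E v)) w =
        (\<lambda>v\<in>V. f (raag_gen V E v)) w \<otimes>\<^bsub>G\<^esub> (\<lambda>v\<in>V. f (raag_gen V E v)) v"
      using vw hom_mult[OF f(1)] by (simp add: raag_gen_carrier)
  qed
  show "raag_hom V E G (\<lambda>v\<in>V. f (raag_gen V E v)) = f"
  proof (rule extensionalityI[of _ "carrier (RAAG V E)"])
    fix x assume "x \<in> carrier (RAAG V E)"
    then obtain a where "a \<in> raag_words V" "x = raag_rel V E `` {a}"
      by (elim RAAG_classE)
    then show "raag_hom V E G (\<lambda>v\<in>V. f (raag_gen V E v)) x = f x"
      using raag_hom_class[OF G *] hom_word_eval[OF G f(1)] by simp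
  qed (use f in \<open>auto simp: raag_hom_def\<close>)
qed

definition topological_group :: "('g, 'm) monoid_scheme \<Rightarrow> 'g topology \<Rightarrow> bool"
  where "topological_group G T \<longleftrightarrow> group G \<and> topspace T = carrier G \<and>
    continuous_map (prod_topology T T) T (\<lambda>(x, y). x \<otimes>\<^bsub>G\<^esub> y) \<and>
    continuous_map T T (\<lambda>x. inv\<^bsub>G\<^esub> x)"

lemma topspace_raag_rep_space:
  assumes "topspace T = carrier G"
  shows "topspace (raag_rep_space V E G T) =
    hom (RAAG V E) G \<inter> extensional (carrier (RAAG V E))"
proof -
  let ?K = "discrete_topology (carrier (RAAG V E))"
  let ?S = "{{f \<in> extensional (topspace ?K). continuous_map ?K T f \<and> f ` C \<subseteq> U} |C U.
    compactin ?K C \<and> openin T U}"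
  have 1: "\<Union>?S \<subseteq> {f \<in> extensional (topspace ?K). continuous_map ?K T f}"
    by blast
  have "compactin ?K {}" "openin T {}" by simp_all
  then have "{f \<in> extensional (topspace ?K). continuous_map ?K T f \<and> f ` {} \<subseteq> {}} \<in> ?S"
    by blast
  then have "{f \<in> extensional (topspace ?K). continuous_map ?K T f} \<subseteq> \<Union>?S"
    by blast
  with 1 have "\<Union>?S = {f \<in> extensional (topspace ?K). continuous_map ?K T f}"
    by (rule subset_antisym)
  also have "\<dots> = carrier (RAAG V E) \<rightarrow>\<^sub>E carrier G"
    using assms by (auto simp: PiE_def)
  finally have "topspace (compact_open_topology ?K T) = carrier (RAAG V E) \<rightarrow>\<^sub>E carrier G"
    unfolding compact_open_topology_def topology_generated_by_topspace .
  then have "topspace (raag_rep_space V E G T)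
      = (carrier (RAAG V E) \<rightarrow>\<^sub>E carrier G) \<inter> hom (RAAG V E) G"
    by (simp only: raag_rep_space_def topspace_subtopology)
  also have "\<dots> = hom (RAAG V E) G \<inter> extensional (carrier (RAAG V E))"
    unfolding PiE_def hom_def by blast
  finally show ?thesis .
qed

lemma continuous_map_word_eval:
  assumes TG: "topological_group G T" and w: "w \<in> raag_words V"
  shows "continuous_map (product_topology (\<lambda>_. T) V) T (\<lambda>g. word_eval G g w)"
  using w
proof (induction w)
  case Nil
  interpret group G using TG by (simp add: topological_group_def)
  show ?case using TG by (simp add: topological_group_def)
next
  case (Cons p w)
  obtain v s where p: "p = (v, s)" by fastforce
  have v: "v \<in> V" and w: "w \<in> raag_words V" using Cons.hyps p by auto
  let ?P = "product_topology (\<lambda>_. T) V"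
  have 1: "continuous_map ?P T (\<lambda>g. g v)"
    using v by (rule continuous_map_product_projection)
  then have "continuous_map ?P T (\<lambda>g. inv\<^bsub>G\<^esub> g v)"
    using continuous_map_compose[of ?P T "\<lambda>g. g v" T "\<lambda>x. inv\<^bsub>G\<^esub> x"] TG
    by (simp add: topological_group_def o_def)
  with 1 have "continuous_map ?P T (\<lambda>g. if s then g v else inv\<^bsub>G\<^esub> g v)"
    by (cases s) auto
  then have "continuous_map ?P (prod_topology T T)
      (\<lambda>g. (if s then g v else inv\<^bsub>G\<^esub> g v, word_eval G g w))"
    using Cons.IH by (simp add: continuous_map_paired)
  then have "continuous_map ?P T ((\<lambda>(x, y). x \<otimes>\<^bsub>G\<^esub> y) \<circ>
      (\<lambda>g. (if s then g v else inv\<^bsub>G\<^esub> g v, word_eval G g w)))"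
    using TG by (intro continuous_map_compose) (auto simp: topological_group_def)
  then show ?case using p by (simp add: o_def)
qed

theorem raag_rep_space_homeomorphic_commuting_tuples:
  assumes TG: "topological_group G T"
  shows "homeomorphic_maps (raag_rep_space V E G T)
    (subtopology (product_topology (\<lambda>_. T) V) (commuting_tuples V E G))
    (\<lambda>f. \<lambda>v\<in>V. f (raag_gen V E v)) (raag_hom V E G)"
proof -
  have G: "group G" and T: "topspace T = carrier G"
    using TG unfolding topological_group_def by blast+
  let ?R = "raag_rep_space V E G T"
  let ?K = "discrete_topology (carrier (RAAG V E))"
  let ?P = "product_topology (\<lambda>_. T) V"
  let ?Q = "subtopology ?P (commuting_tuples V E G)"
  let ?\<Phi> = "\<lambda>f. \<lambda>v\<in>V. f (raag_gen V E v)"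
  have topQ: "topspace ?Q = commuting_tuples V E G"
    unfolding topspace_subtopology topspace_product_topology T commuting_tuples_def by blast
  note topR = topspace_raag_rep_space[OF T, of V E]
  have cont_comp: "continuous_map ?R T (\<lambda>f. f (raag_gen V E v))" if v: "v \<in> V" for v
    unfolding continuous_map_def
  proof (intro conjI allI impI)
    show "(\<lambda>f. f (raag_gen V E v)) \<in> topspace ?R \<rightarrow> topspace T"
    proof
      fix f assume "f \<in> topspace ?R"
      then have "f \<in> hom (RAAG V E) G" unfolding topR by (rule IntD1)
      then show "f (raag_gen V E v) \<in> topspace T"
        unfolding T using raag_gen_carrier[OF v] by (rule hom_in_carrier)
    qed
    fix U assume U: "openin T U"
    let ?B = "{f \<in> extensional (topspace ?K). continuous_map ?K T f \<and> f ` {raag_gen V E v} \<subseteq> U}"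
    have "openin (compact_open_topology ?K T) ?B"
      unfolding compact_open_topology_def
    proof (rule topology_generated_by_Basis)
      have "compactin ?K {raag_gen V E v}"
        using raag_gen_carrier[OF v] by (simp add: compactin_discrete_topology)
      with U show "?B \<in> {{f \<in> extensional (topspace ?K). continuous_map ?K T f \<and> f ` C \<subseteq> U} |C U.
          compactin ?K C \<and> openin T U}"
        by blast
    qed
    then have "openin ?R (hom (RAAG V E) G \<inter> ?B)"
      unfolding raag_rep_space_def by (rule openin_subtopology_Int2)
    moreover have "hom (RAAG V E) G \<inter> ?B = {f \<in> topspace ?R. f (raag_gen V E v) \<in> U}"
    proof -
      have "continuous_map ?K T f" if "f \<in> hom (RAAG V E) G" for f
        using that T by (simp add: hom_def)
      then show ?thesis unfolding topR topspace_discrete_topology by blast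
    qed
    ultimately show "openin ?R {f \<in> topspace ?R. f (raag_gen V E v) \<in> U}" by simp
  qed
  have "continuous_map ?R ?Q ?\<Phi>"
    unfolding continuous_map_in_subtopology
  proof
    show "continuous_map ?R ?P ?\<Phi>"
      unfolding continuous_map_componentwise
    proof (intro conjI ballI)
      fix v assume "v \<in> V"
      then show "continuous_map ?R T (\<lambda>f. ?\<Phi> f v)"
        using cont_comp[of v] by simp
    qed auto
    show "?\<Phi> \<in> topspace ?R \<rightarrow> commuting_tuples V E G"
      unfolding topR using hom_eq_raag_hom(1)[OF G] by blast
  qed
  moreover have "continuous_map ?Q ?R (raag_hom V E G)"
    unfolding raag_rep_space_def continuous_map_in_subtopology
  proof
    show "raag_hom V E G \<in> topspace ?Q \<rightarrow> hom (RAAG V E) G"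
      unfolding topQ using raag_hom_hom[OF G] by blast
    have into: "raag_hom V E G g \<in> topspace ?R" if "g \<in> topspace ?Q" for g
    proof -
      have "raag_hom V E G g \<in> extensional (carrier (RAAG V E))"
        by (simp add: raag_hom_def)
      then show ?thesis
        using that raag_hom_hom[OF G] unfolding topQ topR by blast
    qed
    have ev: "continuous_map ?Q T (\<lambda>g. raag_hom V E G g c)" if c: "c \<in> carrier (RAAG V E)" for c
    proof -
      from c obtain a where a: "a \<in> raag_words V" "c = raag_rel V E `` {a}"
        by (elim RAAG_classE)
      have "continuous_map ?Q T (\<lambda>g. word_eval G g a)"
        by (rule continuous_map_from_subtopology[OF continuous_map_word_eval[OF TG a(1)]])
      then show ?thesis
        by (rule continuous_map_eq) (simp only: topQ raag_hom_class[OF G _ a(1)] a(2))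
    qed
    show "continuous_map ?Q (compact_open_topology ?K T) (raag_hom V E G)"
      unfolding compact_open_topology_def
    proof (rule continuous_on_generated_topo)
      have "raag_hom V E G ` topspace ?Q \<subseteq> topspace (compact_open_topology ?K T)"
        using into unfolding raag_rep_space_def topspace_subtopology by (meson IntD1 image_subsetI)
      then show "raag_hom V E G ` topspace ?Q \<subseteq> \<Union> {{f \<in> extensional (topspace ?K).
          continuous_map ?K T f \<and> f ` C \<subseteq> U} |C U. compactin ?K C \<and> openin T U}"
        by (simp only: compact_open_topology_def topology_generated_by_topspace)
      fix B assume "B \<in> {{f \<in> extensional (topspace ?K).
          continuous_map ?K T f \<and> f ` C \<subseteq> U} |C U. compactin ?K C \<and> openin T U}"
      then obtain C U where B: "B = {f \<in> extensional (topspace ?K).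
          continuous_map ?K T f \<and> f ` C \<subseteq> U}"
        and C: "compactin ?K C" and U: "openin T U" by blast
      have C': "finite C" "C \<subseteq> carrier (RAAG V E)"
        using C by (auto simp: compactin_discrete_topology)
      have ext: "raag_hom V E G g \<in> extensional (topspace ?K) \<and> continuous_map ?K T (raag_hom V E G g)"
        if "g \<in> topspace ?Q" for g
        using into[OF that] T unfolding topR by (simp add: hom_def)
      have eq: "raag_hom V E G -` B \<inter> topspace ?Q
        = topspace ?Q \<inter> (\<Inter>c\<in>C. {g \<in> topspace ?Q. raag_hom V E G g c \<in> U})"
      proof (rule Set.set_eqI)
        fix g
        show "g \<in> raag_hom V E G -` B \<inter> topspace ?Q \<longleftrightarrow>
          g \<in> topspace ?Q \<inter> (\<Inter>c\<in>C. {g \<in> topspace ?Q. raag_hom V E G g c \<in> U})"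
        proof (cases "g \<in> topspace ?Q")
          case True
          then show ?thesis
            by (simp only: B vimage_eq Int_iff mem_Collect_eq INT_iff image_subset_iff
                ext[OF True] simp_thms)
        qed (simp only: Int_iff simp_thms)
      qed
      have opn: "openin ?Q {g \<in> topspace ?Q. raag_hom V E G g c \<in> U}" if "c \<in> C" for c
        by (rule openin_continuous_map_preimage[OF ev U]) (use that C' in blast)
      show "openin ?Q (raag_hom V E G -` B \<inter> topspace ?Q)"
      proof (cases "C = {}")
        case True
        then show ?thesis
          unfolding eq by (simp only: INT_empty Int_UNIV_right openin_topspace)
      next
        case False
        have "openin ?Q (\<Inter>c\<in>C. {g \<in> topspace ?Q. raag_hom V E G g c \<in> U})"
          by (rule openin_INT2[OF C'(1) False opn])
        then show ?thesis
          unfolding eq by (intro openin_Int openin_topspace)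
      qed
    qed
  qed
  moreover have "raag_hom V E G (?\<Phi> f) = f" if "f \<in> topspace ?R" for f
    by (rule hom_eq_raag_hom(2)[OF G]) (use that in \<open>simp_all only: topR Int_iff\<close>)
  moreover have "?\<Phi> (raag_hom V E G g) = g" if "g \<in> topspace ?Q" for g
  proof
    fix v
    have g: "g \<in> commuting_tuples V E G" using that unfolding topQ .
    then have arb: "v \<notin> V \<Longrightarrow> g v = undefined"
      unfolding commuting_tuples_def by (blast intro: PiE_arb)
    show "?\<Phi> (raag_hom V E G g) v = g v"
      using raag_hom_gen[OF G g, of v] arb by (cases "v \<in> V") simp_all
  qed
  ultimately show ?thesis
    unfolding homeomorphic_maps_def by (intro conjI ballI)
qed

lemma group_SO3: "group SO3"
proof (rule groupI)
  fix x assume "x \<in> carrier SO3"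
  then show "\<exists>y\<in>carrier SO3. y \<otimes>\<^bsub>SO3\<^esub> x = \<one>\<^bsub>SO3\<^esub>"
    by (intro bexI[of _ "transpose x"])
      (auto simp: SO3_def rotation_matrix_def orthogonal_matrix_def det_transpose)
qed (auto simp: SO3_def rotation_matrix_def orthogonal_matrix_mul orthogonal_matrix_id det_mul
      matrix_mul_assoc)

lemma inv_SO3: "A \<in> carrier SO3 \<Longrightarrow> inv\<^bsub>SO3\<^esub> A = transpose A"
  by (rule group.inv_equality[OF group_SO3])
    (auto simp: SO3_def rotation_matrix_def orthogonal_matrix_def det_transpose)

lemma topological_group_SO3: "topological_group SO3 SO3_topology"
  unfolding topological_group_def
proof (intro conjI)
  interpret group SO3 by (rule group_SO3)
  have closed: "A \<in> carrier SO3 \<Longrightarrow> B \<in> carrier SO3 \<Longrightarrow> A ** B \<in> carrier SO3" for A B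
    using m_closed[of A B] by (simp add: SO3_def)
  show "group SO3" by (rule group_SO3)
  show "topspace SO3_topology = carrier SO3" by (simp add: SO3_topology_def)
  have "continuous_on S (\<lambda>p. fst p ** snd p)" for S :: "((real^3^3) \<times> (real^3^3)) set"
    unfolding matrix_matrix_mult_def by (intro continuous_intros)
  then show "continuous_map (prod_topology SO3_topology SO3_topology) SO3_topology
      (\<lambda>(x, y). x \<otimes>\<^bsub>SO3\<^esub> y)"
    using closed
    by (auto simp: SO3_topology_def subtopology_Times[symmetric] euclidean_product_topology
        case_prod_unfold SO3_def)
  have "continuous_on S transpose" for S :: "(real^3^3) set"
    unfolding transpose_def by (intro continuous_intros)
  then have "continuous_map SO3_topology SO3_topology transpose"
    using inv_closed by (auto simp: SO3_topology_def inv_SO3 simp flip: Pi_iff)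
  then show "continuous_map SO3_topology SO3_topology (\<lambda>x. inv\<^bsub>SO3\<^esub> x)"
    by (rule continuous_map_eq) (simp add: SO3_topology_def inv_SO3)
qed

end

theory Submission
  imports Defs
begin

text \<open>
  A representation is a tuple of rotations that commute along the edges. Lift each rotation to a
  quaternion. Two rotations commute iff their lifts commute or anticommute: in the first case they
  share an axis (or one of them is trivial), in the second they are half turns about orthogonal axes.
  The trace function \<open>edge_trace\<close> takes the value \<open>-3\<close> in the second case and values
  \<open>\<ge> -1\<close> in the first, so the set \<open>N\<close> of edges whose lifts anticommute is locally constant.
  The space is thus the disjoint union of open strata, one for each \<open>N \<subseteq> E\<close>, and there are
  \<open>2 ^ card E\<close> of them. It remains to see that each stratum is nonempty and connected.

  A vertex outside \<open>\<Union>N\<close> has commuting lifts with all its neighbours, so its quaternion can be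
  moved to \<open>1\<close> along a straight segment without leaving the stratum. The vertices in \<open>\<Union>N\<close>
  carry half turns, that is, lines in space: equal along the edges outside \<open>N\<close>, orthogonal along
  the edges of \<open>N\<close>. The claim becomes that such line configurations exist and can be moved into
  one another (\<open>tree_or_cycle_line_connected\<close>). All motions are composed of two kinds of steps,
  rescaling spanning vectors and straight segments of vectors, and these steps extend over a new
  vertex whose constraints come from one old vertex (\<open>extend_move\<close>).

  If the graph on \<open>\<Union>N\<close> has a vertex of degree at most one in every nonempty subset, which holds for a
  tree and for a proper subset of a cycle, induction over the vertices finishes the proof. What remains
  is a cycle all of whose vertices lie in \<open>\<Union>N\<close>. Contracting the edges outside \<open>N\<close> turns it into
  a closed polygon of lines with consecutive ones orthogonal. Such a polygon with \<open>k \<ge> 4\<close> vertices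
  can be folded so that the two neighbours of some vertex coincide (\<open>polygon_fold\<close>), and a folded
  polygon is a polygon with \<open>k - 2\<close> vertices together with a repeated vertex and a pendant one.
\<close>

section \<open>Rotations as quaternions up to scaling\<close>

text \<open>The map that sends an imaginary quaternion \<open>x\<close> to the product of \<open>q\<close>, \<open>x\<close> and the
  conjugate of \<open>q\<close>, where \<open>q\<close> has real part \<open>fst q\<close> and imaginary part \<open>snd q\<close>. For a unit
  quaternion it is a rotation.\<close>

definition qmat :: "real \<times> (real^3) \<Rightarrow> real^3^3" where
  "qmat q = matrix (\<lambda>x. ((fst q)\<^sup>2 - snd q \<bullet> snd q) *\<^sub>R x
      + (2 * (snd q \<bullet> x)) *\<^sub>R snd q + (2 * fst q) *\<^sub>R cross3 (snd q) x)"

text \<open>Dividing by the squared norm makes the rotation depend on the line through \<open>q\<close> only, so that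
  segments of nonzero quaternions can be used as paths without normalisation.\<close>

definition rotq :: "real \<times> (real^3) \<Rightarrow> real^3^3" where
  "rotq q = (1 / (q \<bullet> q)) *\<^sub>R qmat q"

definition qmul :: "real \<times> (real^3) \<Rightarrow> real \<times> (real^3) \<Rightarrow> real \<times> (real^3)" where
  "qmul p q = (fst p * fst q - snd p \<bullet> snd q,
     fst p *\<^sub>R snd q + fst q *\<^sub>R snd p + cross3 (snd p) (snd q))"

lemma qmat_components:
  "qmat (a, v) $ 1 $ 1 = a\<^sup>2 + (v$1)\<^sup>2 - (v$2)\<^sup>2 - (v$3)\<^sup>2"
  "qmat (a, v) $ 2 $ 2 = a\<^sup>2 - (v$1)\<^sup>2 + (v$2)\<^sup>2 - (v$3)\<^sup>2"
  "qmat (a, v) $ 3 $ 3 = a\<^sup>2 - (v$1)\<^sup>2 - (v$2)\<^sup>2 + (v$3)\<^sup>2"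
  "qmat (a, v) $ 1 $ 2 = 2 * (v$1) * (v$2) - 2 * a * v$3"
  "qmat (a, v) $ 2 $ 1 = 2 * (v$1) * (v$2) + 2 * a * v$3"
  "qmat (a, v) $ 1 $ 3 = 2 * (v$1) * (v$3) + 2 * a * v$2"
  "qmat (a, v) $ 3 $ 1 = 2 * (v$1) * (v$3) - 2 * a * v$2"
  "qmat (a, v) $ 2 $ 3 = 2 * (v$2) * (v$3) - 2 * a * v$1"
  "qmat (a, v) $ 3 $ 2 = 2 * (v$2) * (v$3) + 2 * a * v$1"
  by (simp_all add: qmat_def matrix_def cross3_simps axis_def power2_eq_square)

lemma inner_quat: "(a, v) \<bullet> (b, w) = a * b + v$1 * w$1 + v$2 * w$2 + v$3 * w$3" for v w :: "real^3"
  by (simp add: inner_vec_def sum_3)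

lemma qmul_components:
  "fst (qmul (a, v) (b, w)) = a * b - v$1 * w$1 - v$2 * w$2 - v$3 * w$3"
  "snd (qmul (a, v) (b, w)) $ 1 = a * w$1 + b * v$1 + v$2 * w$3 - v$3 * w$2"
  "snd (qmul (a, v) (b, w)) $ 2 = a * w$2 + b * v$2 + v$3 * w$1 - v$1 * w$3"
  "snd (qmul (a, v) (b, w)) $ 3 = a * w$3 + b * v$3 + v$1 * w$2 - v$2 * w$1"
  by (simp_all add: qmul_def cross3_simps)

lemma qmat_mult: "qmat p ** qmat q = qmat (qmul p q)"
proof -
  obtain a v b w where pq: "p = (a, v)" "q = (b, w)" by (cases p, cases q) auto
  obtain c u where cu: "qmul (a, v) (b, w) = (c, u)" by fastforce
  have *: "c = a * b - v$1 * w$1 - v$2 * w$2 - v$3 * w$3"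
    "u $ 1 = a * w$1 + b * v$1 + v$2 * w$3 - v$3 * w$2"
    "u $ 2 = a * w$2 + b * v$2 + v$3 * w$1 - v$1 * w$3"
    "u $ 3 = a * w$3 + b * v$3 + v$1 * w$2 - v$2 * w$1"
    using qmul_components[of a v b w] by (simp_all add: cu)
  show ?thesis
    unfolding pq cu
    by (simp only: vec_eq_iff forall_3 matrix_matrix_mult_def vec_lambda_beta sum_3 qmat_components *)
       (intro conjI; algebra)
qed

lemma qmul_norm: "qmul p q \<bullet> qmul p q = (p \<bullet> p) * (q \<bullet> q)"
proof -
  obtain a v b w where pq: "p = (a, v)" "q = (b, w)" by (cases p, cases q) auto
  have "qmul p q = (fst (qmul p q), snd (qmul p q))" by simp
  then have e: "qmul p q \<bullet> qmul p q = (fst (qmul p q))\<^sup>2 + (snd (qmul p q) $ 1)\<^sup>2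
    + (snd (qmul p q) $ 2)\<^sup>2 + (snd (qmul p q) $ 3)\<^sup>2"
    by (metis inner_quat power2_eq_square)
  then show ?thesis
    by (simp only: e[unfolded pq] pq qmul_components inner_quat) algebra
qed

lemma rotq_mult: "rotq p ** rotq q = rotq (qmul p q)"
  by (simp add: rotq_def qmul_norm matrix_scalar_ac flip: qmat_mult scalar_matrix_assoc)

lemma rotq_real: "a \<noteq> 0 \<Longrightarrow> rotq (a, 0) = mat 1"
  by (simp add: rotq_def vec_eq_iff forall_3 qmat_components mat_def power2_eq_square)

lemma transpose_rotq: "transpose (rotq (a, v)) = rotq (a, - v)"
  by (simp add: rotq_def vec_eq_iff forall_3 qmat_components transpose_def)

lemma qmul_conj: "qmul (a, - v) (a, v) = ((a, v) \<bullet> (a, v), 0)"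
  by (simp add: qmul_def)

lemma rotq_in_SO3: "q \<noteq> 0 \<Longrightarrow> rotq q \<in> carrier SO3"
proof -
  assume "q \<noteq> 0"
  obtain a v where q: "q = (a, v)" by (cases q)
  have n: "(a, v) \<bullet> (a, v) \<noteq> 0" using \<open>q \<noteq> 0\<close> by (simp only: q inner_eq_zero_iff not_False_eq_True)
  then have "transpose (rotq q) ** rotq q = mat 1"
    by (simp only: q transpose_rotq rotq_mult qmul_conj rotq_real not_False_eq_True)
  then have o: "orthogonal_matrix (rotq q)"
    by (simp add: orthogonal_matrix)
  have "det (qmat q) = (q \<bullet> q) ^ 3"
    unfolding q by (simp only: det_3 qmat_components inner_quat) algebra
  moreover have "det (c *\<^sub>R M) = c ^ 3 * det M" for c and M :: "real^3^3"
    by (simp add: det_3 power3_eq_cube algebra_simps)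
  ultimately have "det (rotq q) = 1"
    using \<open>q \<noteq> 0\<close> by (simp add: rotq_def power_divide)
  with o show ?thesis by (simp add: SO3_def rotation_matrix_def)
qed

lemma trace_rotq:
  assumes "q \<noteq> 0"
  shows "trace (rotq q) = 4 * ((fst q)\<^sup>2 / (q \<bullet> q)) - 1"
proof -
  obtain a v where q: "q = (a, v)" by (cases q)
  have n: "q \<bullet> q \<noteq> 0" using assms by simp
  have "trace (qmat q) = 4 * a\<^sup>2 - q \<bullet> q"
    unfolding q by (simp only: trace_def sum_3 qmat_components inner_quat) algebra
  moreover have "trace (c *\<^sub>R M) = c * trace M" for c and M :: "real^3^3"
    by (simp add: trace_def sum_3 algebra_simps)
  ultimately show ?thesis
    using n by (simp add: rotq_def diff_divide_distrib) (simp add: q)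
qed

lemma rotq_scale:
  assumes "c \<noteq> 0"
  shows "rotq (c *\<^sub>R q) = rotq q"
proof -
  obtain a v where q: "q = (a, v)" by (cases q)
  have "qmat (c *\<^sub>R q) = (c * c) *\<^sub>R qmat q"
    unfolding q by (simp add: vec_eq_iff forall_3 qmat_components) (intro conjI; algebra)
  with assms show ?thesis by (simp add: rotq_def)
qed

lemma continuous_on_rotq: "continuous_on {q. q \<noteq> 0} rotq"
  unfolding rotq_def qmat_def matrix_def
  by (intro continuous_intros continuous_on_vec_lambda continuous_on_cross) auto

text \<open>The two products of the lifts are equal or opposite, and opposite quaternions give the same
  rotation.\<close>

lemma rotq_commute_if:
  assumes "cross3 (snd p) (snd q) = 0 \<or> (fst p = 0 \<and> fst q = 0 \<and> snd p \<bullet> snd q = 0)"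
  shows "rotq p ** rotq q = rotq q ** rotq p"
proof -
  have "qmul q p = qmul p q \<or> qmul q p = (-1) *\<^sub>R qmul p q"
    using assms cross_skew[of "snd p" "snd q"] by (auto simp: qmul_def inner_commute)
  then show ?thesis
    by (metis rotq_mult rotq_scale zero_neq_neg_one)
qed

text \<open>The products \<open>(s, m + c)\<close> and \<open>(s, m - c)\<close> of the lifts in both orders have the same
  rotation matrix. Its skew part gives \<open>s c = 0\<close> and its symmetric part that \<open>m c\<^sup>T\<close> is skew;
  since \<open>m\<close> is orthogonal to \<open>c\<close>, the assumption \<open>c \<noteq> 0\<close> forces \<open>s\<close> and \<open>m\<close> to vanish.\<close>

lemma rotq_commute_cases:
  assumes "p \<noteq> 0" "q \<noteq> 0" "rotq p ** rotq q = rotq q ** rotq p"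
  shows "cross3 (snd p) (snd q) = 0 \<or> (fst p = 0 \<and> fst q = 0 \<and> snd p \<bullet> snd q = 0)"
proof (cases "cross3 (snd p) (snd q) = 0")
  case c0: False
  obtain a v b w where pq: "p = (a, v)" "q = (b, w)" by (cases p, cases q) auto
  define s where "s = a * b - v \<bullet> w"
  define m where "m = a *\<^sub>R w + b *\<^sub>R v"
  define c where "c = cross3 v w"
  have c: "c \<noteq> 0" using c0 by (simp add: pq c_def)
  have 1: "qmul p q = (s, m + c)" "qmul q p = (s, m - c)"
    by (simp_all add: pq qmul_def s_def m_def c_def inner_commute cross_skew[of w v])
  have mc: "m \<bullet> c = 0"
    by (simp add: m_def c_def inner_add_left dot_cross_self)
  have "qmul p q \<bullet> qmul p q = qmul q p \<bullet> qmul q p"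
    by (simp add: qmul_norm)
  moreover have "qmul p q \<bullet> qmul p q \<noteq> 0"
    using assms by (simp add: qmul_norm)
  moreover have "rotq (qmul p q) = rotq (qmul q p)"
    using assms(3) by (simp only: rotq_mult)
  ultimately have e: "qmat (s, m + c) = qmat (s, m - c)"
    unfolding rotq_def 1 by auto
  note e' = arg_cong[OF e, of "\<lambda>M. M $ i $ j" for i j]
  have "s * c$1 = 0" "s * c$2 = 0" "s * c$3 = 0"
    using e'[of 3 2] e'[of 2 3] e'[of 1 3] e'[of 3 1] e'[of 2 1] e'[of 1 2]
    unfolding qmat_components by (simp_all add: algebra_simps)
  with c have s: "s = 0" by (auto simp: vec_eq_iff forall_3)
  have d: "m$1 * c$1 = m$2 * c$2 + m$3 * c$3" "m$2 * c$2 = m$1 * c$1 + m$3 * c$3"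
    using e'[of 1 1] e'[of 2 2] unfolding qmat_components vector_add_component vector_minus_component
    by algebra+
  moreover have "m$1 * c$1 + m$2 * c$2 + m$3 * c$3 = 0"
    using mc by (simp add: inner_vec_def sum_3)
  ultimately have "m$1 * c$1 = 0" "m$2 * c$2 = 0" "m$3 * c$3 = 0"
    by linarith+
  moreover have "m$1 * c$2 + m$2 * c$1 = 0" "m$1 * c$3 + m$3 * c$1 = 0" "m$2 * c$3 + m$3 * c$2 = 0"
    using e'[of 1 2] e'[of 2 1] e'[of 1 3] e'[of 3 1] e'[of 2 3] e'[of 3 2] unfolding qmat_components vector_add_component vector_minus_component by algebra+
  moreover have "c$1 \<noteq> 0 \<or> c$2 \<noteq> 0 \<or> c$3 \<noteq> 0" using c by (auto simp: vec_eq_iff forall_3)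
  ultimately have "m$1 = 0 \<and> m$2 = 0 \<and> m$3 = 0" by auto
  then have m: "m = 0" by (simp add: vec_eq_iff forall_3)
  have "cross3 v m = a *\<^sub>R c" "cross3 m w = b *\<^sub>R c"
    by (simp_all add: m_def c_def cross_add_left cross_add_right cross_mult_left cross_mult_right)
  with m c have "a = 0" "b = 0" by auto
  with s show ?thesis by (simp add: s_def pq)
qed simp

text \<open>Such a matrix is a plane rotation, and its lift comes from the half-angle formula. The angle
  \<open>\<pi>\<close> is separate because there the real part \<open>1 + c\<close> of the lift degenerates.\<close>

lemma rotq_surj_fixing_axis:
  assumes A: "rotation_matrix A" and Ae: "A *v axis 3 1 = axis 3 1"
  shows "\<exists>q. q \<noteq> 0 \<and> A = rotq q"
proof -
  have o: "transpose A ** A = mat 1" and d: "det A = 1"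
    using A by (auto simp: rotation_matrix_def orthogonal_matrix)
  have "transpose A *v axis 3 1 = (transpose A ** A) *v axis 3 1"
    by (simp add: Ae flip: matrix_vector_mul_assoc)
  then have Ae': "transpose A *v axis 3 1 = axis 3 1" by (simp add: o)
  have z: "A$1$3 = 0" "A$2$3 = 0" "A$3$3 = 1" "A$3$1 = 0" "A$3$2 = 0"
    using Ae Ae' by (auto simp: vec_eq_iff forall_3 matrix_vector_mult_def sum_3 axis_def transpose_def)
  have n: "(A$1$1)\<^sup>2 + (A$2$1)\<^sup>2 = 1" "(A$1$2)\<^sup>2 + (A$2$2)\<^sup>2 = 1"
    using o z by (auto simp: vec_eq_iff forall_3 matrix_matrix_mult_def sum_3 transpose_def mat_def power2_eq_square)
  have d': "A$1$1 * A$2$2 - A$1$2 * A$2$1 = 1"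
    using d z by (simp add: det_3)
  \<comment> \<open>The two columns have length one and determinant one, so the second is the first turned by a
    right angle.\<close>
  have "(A$1$1 - A$2$2)\<^sup>2 + (A$1$2 + A$2$1)\<^sup>2 = 0"
    using n d' by algebra
  then have e: "A$2$2 = A$1$1" "A$1$2 = - A$2$1"
    by (auto simp: sum_power2_eq_zero_iff)
  have ax: "(axis 3 1 :: real^3) $ 1 = 0" "(axis 3 1 :: real^3) $ 2 = 0" "(axis 3 1 :: real^3) $ 3 = 1"
    by (simp_all add: axis_def)
  show ?thesis
  proof (cases "A$1$1 = -1")
    case True
    with n have "A$2$1 = 0" by simp
    then have "A = rotq (0, axis 3 1)"
      using z e True by (simp add: rotq_def vec_eq_iff forall_3 qmat_components inner_axis_axis ax)
    moreover have "(0, axis 3 1) \<noteq> (0 :: real \<times> (real^3))"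
      by (simp add: zero_prod_def axis_eq_0_iff)
    ultimately show ?thesis by blast
  next
    case False
    define c s where "c = A$1$1" and "s = A$2$1"
    have cs: "c\<^sup>2 + s\<^sup>2 = 1" "1 + c \<noteq> 0" using n False by (auto simp: c_def s_def)
    \<comment> \<open>With \<open>c\<close> and \<open>s\<close> the cosine and sine of the angle, this is a multiple of the unit quaternion
      with half the angle.\<close>
    let ?q = "(1 + c, s *\<^sub>R axis 3 1) :: real \<times> (real^3)"
    have "?q \<bullet> ?q = 2 * (1 + c)" using cs(1) 
      by (simp add: inner_axis_axis power2_eq_square algebra_simps)
    then have "A = rotq ?q"
      using z e cs
      by (simp add: rotq_def vec_eq_iff forall_3 qmat_components c_def[symmetric] s_def[symmetric] ax)
        (simp add: field_simps power2_eq_square)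
    then show ?thesis using cs by (intro exI[of _ ?q]) (auto simp: zero_prod_def)
  qed
qed

lemma rotq_half_turn:
  assumes "u \<noteq> 0"
  shows "rotq (0, u) *v x = (2 * (u \<bullet> x) / (u \<bullet> u)) *\<^sub>R u - x"
proof -
  have "u \<bullet> u \<noteq> 0" using assms by simp
  moreover have "linear (\<lambda>x. (- (u \<bullet> u)) *\<^sub>R x + (2 * (u \<bullet> x)) *\<^sub>R u)"
    by (intro linearI) (auto simp: algebra_simps)
  ultimately show ?thesis
    by (simp add: rotq_def qmat_def matrix_works scaleR_matrix_vector_assoc[symmetric] algebra_simps)
qed

text \<open>A half turn about the bisector of \<open>A e\<^sub>3\<close> and \<open>e\<^sub>3\<close> carries \<open>A e\<^sub>3\<close> back to \<open>e\<^sub>3\<close>,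
  which reduces the claim to rotations with a known axis.\<close>

lemma rotq_surj:
  assumes A: "A \<in> carrier SO3"
  obtains q where "q \<noteq> 0" "A = rotq q"
proof -
  let ?e = "axis 3 1 :: real^3"
  have rA: "rotation_matrix A" using A by (simp add: SO3_def)
  define p where "p = A *v ?e"
  have "norm p = norm ?e"
    using rA unfolding p_def rotation_matrix_def
    by (metis orthogonal_transformation_matrix orthogonal_transformation_norm matrix_of_matrix_vector_mul matrix_vector_mul_linear)
  then have pp: "p \<bullet> p = 1" by (simp add: norm_eq_1)
  have "\<exists>u. u \<noteq> 0 \<and> rotq (0, u) *v p = ?e"
  proof (cases "p + ?e = 0")
    case True
    \<comment> \<open>There is no bisector, but the half turn about any orthogonal axis reverses the direction.\<close>
    then have "p = - ?e" by (simp add: eq_neg_iff_add_eq_0)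
    then show ?thesis
      by (intro exI[of _ "axis 1 1"]) (auto simp: rotq_half_turn axis_eq_0_iff inner_axis_axis)
  next
    case False
    then have n: "(p + ?e) \<bullet> (p + ?e) \<noteq> 0" by simp
    have "(p + ?e) \<bullet> (p + ?e) = 2 * ((p + ?e) \<bullet> p)"
      using pp by (simp add: inner_add_left inner_add_right inner_axis_axis inner_commute)
    with n have "2 * ((p + ?e) \<bullet> p) / ((p + ?e) \<bullet> (p + ?e)) = 1" by simp
    then show ?thesis
      by (intro exI[of _ "p + ?e"]) (simp only: rotq_half_turn[OF False] False, simp)
  qed
  then obtain u where u: "u \<noteq> 0" "rotq (0, u) *v p = ?e" by blast
  then have "rotq (0, u) \<in> carrier SO3" by (intro rotq_in_SO3) (auto simp: zero_prod_def)
  then have "rotation_matrix (rotq (0, u))" by (simp add: SO3_def)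
  then have "rotation_matrix (rotq (0, u) ** A)"
    using rA by (auto simp: rotation_matrix_def orthogonal_matrix_mul det_mul)
  moreover have "(rotq (0, u) ** A) *v ?e = ?e"
    using u by (simp add: p_def flip: matrix_vector_mul_assoc)
  ultimately obtain q where q: "q \<noteq> 0" "rotq (0, u) ** A = rotq q"
    using rotq_surj_fixing_axis by metis
  have uu: "rotq (0, u) ** rotq (0, u) = mat 1"
    using u(1) by (simp add: rotq_mult qmul_def rotq_real)
  have "A = (rotq (0, u) ** rotq (0, u)) ** A" by (simp only: uu matrix_mul_lid)
  also have "\<dots> = rotq (0, u) ** rotq q"
    by (simp only: q(2) flip: matrix_mul_assoc)
  also have "\<dots> = rotq (qmul (0, u) q)" by (rule rotq_mult)
  finally have "A = rotq (qmul (0, u) q)" .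
  moreover have "qmul (0, u) q \<bullet> qmul (0, u) q \<noteq> 0"
    using u q by (simp add: qmul_norm)
  ultimately show ?thesis using that[of "qmul (0, u) q"] by auto
qed

text \<open>Half turns about orthogonal axes and their product, again a half turn, have trace \<open>-1\<close>.\<close>

lemma trace_sum_anticommuting:
  assumes "p \<noteq> 0" "q \<noteq> 0" "fst p = 0" "fst q = 0" "snd p \<bullet> snd q = 0"
  shows "trace (rotq p) + trace (rotq q) + trace (rotq p ** rotq q) = -3"
proof -
  have "qmul p q \<bullet> qmul p q \<noteq> 0" using assms by (simp add: qmul_norm)
  then have "qmul p q \<noteq> 0" by auto
  with assms show ?thesis by (simp add: rotq_mult trace_rotq) (simp add: qmul_def)
qed

text \<open>The sum of the traces measures the squared real parts \<open>\<alpha>\<close>, \<open>\<beta>\<close>, \<open>\<gamma>\<close> of the normalised lifts and of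
  their product. They cannot all be small: if the factors are nearly imaginary, then, being parallel,
  they have a nearly real product. The value \<open>-1\<close> is not optimal; what counts is the gap to \<open>-3\<close>.\<close>

lemma trace_sum_common_axis:
  assumes "p \<noteq> 0" "q \<noteq> 0" "cross3 (snd p) (snd q) = 0"
  shows "trace (rotq p) + trace (rotq q) + trace (rotq p ** rotq q) \<ge> -1"
proof -
  have pq: "p \<bullet> p > 0" "q \<bullet> q > 0" using assms by auto
  have n: "qmul p q \<bullet> qmul p q \<noteq> 0" using assms by (simp add: qmul_norm)
  then have n': "qmul p q \<noteq> 0" by auto
  obtain a v b w where e: "p = (a, v)" "q = (b, w)" by (cases p, cases q) auto
  define m n where "m = p \<bullet> p" and "n = q \<bullet> q"
  have mn: "m > 0" "n > 0" using pq by (auto simp: m_def n_def)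
  define y where "y = v \<bullet> w"
  have "y\<^sup>2 = (v \<bullet> v) * (w \<bullet> w)"
    using dot_cross[of v w v w] assms(3) by (simp add: e y_def power2_eq_square inner_commute)
  moreover have vv: "v \<bullet> v = m - a\<^sup>2" "w \<bullet> w = n - b\<^sup>2" by (simp_all add: m_def n_def e power2_eq_square)
  ultimately have y2: "y\<^sup>2 = (m - a\<^sup>2) * (n - b\<^sup>2)" by simp
  define \<alpha> \<beta> \<gamma> where "\<alpha> = a\<^sup>2 / m" and "\<beta> = b\<^sup>2 / n" and "\<gamma> = (a * b - y)\<^sup>2 / (m * n)"
  have "0 \<le> v \<bullet> v" "0 \<le> w \<bullet> w" by simp_all
  then have ab: "0 \<le> \<alpha>" "\<alpha> \<le> 1" "0 \<le> \<beta>" "\<beta> \<le> 1"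
    using mn vv by (auto simp: \<alpha>_def \<beta>_def)
  have "y\<^sup>2 \<le> 2 * (a * b - y)\<^sup>2 + 2 * (a * b)\<^sup>2"
    using zero_le_power2[of "2 * (a * b) - y"] by (simp add: power2_eq_square algebra_simps)
  then have "y\<^sup>2 / (m * n) \<le> (2 * (a * b - y)\<^sup>2 + 2 * (a * b)\<^sup>2) / (m * n)"
    using mn by (intro divide_right_mono) auto
  also have "\<dots> = 2 * \<gamma> + 2 * (\<alpha> * \<beta>)"
    by (simp add: \<gamma>_def \<alpha>_def \<beta>_def add_divide_distrib power_mult_distrib)
  also have "y\<^sup>2 / (m * n) = (1 - \<alpha>) * (1 - \<beta>)"
    using mn by (simp add: y2 \<alpha>_def \<beta>_def field_simps)
  finally have "(1 - \<alpha>) * (1 - \<beta>) \<le> 2 * \<gamma> + 2 * (\<alpha> * \<beta>)" .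
  moreover have "\<alpha> * \<beta> \<le> \<alpha>" using ab mult_left_mono[of \<beta> 1 \<alpha>] by simp
  ultimately have "\<alpha> + \<beta> + \<gamma> \<ge> 1 / 2" using ab by (simp add: algebra_simps)
  moreover have "trace (rotq p) = 4 * \<alpha> - 1" "trace (rotq q) = 4 * \<beta> - 1"
    "trace (rotq p ** rotq q) = 4 * \<gamma> - 1"
    using assms n' by (simp_all add: trace_rotq rotq_mult qmul_norm \<alpha>_def \<beta>_def \<gamma>_def m_def n_def)
      (simp_all add: e qmul_def y_def)
  ultimately show ?thesis by simp
qed

section \<open>Configurations of lines and their motions\<close>

text \<open>A vector \<open>x v\<close> stands for the line that it spans. Edges in \<open>N\<close> join orthogonal lines, the
  other edges equal lines.\<close>

definition line_config :: "'v set \<Rightarrow> 'v set set \<Rightarrow> 'v set set \<Rightarrow> ('v \<Rightarrow> real^3) \<Rightarrow> bool" where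
  "line_config F E N x \<longleftrightarrow> (\<forall>v\<in>F. x v \<noteq> 0) \<and>
     (\<forall>u\<in>F. \<forall>v\<in>F. {u, v} \<in> E \<longrightarrow> 
        ({u, v} \<in> N \<longrightarrow> x u \<bullet> x v = 0) \<and> ({u, v} \<notin> N \<longrightarrow> cross3 (x u) (x v) = 0))"

text \<open>The elementary motions. In a segment step all constraints are bilinear, so it suffices that they
  hold at the endpoints and at the midpoint; the positive inner products keep the vectors away from
  zero. Vectors are not normalised because bilinearity would be lost on the sphere.\<close>

inductive line_move for F :: "'v set" and E N :: "'v set set" where
  rescale: "line_config F E N x \<Longrightarrow> (\<And>v. v \<in> F \<Longrightarrow> \<exists>c. c \<noteq> 0 \<and> y v = c *\<^sub>R x v) \<Longrightarrow> line_move F E N x y"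
| segment: "line_config F E N x \<Longrightarrow> line_config F E N y \<Longrightarrow> line_config F E N (\<lambda>v. x v + y v) \<Longrightarrow>
    (\<And>v. v \<in> F \<Longrightarrow> x v \<bullet> y v > 0) \<Longrightarrow> line_move F E N x y"

abbreviation line_reach :: "'v set \<Rightarrow> 'v set set \<Rightarrow> 'v set set \<Rightarrow> ('v \<Rightarrow> real^3) \<Rightarrow> ('v \<Rightarrow> real^3) \<Rightarrow> bool" where
  "line_reach F E N \<equiv> (line_move F E N)\<^sup>*\<^sup>*"

text \<open>Nonemptiness is included so that existence and connectedness are proved by one induction.\<close>

definition line_connected :: "'v set \<Rightarrow> 'v set set \<Rightarrow> 'v set set \<Rightarrow> bool" where
  "line_connected F E N \<longleftrightarrow> (\<exists>x. line_config F E N x) \<and>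
     (\<forall>x y. line_config F E N x \<longrightarrow> line_config F E N y \<longrightarrow> line_reach F E N x y)"

lemma line_configD:
  assumes "line_config F E N x"
  shows "v \<in> F \<Longrightarrow> x v \<noteq> 0"
    and "\<lbrakk>u \<in> F; v \<in> F; {u, v} \<in> E; {u, v} \<in> N\<rbrakk> \<Longrightarrow> x u \<bullet> x v = 0"
    and "\<lbrakk>u \<in> F; v \<in> F; {u, v} \<in> E; {u, v} \<notin> N\<rbrakk> \<Longrightarrow> cross3 (x u) (x v) = 0"
  using assms unfolding line_config_def by blast+

lemma line_configI:
  assumes "\<And>v. v \<in> F \<Longrightarrow> x v \<noteq> 0"
    and "\<And>u v. \<lbrakk>u \<in> F; v \<in> F; {u, v} \<in> E; {u, v} \<in> N\<rbrakk> \<Longrightarrow> x u \<bullet> x v = 0"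
    and "\<And>u v. \<lbrakk>u \<in> F; v \<in> F; {u, v} \<in> E; {u, v} \<notin> N\<rbrakk> \<Longrightarrow> cross3 (x u) (x v) = 0"
  shows "line_config F E N x"
  unfolding line_config_def by (intro conjI ballI impI) (fact assms)+

lemma line_config_rescale:
  assumes x: "line_config F E N x" and y: "\<And>v. v \<in> F \<Longrightarrow> \<exists>c. c \<noteq> 0 \<and> y v = c *\<^sub>R x v"
  shows "line_config F E N y"
proof (rule line_configI)
  fix v assume "v \<in> F"
  with y line_configD(1)[OF x] show "y v \<noteq> 0" by fastforce
next
  fix u v assume uv: "u \<in> F" "v \<in> F" "{u, v} \<in> E" "{u, v} \<in> N"
  with y obtain c d where "y u = c *\<^sub>R x u" "y v = d *\<^sub>R x v" by meson
  with line_configD(2)[OF x uv] show "y u \<bullet> y v = 0" by simp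
next
  fix u v assume uv: "u \<in> F" "v \<in> F" "{u, v} \<in> E" "{u, v} \<notin> N"
  with y obtain c d where "y u = c *\<^sub>R x u" "y v = d *\<^sub>R x v" by meson
  with line_configD(3)[OF x uv] show "cross3 (y u) (y v) = 0" by (simp add: cross_mult_left cross_mult_right)
qed

lemma line_config_cong:
  "(\<And>v. v \<in> F \<Longrightarrow> x v = y v) \<Longrightarrow> line_config F E N x \<longleftrightarrow> line_config F E N y"
  unfolding line_config_def by (simp cong: ball_cong)

lemma line_config_mono: "line_config F E N x \<Longrightarrow> F' \<subseteq> F \<Longrightarrow> line_config F' E N x"
  unfolding line_config_def by blast

lemma line_move_config: "line_move F E N x y \<Longrightarrow> line_config F E N x \<and> line_config F E N y"
proof (induction rule: line_move.induct)
  case (rescale x y)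
  then show ?case using line_config_rescale[OF rescale] by simp
qed simp

lemma line_reach_config: "line_reach F E N x y \<Longrightarrow> line_config F E N x \<Longrightarrow> line_config F E N y"
  by (induction rule: rtranclp_induct) (simp_all add: line_move_config)

lemma line_move_sym: "line_move F E N x y \<Longrightarrow> line_move F E N y x"
proof (induction rule: line_move.induct)
  case (rescale x y)
  then have "\<exists>c. c \<noteq> 0 \<and> x v = c *\<^sub>R y v" if v: "v \<in> F" for v
  proof -
    obtain c where "c \<noteq> 0" "y v = c *\<^sub>R x v" using rescale(2)[OF v] by blast
    then show ?thesis by (intro exI[of _ "inverse c"]) simp
  qed
  then show ?case using line_config_rescale[OF rescale] by (rule line_move.rescale[rotated])
next
  case (segment x y)
  then show ?case by (intro line_move.segment) (simp_all add: add.commute inner_commute)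
qed

lemma line_reach_sym: "line_reach F E N x y \<Longrightarrow> line_reach F E N y x"
  by (induction rule: rtranclp_induct) (blast intro: line_move_sym converse_rtranclp_into_rtranclp)+

lemma line_move_agree: "line_config F E N x \<Longrightarrow> (\<And>v. v \<in> F \<Longrightarrow> x v = y v) \<Longrightarrow> line_move F E N x y"
  by (rule line_move.rescale, assumption, rule exI[of _ 1]) simp

text \<open>With all other vectors fixed, the constraints on one vector are linear.\<close>

lemma vertex_segment:
  assumes x: "line_config F E N x" and y: "line_config F E N (x(v := q))"
    and v: "v \<in> F" "{v} \<notin> E" and pos: "x v \<bullet> q > 0"
  shows "line_move F E N x (x(v := q))"
proof (rule line_move.segment[OF x y])
  let ?y = "x(v := q)"
  show pos': "x u \<bullet> ?y u > 0" if "u \<in> F" for u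
    using pos line_configD(1)[OF x that] by auto
  show "line_config F E N (\<lambda>w. x w + ?y w)"
  proof (rule line_configI)
    fix u assume u: "u \<in> F"
    show "x u + ?y u \<noteq> 0"
    proof
      assume "x u + ?y u = 0"
      then have "x u \<bullet> x u + x u \<bullet> ?y u = 0" by (metis inner_add_right inner_zero_right)
      with pos'[OF u] show False by (smt (verit) inner_ge_zero)
    qed
  next
    fix u w assume uw: "u \<in> F" "w \<in> F" "{u, w} \<in> E" "{u, w} \<in> N"
    show "(x u + ?y u) \<bullet> (x w + ?y w) = 0"
      using line_configD(2)[OF x uw] line_configD(2)[OF y uw] uw(3) v(2)
      by (auto simp: inner_add_left inner_add_right split: if_splits)
  next
    fix u w assume uw: "u \<in> F" "w \<in> F" "{u, w} \<in> E" "{u, w} \<notin> N"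
    show "cross3 (x u + ?y u) (x w + ?y w) = 0"
      using line_configD(3)[OF x uw] line_configD(3)[OF y uw] uw(3) v(2)
      by (auto simp: cross_add_left cross_add_right split: if_splits)
  qed
qed

lemma line_config_vertex_combination:
  assumes x: "line_config F E N x" and y: "line_config F E N (x(v := q))"
    and v: "v \<in> F" "{v} \<notin> E" and nz: "a *\<^sub>R x v + b *\<^sub>R q \<noteq> 0"
  shows "line_config F E N (x(v := a *\<^sub>R x v + b *\<^sub>R q))"
proof (rule line_configI)
  let ?y = "x(v := q)" and ?z = "x(v := a *\<^sub>R x v + b *\<^sub>R q)"
  show "?z u \<noteq> 0" if "u \<in> F" for u
    using nz line_configD(1)[OF x that] by auto
  show "?z u \<bullet> ?z w = 0" if uw: "u \<in> F" "w \<in> F" "{u, w} \<in> E" "{u, w} \<in> N" for u w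
      using line_configD(2)[OF x uw] line_configD(2)[OF y uw] uw(3) v(2)
      by (auto simp: inner_add_left inner_add_right split: if_splits)
  show "cross3 (?z u) (?z w) = 0" if uw: "u \<in> F" "w \<in> F" "{u, w} \<in> E" "{u, w} \<notin> N" for u w
      using line_configD(3)[OF x uw] line_configD(3)[OF y uw] uw(3) v(2)
      by (auto simp: cross_add_left cross_add_right cross_mult_left cross_mult_right split: if_splits)
qed

text \<open>Either the segment between the two vectors works, or the one to the opposite vector, or, in the
  orthogonal case, the detour through their sum.\<close>

lemma vertex_reach:
  assumes x: "line_config F E N x" and y: "line_config F E N (x(v := q))"
    and v: "v \<in> F" "{v} \<notin> E"
  shows "line_reach F E N x (x(v := q))"
proof -
  have pos: ?thesis if "x v \<bullet> q > 0"
    using vertex_segment[OF x y v that] by blast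
  consider "x v \<bullet> q > 0" | "x v \<bullet> q < 0" | "x v \<bullet> q = 0" by linarith
  then show ?thesis
  proof cases
    case 2
    let ?y = "x(v := - q)"
    have "line_config F E N ?y"
      using line_config_vertex_combination[OF x y v, of 0 "-1"] line_configD(1)[OF y v(1)] by simp
    then have 1: "line_move F E N x ?y"
      using 2 v by (intro vertex_segment x) auto
    have "line_move F E N ?y (x(v := q))"
    proof (rule line_move.rescale)
      show "\<exists>c. c \<noteq> 0 \<and> (x(v := q)) u = c *\<^sub>R ?y u" for u
        by (cases "u = v") (auto intro: exI[of _ "-1"] exI[of _ 1])
    qed fact
    with 1 show ?thesis by (meson r_into_rtranclp rtranclp.rtrancl_into_rtrancl)
  next
    case 3
    have xx: "x v \<bullet> x v > 0" "q \<bullet> q > 0"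
      using line_configD(1)[OF x v(1)] line_configD(1)[OF y v(1)] by auto
    then have p: "x v \<bullet> (x v + q) > 0" "(x v + q) \<bullet> q > 0"
      using 3 by (auto simp: inner_add_left inner_add_right)
    then have "1 *\<^sub>R x v + 1 *\<^sub>R q \<noteq> 0" by auto
    from line_config_vertex_combination[OF x y v this]
    have z: "line_config F E N (x(v := x v + q))" by simp
    have 1: "line_move F E N x (x(v := x v + q))"
      by (rule vertex_segment[OF x z v p(1)])
    have "line_move F E N (x(v := x v + q)) ((x(v := x v + q))(v := q))"
      by (rule vertex_segment[OF z _ v]) (use p y in auto)
    with 1 show ?thesis by (simp add: converse_rtranclp_into_rtranclp)
  qed (rule pos)
qed

text \<open>Two vertices move together, one of them following the other through the linear map
  \<open>r \<mapsto> r \<times> m\<close>; linearity turns this into a segment step.\<close>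

lemma pair_segment:
  fixes x :: "'v \<Rightarrow> real^3" and S :: "(real^3) set" and m :: "real^3" and i j :: "'v"
  defines "z \<equiv> \<lambda>r. x(i := r, j := cross3 r m)"
  assumes S: "subspace S" and ij: "i \<noteq> j"
    and conf: "\<And>r. r \<in> S \<Longrightarrow> r \<noteq> 0 \<Longrightarrow> line_config F E N (z r)"
    and p: "p \<in> S" and q: "q \<in> S" and pq: "p \<bullet> q > 0" "cross3 p m \<bullet> cross3 q m > 0"
  shows "line_move F E N (z p) (z q)"
proof (rule line_move.segment)
  have nz: "p \<noteq> 0" "q \<noteq> 0" "p + q \<noteq> 0"
  proof -
    show "p \<noteq> 0" "q \<noteq> 0" using pq by auto
    show "p + q \<noteq> 0"
    proof
      assume "p + q = 0"
      then have "p \<bullet> p + p \<bullet> q = 0" by (metis inner_add_right inner_zero_right)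
      with pq show False by (smt (verit) inner_ge_zero)
    qed
  qed
  then show P: "line_config F E N (z p)" and Q: "line_config F E N (z q)"
    using conf p q by auto
  have R: "line_config F E N (z (p + q))" using nz S p q by (intro conf) (auto simp: subspace_add)
  show "line_config F E N (\<lambda>v. z p v + z q v)"
  proof (rule line_config_rescale[OF R])
    fix v
    have "z p v + z q v = (if v = i \<or> v = j then 1 else 2) *\<^sub>R z (p + q) v"
      using ij by (auto simp: z_def cross_add_left scaleR_2)
    then show "\<exists>c. c \<noteq> 0 \<and> z p v + z q v = c *\<^sub>R z (p + q) v"
      by (intro exI[of _ "if v = i \<or> v = j then 1 else 2"]) auto
  qed
  show "z p v \<bullet> z q v > 0" if "v \<in> F" for v
    using pq ij line_configD(1)[OF P that] by (auto simp: z_def)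
qed

text \<open>A segment from \<open>p\<close> to \<open>q\<close> is a legal step only if both the vectors and their images under
  \<open>r \<mapsto> r \<times> m\<close> form acute angles. After a change of sign of \<open>q\<close> the vectors \<open>p\<close> and \<open>q\<close> do
  not form an obtuse angle, and the image of the intermediate vector \<open>r\<close> bisects the angle of the
  images, so that both halves of the detour through \<open>r\<close> are legal.\<close>

lemma pair_reach:
  fixes x :: "'v \<Rightarrow> real^3" and S :: "(real^3) set" and m :: "real^3" and i j :: "'v"
  defines "z \<equiv> \<lambda>r. x(i := r, j := cross3 r m)"
  assumes S: "subspace S" and ij: "i \<noteq> j" "i \<in> F" "j \<in> F"
    and conf: "\<And>r. r \<in> S \<Longrightarrow> r \<noteq> 0 \<Longrightarrow> line_config F E N (z r)"
    and p: "p \<in> S" "p \<noteq> 0" and q: "q \<in> S" "q \<noteq> 0"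
  shows "line_reach F E N (z p) (z q)"
proof -
  let ?L = "\<lambda>r. cross3 r m"
  have L: "?L r \<noteq> 0" if "r \<in> S" "r \<noteq> 0" for r
    using line_configD(1)[OF conf[OF that] ij(3)] by (simp add: z_def)
  have main: "line_reach F E N (z p) (z q)" if q: "q \<in> S" "q \<noteq> 0" and pq: "p \<bullet> q \<ge> 0" for q
  proof -
    \<comment> \<open>The weights give the two summands of the image of \<open>r\<close> the same length.\<close>
    define r where "r = norm (?L q) *\<^sub>R p + norm (?L p) *\<^sub>R q"
    have rS: "r \<in> S" using S p q by (simp add: r_def subspace_add subspace_scale)
    have n: "norm (?L p) > 0" "norm (?L q) > 0" using L p q by auto
    have pp: "p \<bullet> p > 0" "q \<bullet> q > 0" using p q by auto
    have pr: "p \<bullet> r > 0" "r \<bullet> q > 0"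
      unfolding r_def inner_add_left inner_add_right inner_scaleR_left inner_scaleR_right
      by (intro add_pos_nonneg add_nonneg_pos mult_pos_pos mult_nonneg_nonneg n pp pq; simp)+
    then have r0: "r \<noteq> 0" by auto
    define s where "s = norm (?L p) * norm (?L q) + ?L p \<bullet> ?L q"
    define A B where "A = ?L p" and "B = ?L q"
    have Lr: "?L r = norm B *\<^sub>R A + norm A *\<^sub>R B"
      by (simp add: r_def cross_add_left cross_mult_left A_def B_def)
    have AB: "A \<bullet> A = norm A * norm A" "B \<bullet> B = norm B * norm B" "B \<bullet> A = A \<bullet> B"
      by (simp_all add: norm_eq_sqrt_inner inner_commute)
    have s': "s = norm A * norm B + A \<bullet> B" by (simp add: s_def A_def B_def)
    have "?L r \<bullet> ?L r = 2 * norm A * norm B * s"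
      unfolding Lr s' inner_add_left inner_add_right inner_scaleR_left inner_scaleR_right AB by algebra
    moreover have "?L r \<bullet> ?L r > 0" using L[OF rS r0] by simp
    ultimately have "2 * norm A * norm B * s > 0" by simp
    moreover have "2 * norm A * norm B > 0" using n by (simp add: A_def B_def)
    ultimately have s: "s > 0" by (rule zero_less_mult_pos)
    have "?L p \<bullet> ?L r = norm A * s" "?L r \<bullet> ?L q = norm B * s"
      unfolding Lr s' A_def[symmetric] B_def[symmetric]
        inner_add_left inner_add_right inner_scaleR_left inner_scaleR_right AB by algebra+
    then have Lpr: "?L p \<bullet> ?L r > 0" "?L r \<bullet> ?L q > 0" using n s by (simp_all add: A_def B_def)
    have "line_move F E N (z p) (z r)" "line_move F E N (z r) (z q)"
      unfolding z_def using pair_segment[OF S ij(1) conf[unfolded z_def]] p q rS pr Lpr by blast+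
    then show ?thesis by (meson converse_rtranclp_into_rtranclp r_into_rtranclp)
  qed
  show ?thesis
  proof (cases "p \<bullet> q \<ge> 0")
    case False
    then have "line_reach F E N (z p) (z (- q))"
      using q S by (intro main) (auto simp: subspace_neg)
    moreover have "line_move F E N (z (- q)) (z q)"
    proof (rule line_move.rescale)
      show "line_config F E N (z (- q))" using q S by (intro conf) (auto simp: subspace_neg)
      show "\<exists>c. c \<noteq> 0 \<and> z q v = c *\<^sub>R z (- q) v" for v
        using ij(1) by (intro exI[of _ "if v = i \<or> v = j then -1 else 1"]) (auto simp: z_def)
    qed
    ultimately show ?thesis by (rule rtranclp.rtrancl_into_rtrancl[where r = "line_move F E N"])
  qed (use main q in auto)
qed

section \<open>Adding a vertex, thin graphs and pullbacks\<close>

lemma parallel_multiple: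
  fixes a b :: "real^3"
  assumes "cross3 a b = 0" "a \<noteq> 0" "b \<noteq> 0"
  obtains c where "c \<noteq> 0" "b = c *\<^sub>R a"
proof -
  have aa: "a \<bullet> a \<noteq> 0" using assms by simp
  have "(a \<bullet> b) *\<^sub>R a - (a \<bullet> a) *\<^sub>R b = 0"
    using Lagrange[of a a b] assms by simp
  then have "(a \<bullet> a) *\<^sub>R b = (a \<bullet> b) *\<^sub>R a" by simp
  then have "b = ((a \<bullet> b) / (a \<bullet> a)) *\<^sub>R a"
    using aa by (metis divide_inverse inverse_eq_divide mult.commute real_vector_affinity_eq scaleR_scaleR vector_fraction_eq_iff)
  with assms that show thesis by (metis scale_eq_0_iff)
qed

lemma perp_multiple:
  fixes p q r :: "real^3"
  assumes "cross3 p q \<noteq> 0" "r \<noteq> 0" "r \<bullet> p = 0" "r \<bullet> q = 0"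
  obtains c where "c \<noteq> 0" "r = c *\<^sub>R cross3 p q"
proof -
  have "cross3 (cross3 p q) r = - cross3 r (cross3 p q)" by (rule cross_skew)
  also have "\<dots> = 0" using assms by (simp add: Lagrange)
  finally show thesis using parallel_multiple assms that by blast
qed

lemma orthogonal_cross_nonzero:
  fixes p q :: "real^3"
  assumes "p \<noteq> 0" "q \<noteq> 0" "p \<bullet> q = 0"
  shows "cross3 p q \<noteq> 0"
proof
  assume "cross3 p q = 0"
  then obtain c where "c \<noteq> 0" "q = c *\<^sub>R p" using parallel_multiple assms by metis
  with assms show False by simp
qed

lemma exists_orthogonal: "\<exists>a. a \<noteq> 0 \<and> p \<bullet> a = 0" for p :: "real^3"
proof (cases "p = 0")
  case False
  then show ?thesis using cross_basis_nonzero[OF False] dot_cross_self by blast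
qed (auto intro!: exI[of _ "axis 1 1"])

lemma line_config_parallel_cong:
  assumes "cross3 a b = 0" "a \<noteq> 0" "b \<noteq> (0 :: real^3)"
  shows "a \<bullet> d = 0 \<longleftrightarrow> b \<bullet> d = 0" "cross3 a d = 0 \<longleftrightarrow> cross3 b d = 0"
proof -
  obtain c where "c \<noteq> 0" "b = c *\<^sub>R a" using parallel_multiple[OF assms] .
  then show "a \<bullet> d = 0 \<longleftrightarrow> b \<bullet> d = 0" "cross3 a d = 0 \<longleftrightarrow> cross3 b d = 0"
    by (simp_all add: cross_mult_left)
qed

lemma line_config_empty: "line_config {} E N x"
  by (simp add: line_config_def)

lemma line_connected_empty: "line_connected {} E N"
  unfolding line_connected_def
  by (auto simp: line_config_empty intro!: r_into_rtranclp line_move_agree)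

text \<open>The line at the new vertex \<open>v\<close> is constrained by the old vertex \<open>u\<close> only: further old
  neighbours \<open>w\<close> are allowed if their constraint with \<open>v\<close> follows from the one between \<open>v\<close> and
  \<open>u\<close> and the one between \<open>w\<close> and \<open>u\<close>.\<close>

definition attached :: "'v set \<Rightarrow> 'v set set \<Rightarrow> 'v set set \<Rightarrow> 'v \<Rightarrow> 'v \<Rightarrow> bool" where
  "attached F E N u v \<longleftrightarrow> u \<in> F \<and> {u, v} \<in> E \<and>
     (\<forall>w\<in>F. {w, v} \<in> E \<longrightarrow> w = u \<or>
        (if {u, v} \<in> N then {w, v} \<in> N \<and> {w, u} \<in> E \<and> {w, u} \<notin> N
         else {w, u} \<in> E \<and> ({w, u} \<in> N \<longleftrightarrow> {w, v} \<in> N)))"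

lemma line_config_insert:
  assumes v: "v \<notin> F" "{v} \<notin> E" and z: "line_config F E N z" "z v \<noteq> 0"
    and old: "\<And>w. w \<in> F \<Longrightarrow> {w, v} \<in> E \<Longrightarrow> {w, v} \<in> N \<Longrightarrow> z w \<bullet> z v = 0"
      "\<And>w. w \<in> F \<Longrightarrow> {w, v} \<in> E \<Longrightarrow> {w, v} \<notin> N \<Longrightarrow> cross3 (z w) (z v) = 0"
  shows "line_config (insert v F) E N z"
proof (rule line_configI)
  show "z w \<noteq> 0" if "w \<in> insert v F" for w
    using that z(2) line_configD(1)[OF z(1)] by auto
next
  fix u w assume uw: "u \<in> insert v F" "w \<in> insert v F" "{u, w} \<in> E" "{u, w} \<in> N"
  consider "u = v" "w = v" | "u = v" "w \<in> F" | "u \<in> F" "w = v" | "u \<in> F" "w \<in> F" using uw by blast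
  then show "z u \<bullet> z w = 0"
  proof cases
    case 2
    then have "z w \<bullet> z u = 0" using uw old(1)[of w] by (simp add: insert_commute)
    then show ?thesis by (simp add: inner_commute)
  qed (use uw v old line_configD(2)[OF z(1)] in auto)
next
  fix u w assume uw: "u \<in> insert v F" "w \<in> insert v F" "{u, w} \<in> E" "{u, w} \<notin> N"
  consider "u = v" "w = v" | "u = v" "w \<in> F" | "u \<in> F" "w = v" | "u \<in> F" "w \<in> F" using uw by blast
  then show "cross3 (z u) (z w) = 0"
  proof cases
    case 2
    then have "cross3 (z w) (z u) = 0" using uw old(2)[of w] by (auto simp: insert_commute)
    then show ?thesis using cross_skew[of "z u" "z w"] by simp
  qed (use uw old line_configD(3)[OF z(1)] in auto)
qed

lemma line_config_attached:
  assumes att: "attached F E N u v" and v: "v \<notin> F" "{v} \<notin> E"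
  shows "line_config (insert v F) E N z \<longleftrightarrow> line_config F E N z \<and> z v \<noteq> 0 \<and>
    (if {u, v} \<in> N then z u \<bullet> z v = 0 else cross3 (z u) (z v) = 0)" (is "?L \<longleftrightarrow> ?R")
proof
  assume L: ?L
  then show ?R using line_config_mono[OF L, of F] line_configD[OF L] att
    by (auto simp: attached_def)
next
  assume R: ?R
  then have z: "line_config F E N z" "z v \<noteq> 0" by auto
  have u: "u \<in> F" "z u \<noteq> 0" using att line_configD(1)[OF z(1)] by (auto simp: attached_def)
  have att': "w = u \<or> (if {u, v} \<in> N then {w, v} \<in> N \<and> {w, u} \<in> E \<and> {w, u} \<notin> N
         else {w, u} \<in> E \<and> ({w, u} \<in> N \<longleftrightarrow> {w, v} \<in> N))" if "w \<in> F" "{w, v} \<in> E" for w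
    using att that by (simp add: attached_def)
  show ?L
  proof (rule line_config_insert[OF v z])
    fix w assume w: "w \<in> F" "{w, v} \<in> E" "{w, v} \<in> N"
    have w0: "z w \<noteq> 0" using line_configD(1)[OF z(1) w(1)] .
    show "z w \<bullet> z v = 0"
    proof (cases "w = u \<or> {u, v} \<in> N")
      case True
      with R w att'[OF w(1,2)] have "w = u \<or> cross3 (z w) (z u) = 0" "z u \<bullet> z v = 0"
        using line_configD(3)[OF z(1) w(1) u(1)] by auto
      then show ?thesis using line_config_parallel_cong(1)[OF _ w0 u(2)] by auto
    next
      case False
      with R w att'[OF w(1,2)] have "z w \<bullet> z u = 0" "cross3 (z u) (z v) = 0"
        using line_configD(2)[OF z(1) w(1) u(1)] by auto
      then show ?thesis
        using line_config_parallel_cong(1)[OF _ u(2) z(2), of "z w"] by (simp add: inner_commute)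
    qed
  next
    fix w assume w: "w \<in> F" "{w, v} \<in> E" "{w, v} \<notin> N"
    have w0: "z w \<noteq> 0" using line_configD(1)[OF z(1) w(1)] .
    have "w = u \<or> {w, u} \<in> E \<and> {w, u} \<notin> N" "{u, v} \<notin> N"
      using w att'[OF w(1,2)] by (auto split: if_splits)
    then have "w = u \<or> cross3 (z w) (z u) = 0" "cross3 (z u) (z v) = 0"
      using R line_configD(3)[OF z(1) w(1) u(1)] by auto
    then show "cross3 (z w) (z v) = 0" using line_config_parallel_cong(2)[OF _ w0 u(2)] by auto
  qed
qed

lemma line_config_detached:
  assumes "\<And>w. w \<in> F \<Longrightarrow> {w, v} \<notin> E" and v: "v \<notin> F" "{v} \<notin> E"
  shows "line_config (insert v F) E N z \<longleftrightarrow> line_config F E N z \<and> z v \<noteq> 0"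
  using line_config_insert[OF v, of N z] line_config_mono[of "insert v F" E N z F]
    line_configD(1)[of "insert v F" E N z v] assms by blast

text \<open>The constraint at the endpoint and at the midpoint prescribe \<open>q \<bullet> b = 0\<close> and
  \<open>p \<bullet> b = - (q \<bullet> a)\<close>; a multiple of the projection of \<open>a\<close> onto the plane orthogonal to \<open>q\<close>
  solves both.\<close>

lemma extend_segment_value:
  fixes p q a :: "real^3"
  assumes pq: "p \<bullet> q > 0" and a: "a \<noteq> 0" "p \<bullet> a = 0"
  obtains b where "q \<bullet> b = 0" "(p + q) \<bullet> (a + b) = 0" "a \<bullet> b > 0"
proof
  define b where "b = (1 / (p \<bullet> q)) *\<^sub>R ((q \<bullet> q) *\<^sub>R a - (a \<bullet> q) *\<^sub>R q)"
  show 1: "q \<bullet> b = 0" by (simp add: b_def inner_diff_right inner_commute)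
  have "p \<bullet> b = - (a \<bullet> q)"
    using pq a by (simp add: b_def inner_diff_right inner_commute)
  with 1 a show "(p + q) \<bullet> (a + b) = 0"
    by (simp add: inner_add_left inner_add_right inner_commute)
  have "cross3 a q \<noteq> 0"
  proof
    assume "cross3 a q = 0"
    moreover have "q \<noteq> 0" using pq by auto
    ultimately obtain c where "q = c *\<^sub>R a" using parallel_multiple a by metis
    with a pq show False by simp
  qed
  then have "cross3 a q \<bullet> cross3 a q > 0" by simp
  then have "(a \<bullet> a) * (q \<bullet> q) - (a \<bullet> q) * (a \<bullet> q) > 0"
    by (simp add: dot_cross inner_commute)
  moreover have "a \<bullet> b = ((a \<bullet> a) * (q \<bullet> q) - (a \<bullet> q) * (a \<bullet> q)) / (p \<bullet> q)"
    by (simp add: b_def inner_diff_right inner_commute mult.commute)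
  ultimately show "a \<bullet> b > 0" using pq by simp
qed

definition extension_vertex :: "'v set \<Rightarrow> 'v set set \<Rightarrow> 'v set set \<Rightarrow> 'v \<Rightarrow> bool" where
  "extension_vertex F E N v \<longleftrightarrow> v \<notin> F \<and> {v} \<notin> E \<and>
     ((\<forall>w\<in>F. {w, v} \<notin> E) \<or> (\<exists>u. attached F E N u v))"

text \<open>The lifting property on which all inductions rest: a motion of the old lines extends to the new
  vertex. A parallel vector follows its partner proportionally, an orthogonal one moves as in
  \<open>extend_segment_value\<close>.\<close>

lemma extend_move:
  assumes ext: "extension_vertex F E N v" and mv: "line_move F E N x y"
    and x: "line_config (insert v F) E N x"
  shows "\<exists>y'. line_move (insert v F) E N x y' \<and> (\<forall>w\<in>F. y' w = y w)"
  using mv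
proof cases
  case rescale
  have "line_move (insert v F) E N x (y(v := x v))"
  proof (rule line_move.rescale[OF x])
    fix w assume "w \<in> insert v F"
    then show "\<exists>c. c \<noteq> 0 \<and> (y(v := x v)) w = c *\<^sub>R x w"
      using rescale(2)[of w] by (cases "w = v") (auto intro: exI[of _ 1])
  qed
  then show ?thesis using ext by (intro exI[of _ "y(v := x v)"]) (auto simp: extension_vertex_def)
next
  case segment
  have v: "v \<notin> F" "{v} \<notin> E" using ext by (auto simp: extension_vertex_def)
  have xv: "x v \<noteq> 0" using line_configD(1)[OF x] by simp
  have step: ?thesis if b: "x v \<bullet> b > 0" and yb: "line_config (insert v F) E N (y(v := b))"
      and xyb: "line_config (insert v F) E N (\<lambda>w. x w + (y(v := b)) w)" for b
  proof -
    have "line_move (insert v F) E N x (y(v := b))"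
      by (rule line_move.segment[OF x yb xyb]) (use segment(4) b v in auto)
    then show ?thesis using v by (intro exI[of _ "y(v := b)"]) auto
  qed
  have agree: "line_config F E N (y(v := b))" "line_config F E N (\<lambda>w. x w + (y(v := b)) w)" for b
  proof -
    have e: "(y(v := b)) w = y w" "x w + (y(v := b)) w = x w + y w" if "w \<in> F" for w
      using v that by auto
    show "line_config F E N (y(v := b))"
      using segment(2) line_config_cong[of F "y(v := b)" y E N, OF e(1)] by simp
    show "line_config F E N (\<lambda>w. x w + (y(v := b)) w)"
      using segment(3) line_config_cong[of F "\<lambda>w. x w + (y(v := b)) w" "\<lambda>w. x w + y w" E N, OF e(2)]
      by simp
  qed
  have nz: "b \<noteq> 0" "x v + b \<noteq> 0" if "x v \<bullet> b > 0" for b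
  proof -
    show "b \<noteq> 0" using that by auto
    show "x v + b \<noteq> 0"
    proof
      assume "x v + b = 0"
      then have "x v \<bullet> x v + x v \<bullet> b = 0" by (metis inner_add_right inner_zero_right)
      with that show False by (smt (verit) inner_ge_zero)
    qed
  qed
  from ext consider "\<forall>w\<in>F. {w, v} \<notin> E" | u where "attached F E N u v"
    by (auto simp: extension_vertex_def)
  then show ?thesis
  proof cases
    case 1
    show ?thesis
    proof (rule step)
      have d: "line_config (insert v F) E N z \<longleftrightarrow> line_config F E N z \<and> z v \<noteq> 0" for z
        using 1 v by (intro line_config_detached) auto
      show p: "x v \<bullet> x v > 0" using xv by simp
      show "line_config (insert v F) E N (y(v := x v))"
        unfolding d using agree(1) xv by simp
      show "line_config (insert v F) E N (\<lambda>w. x w + (y(v := x v)) w)"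
        unfolding d using agree(2) nz(2)[OF p] by simp
    qed
  next
    case 2
    then have u: "u \<in> F" "u \<noteq> v" using v by (auto simp: attached_def)
    have pq: "x u \<bullet> y u > 0" using segment(4) u by simp
    have xu: "x u \<noteq> 0" using pq by auto
    note iff = line_config_attached[OF 2 v]
    have xx: "if {u, v} \<in> N then x u \<bullet> x v = 0 else cross3 (x u) (x v) = 0" using x iff by blast
    show ?thesis
    proof (cases "{u, v} \<in> N")
      case True
      with xx extend_segment_value[OF pq xv] obtain b
        where b: "y u \<bullet> b = 0" "(x u + y u) \<bullet> (x v + b) = 0" "x v \<bullet> b > 0" by auto
      show ?thesis by (rule step[OF b(3)]) (use True u b agree nz[OF b(3)] in \<open>simp_all add: iff\<close>)
    next
      case False
      with xx obtain c where c: "c \<noteq> 0" "x v = c *\<^sub>R x u" using parallel_multiple xu xv by auto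
      let ?b = "c *\<^sub>R y u"
      have b: "x v \<bullet> ?b > 0" 
      proof -
        have "x v \<bullet> ?b = (c * c) * (x u \<bullet> y u)" by (simp add: c(2))
        moreover have "c * c > 0" using c(1) by (simp add: zero_less_mult_iff) linarith
        ultimately show ?thesis using pq by (metis mult_pos_pos)
      qed
      have "cross3 (x u + y u) (x v + ?b) = 0"
        by (simp only: c(2) cross_mult_right cross_refl scaleR_zero_right flip: scaleR_add_right)
      then show ?thesis
        by (intro step[OF b]) (use False u agree nz[OF b] in \<open>simp_all add: iff cross_mult_right\<close>)
    qed
  qed
qed

lemma line_move_cong:
  assumes mv: "line_move F E N x y" and eq: "\<And>v. v \<in> F \<Longrightarrow> x v = x' v"
  shows "line_move F E N x' y"
  using mv
proof cases
  case rescale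
  show ?thesis
    by (rule line_move.rescale) (use rescale eq line_config_cong[of F x x' E N, OF eq] in \<open>simp_all\<close>)
next
  case segment
  have "line_config F E N (\<lambda>v. x' v + y v) \<longleftrightarrow> line_config F E N (\<lambda>v. x v + y v)"
    by (rule line_config_cong) (simp add: eq)
  then show ?thesis
    using segment eq line_config_cong[of F x x' E N] by (intro line_move.segment) auto
qed

lemma extend_reach:
  assumes ext: "extension_vertex F E N v" and mv: "line_reach F E N x y"
    and x: "line_config (insert v F) E N x"
  shows "\<exists>y'. line_reach (insert v F) E N x y' \<and> (\<forall>w\<in>F. y' w = y w)"
  using mv
proof (induction rule: rtranclp_induct)
  case base
  then show ?case by blast
next
  case (step y z)
  then obtain y' where y': "line_reach (insert v F) E N x y'" "\<forall>w\<in>F. y' w = y w" by blast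
  have c: "line_config (insert v F) E N y'" using line_reach_config y' x by blast
  have "line_move F E N y' z" using line_move_cong[OF step(2)] y'(2) by simp
  then obtain y'' where y'': "line_move (insert v F) E N y' y''" "\<forall>w\<in>F. y'' w = z w"
    using extend_move[OF ext _ c] by blast
  with y'(1) show ?case by (blast intro: rtranclp.rtrancl_into_rtrancl)
qed

text \<open>Move the old lines to their targets, carrying the new one along, then turn the new line into
  place with the old ones fixed.\<close>

lemma line_connected_insert:
  assumes ext: "extension_vertex F E N v" and conn: "line_connected F E N"
  shows "line_connected (insert v F) E N"
  unfolding line_connected_def
proof (intro conjI allI impI)
  have v: "v \<notin> F" "{v} \<notin> E" using ext by (auto simp: extension_vertex_def)
  obtain x where x: "line_config F E N x" using conn by (auto simp: line_connected_def)
  have x': "line_config F E N (x(v := a))" for a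
  proof -
    have "(x(v := a)) w = x w" if "w \<in> F" for w using v that by auto
    from line_config_cong[of F "x(v := a)" x E N, OF this] x show ?thesis by simp
  qed
  from ext consider "\<forall>w\<in>F. {w, v} \<notin> E" | u where "attached F E N u v"
    by (auto simp: extension_vertex_def)
  then show "\<exists>x. line_config (insert v F) E N x"
  proof cases
    case 1
    then have "line_config (insert v F) E N (x(v := axis 1 1))"
      using x'[of "axis 1 1"] v by (simp add: line_config_detached axis_eq_0_iff)
    then show ?thesis by blast
  next
    case 2
    then have u: "u \<in> F" "u \<noteq> v" using v by (auto simp: attached_def)
    have xu: "x u \<noteq> 0" using line_configD(1)[OF x u(1)] .
    obtain a where a: "a \<noteq> 0" "x u \<bullet> a = 0" using exists_orthogonal by blast
    have "line_config (insert v F) E N (x(v := if {u, v} \<in> N then a else x u))"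
      unfolding line_config_attached[OF 2 v] using x' a u xu by auto
    then show ?thesis by blast
  qed
next
  fix x y assume x: "line_config (insert v F) E N x" and y: "line_config (insert v F) E N y"
  have "line_config F E N x" "line_config F E N y"
    using line_config_mono[OF x] line_config_mono[OF y] by blast+
  then have "line_reach F E N x y" using conn by (simp add: line_connected_def)
  from extend_reach[OF ext this x] obtain z
    where z: "line_reach (insert v F) E N x z" "\<forall>w\<in>F. z w = y w" by blast
  have z': "line_config (insert v F) E N z" using line_reach_config z(1) x by blast
  have eq: "\<And>w. w \<in> insert v F \<Longrightarrow> y w = (z(v := y v)) w" using z(2) by auto
  have "line_config (insert v F) E N (z(v := y v))" using y line_config_cong[of "insert v F" y "z(v := y v)" E N, OF eq] by simp
  then have "line_reach (insert v F) E N z (z(v := y v))"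
    by (rule vertex_reach[OF z']) (use ext in \<open>auto simp: extension_vertex_def\<close>)
  moreover have "line_move (insert v F) E N (z(v := y v)) y"
    by (rule line_move_sym) (rule line_move_agree[OF y eq])
  ultimately show "line_reach (insert v F) E N x y"
    using z(1) by (meson rtranclp.rtrancl_into_rtrancl rtranclp_trans)
qed

lemma line_config_weaken:
  assumes sub: "\<And>u v. \<lbrakk>u \<in> F; v \<in> F; {u, v} \<in> E\<rbrakk> \<Longrightarrow> {u, v} \<in> E' \<and> ({u, v} \<in> N \<longleftrightarrow> {u, v} \<in> N')"
    and x: "line_config F E' N' x"
  shows "line_config F E N x"
  by (rule line_configI) (use sub line_configD[OF x] in blast)+

lemma line_reach_weaken:
  assumes sub: "\<And>u v. \<lbrakk>u \<in> F; v \<in> F; {u, v} \<in> E\<rbrakk> \<Longrightarrow> {u, v} \<in> E' \<and> ({u, v} \<in> N \<longleftrightarrow> {u, v} \<in> N')"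
    and "line_reach F E' N' x y"
  shows "line_reach F E N x y"
proof -
  have w: "line_config F E N z" if "line_config F E' N' z" for z
    using line_config_weaken[of F E E' N N' z] sub that by blast
  have "line_move F E N x y" if "line_move F E' N' x y" for x y
    using that
  proof cases
    case rescale
    show ?thesis by (rule line_move.rescale[OF w[OF rescale(1)] rescale(2)])
  next
    case segment
    show ?thesis by (rule line_move.segment[OF w[OF segment(1)] w[OF segment(2)] w[OF segment(3)] segment(4)])
  qed
  then have "line_move F E' N' \<le> line_move F E N" by blast
  then show ?thesis using assms(2) rtranclp_mono by blast
qed

text \<open>Every nonempty set of vertices has one with at most one neighbour in the set. This is the form of
  acyclicity that the induction over the vertices uses.\<close>

definition thin :: "'v set \<Rightarrow> 'v set set \<Rightarrow> bool" where
  "thin F E \<longleftrightarrow> (\<forall>F'\<subseteq>F. F' \<noteq> {} \<longrightarrow>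
     (\<exists>v\<in>F'. \<forall>u\<in>F'. \<forall>w\<in>F'. {u, v} \<in> E \<longrightarrow> {w, v} \<in> E \<longrightarrow> u = w))"

lemma thin_line_connected:
  assumes "finite F" "thin F E" and loop: "\<And>v. {v} \<notin> E"
  shows "line_connected F E N"
  using assms(1,2)
proof (induction F rule: finite_psubset_induct)
  case (psubset F)
  show ?case
  proof (cases "F = {}")
    case True
    then show ?thesis by (simp add: line_connected_empty)
  next
    case False
    then obtain v where v: "v \<in> F" "\<forall>u\<in>F. \<forall>w\<in>F. {u, v} \<in> E \<longrightarrow> {w, v} \<in> E \<longrightarrow> u = w"
      using psubset.prems unfolding thin_def by (meson subset_refl)
    let ?F = "F - {v}"
    have "thin ?F E" using psubset.prems unfolding thin_def by blast
    then have c: "line_connected ?F E N" using v by (intro psubset.IH) auto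
    have "(\<forall>w\<in>?F. {w, v} \<notin> E) \<or> (\<exists>u. attached ?F E N u v)"
      using v(2) unfolding attached_def by blast
    then have "extension_vertex ?F E N v" using loop by (simp add: extension_vertex_def)
    from line_connected_insert[OF this c] v show ?thesis by (simp add: insert_absorb)
  qed
qed

text \<open>Contraction of parallel edges: if every configuration is, up to scaling, the pullback along
  \<open>f\<close> of one on a smaller graph, then motions can be pulled back as well.\<close>

lemma line_connected_pullback:
  fixes f :: "'v \<Rightarrow> 'i"
  assumes I: "line_connected I EI NI" and f: "f ` F \<subseteq> I"
    and E: "\<And>u v. \<lbrakk>u \<in> F; v \<in> F; {u, v} \<in> E\<rbrakk> \<Longrightarrow>
      (if {u, v} \<in> N then {f u, f v} \<in> EI \<and> {f u, f v} \<in> NI else f u = f v)"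
    and fac: "\<And>x. line_config F E N x \<Longrightarrow>
      \<exists>y. line_config I EI NI y \<and> (\<forall>v\<in>F. \<exists>c. c \<noteq> 0 \<and> y (f v) = c *\<^sub>R x v)"
  shows "line_connected F E N"
proof -
  have pull: "line_config F E N (y \<circ> f)" if y: "line_config I EI NI y" for y
  proof (rule line_configI)
    show "(y \<circ> f) v \<noteq> 0" if "v \<in> F" for v using line_configD(1)[OF y] f that by auto
    show "(y \<circ> f) u \<bullet> (y \<circ> f) v = 0" if "u \<in> F" "v \<in> F" "{u, v} \<in> E" "{u, v} \<in> N" for u v
      using E[OF that(1-3)] line_configD(2)[OF y] f that by auto
    show "cross3 ((y \<circ> f) u) ((y \<circ> f) v) = 0" if "u \<in> F" "v \<in> F" "{u, v} \<in> E" "{u, v} \<notin> N" for u v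
      using E[OF that(1-3)] that by auto
  qed
  have move: "line_move F E N (y \<circ> f) (z \<circ> f)" if "line_move I EI NI y z" for y z
    using that
  proof cases
    case rescale
    show ?thesis by (rule line_move.rescale[OF pull[OF rescale(1)]]) (use rescale(2) f in auto)
  next
    case segment
    have "line_config F E N (\<lambda>v. (y \<circ> f) v + (z \<circ> f) v)"
      using pull[OF segment(3)] by (simp add: o_def)
    then show ?thesis
      by (rule line_move.segment[OF pull[OF segment(1)] pull[OF segment(2)]]) (use segment(4) f in auto)
  qed
  have reach: "line_reach F E N (y \<circ> f) (z \<circ> f)" if "line_reach I EI NI y z" for y z
    using that
  proof (induction rule: rtranclp_induct)
    case (step y' z)
    from step.IH move[OF step.hyps(2)] show ?case
      by (rule rtranclp.rtrancl_into_rtrancl[where r = "line_move F E N"])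
  qed simp
  show ?thesis
    unfolding line_connected_def
  proof (intro conjI allI impI)
    show "\<exists>x. line_config F E N x" using I pull by (auto simp: line_connected_def)
    fix x x' assume x: "line_config F E N x" "line_config F E N x'"
    obtain y where y: "line_config I EI NI y" "\<forall>v\<in>F. \<exists>c. c \<noteq> 0 \<and> y (f v) = c *\<^sub>R x v"
      using fac[OF x(1)] by blast
    obtain y' where y': "line_config I EI NI y'" "\<forall>v\<in>F. \<exists>c. c \<noteq> 0 \<and> y' (f v) = c *\<^sub>R x' v"
      using fac[OF x(2)] by blast
    have "line_move F E N x (y \<circ> f)" "line_move F E N x' (y' \<circ> f)"
      using x y y' by (auto intro: line_move.rescale)
    moreover have "line_reach F E N (y \<circ> f) (y' \<circ> f)"
      using I y y' by (intro reach) (simp add: line_connected_def)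
    ultimately show "line_reach F E N x x'"
      by (meson converse_rtranclp_into_rtranclp line_move_sym rtranclp.rtrancl_into_rtrancl)
  qed
qed

section \<open>Closed polygons of orthogonal lines\<close>

text \<open>For \<open>k = 2\<close> the two edges coincide; this degenerate cycle is a base case of the induction on
  polygons.\<close>

definition cycle_edges :: "nat \<Rightarrow> nat set set" where
  "cycle_edges k = {{i, Suc i mod k} |i. i < k}"

lemma cycle_edges_iff:
  "i < k \<Longrightarrow> j < k \<Longrightarrow> {i, j} \<in> cycle_edges k \<longleftrightarrow> j = Suc i mod k \<or> i = Suc j mod k"
  unfolding cycle_edges_def by (auto simp: doubleton_eq_iff)

definition polygon :: "nat \<Rightarrow> (nat \<Rightarrow> real^3) \<Rightarrow> bool" where
  "polygon k = line_config {..<k} (cycle_edges k) (cycle_edges k)"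

lemma polygon_iff:
  assumes "k \<ge> 1"
  shows "polygon k x \<longleftrightarrow> (\<forall>i<k. x i \<noteq> 0) \<and> (\<forall>i. Suc i < k \<longrightarrow> x i \<bullet> x (Suc i) = 0)
    \<and> x (k - 1) \<bullet> x 0 = 0"
proof -
  have "polygon k x \<longleftrightarrow> (\<forall>i<k. x i \<noteq> 0) \<and> (\<forall>i<k. x i \<bullet> x (Suc i mod k) = 0)"
  proof
    assume "polygon k x"
    note c = line_configD[OF this[unfolded polygon_def]]
    show "(\<forall>i<k. x i \<noteq> 0) \<and> (\<forall>i<k. x i \<bullet> x (Suc i mod k) = 0)"
    proof (intro conjI allI impI)
      fix i assume i: "i < k"
      then show "x i \<noteq> 0" using c(1) by simp
      have "{i, Suc i mod k} \<in> cycle_edges k" using i by (auto simp: cycle_edges_def)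
      then show "x i \<bullet> x (Suc i mod k) = 0" using c(2)[of i "Suc i mod k"] i assms by simp
    qed
  next
    assume r: "(\<forall>i<k. x i \<noteq> 0) \<and> (\<forall>i<k. x i \<bullet> x (Suc i mod k) = 0)"
    show "polygon k x"
      unfolding polygon_def
    proof (rule line_configI)
      fix u v assume uv: "u \<in> {..<k}" "v \<in> {..<k}" "{u, v} \<in> cycle_edges k"
      then have "v = Suc u mod k \<or> u = Suc v mod k" by (simp add: cycle_edges_iff)
      with r uv show "x u \<bullet> x v = 0" by (auto simp: inner_commute)
    qed (use r in auto)
  qed
  also have "(\<forall>i<k. x i \<bullet> x (Suc i mod k) = 0) \<longleftrightarrow>
     (\<forall>i. Suc i < k \<longrightarrow> x i \<bullet> x (Suc i) = 0) \<and> x (k - 1) \<bullet> x 0 = 0" (is "?A \<longleftrightarrow> ?B")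
  proof
    assume A: ?A
    then show ?B using assms by (metis Suc_diff_1 Suc_lessD diff_less less_le_trans less_numeral_extra(1) mod_less mod_self)
  next
    assume B: ?B
    show ?A
    proof (intro allI impI)
      fix i assume "i < k"
      then consider "Suc i < k" | "i = k - 1" by linarith
      then show "x i \<bullet> x (Suc i mod k) = 0" using B assms by cases auto
    qed
  qed
  finally show ?thesis by blast
qed

abbreviation polygon_reach :: "nat \<Rightarrow> (nat \<Rightarrow> real^3) \<Rightarrow> (nat \<Rightarrow> real^3) \<Rightarrow> bool" where
  "polygon_reach k \<equiv> line_reach {..<k} (cycle_edges k) (cycle_edges k)"

lemma cycle_edges_loop: "k \<ge> 2 \<Longrightarrow> {v} \<notin> cycle_edges k"
proof
  assume k: "k \<ge> 2" and "{v} \<in> cycle_edges k"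
  then obtain i where "i < k" "Suc i mod k = i" unfolding cycle_edges_def by auto
  with k show False by (cases "Suc i = k") auto
qed

lemma polygon_vertex_reach:
  assumes "polygon k x" "polygon k (x(v := q))" "v < k" "k \<ge> 2"
  shows "polygon_reach k x (x(v := q))"
  using assms vertex_reach[of "{..<k}" "cycle_edges k" "cycle_edges k" x v q]
  by (simp add: polygon_def cycle_edges_loop)

lemma polygon_3:
  assumes abc: "{..<3::nat} = {a, b, c}" "a \<noteq> b" "a \<noteq> c" "b \<noteq> c"
  shows "polygon 3 x \<longleftrightarrow> x a \<noteq> 0 \<and> x b \<noteq> 0 \<and> x c \<noteq> 0 \<and> x a \<bullet> x b = 0 \<and> x a \<bullet> x c = 0 \<and> x b \<bullet> x c = 0"
proof -
  have *: "a \<in> {..<3}" "b \<in> {..<3}" "c \<in> {..<3}" using abc(1) by blast+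
  have "a = 0 \<or> a = 1 \<or> a = 2" "b = 0 \<or> b = 1 \<or> b = 2" "c = 0 \<or> c = 1 \<or> c = 2" using * by auto
  moreover have "Suc i < 3 \<longleftrightarrow> i = 0 \<or> i = 1" for i by auto
  moreover have "i < 3 \<longleftrightarrow> i = 0 \<or> i = 1 \<or> i = (2::nat)" for i by auto
  ultimately show ?thesis using abc(2-) 
    by (simp add: polygon_iff) (elim disjE; simp add: inner_commute numeral_2_eq_2; blast)
qed

text \<open>The frame turns about its axis \<open>c\<close>: as \<open>r\<close> moves in the plane orthogonal to that axis,
  \<open>r \<times> x c\<close> completes the frame.\<close>

lemma polygon_3_turn:
  assumes abc: "{..<3::nat} = {a, b, c}" "a \<noteq> b" "a \<noteq> c" "b \<noteq> c"
    and x: "polygon 3 x" and q: "q \<bullet> x c = 0" "q \<noteq> 0"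
  shows "polygon_reach 3 x (x(a := q, b := cross3 q (x c)))"
proof -
  note iff = polygon_3[OF abc]
  have xx: "x a \<noteq> 0" "x b \<noteq> 0" "x c \<noteq> 0" "x a \<bullet> x b = 0" "x a \<bullet> x c = 0" "x b \<bullet> x c = 0"
    using x iff by auto
  let ?S = "{r. r \<bullet> x c = 0}"
  let ?z = "\<lambda>r. x(a := r, b := cross3 r (x c))"
  have z: "polygon 3 (?z r)" if "r \<in> ?S" "r \<noteq> 0" for r
    using that xx abc(2-) orthogonal_cross_nonzero[of r "x c"]
    by (simp add: iff dot_cross_self)
  have "polygon_reach 3 (?z (x a)) (?z q)"
  proof (rule pair_reach)
    show "subspace ?S" by (simp add: subspace_def inner_add_left)
    show "line_config {..<3} (cycle_edges 3) (cycle_edges 3) (?z r)" if "r \<in> ?S" "r \<noteq> 0" for r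
      using z[OF that] by (simp only: polygon_def)
  qed (use abc xx q in auto)
  moreover have "line_move {..<3} (cycle_edges 3) (cycle_edges 3) x (?z (x a))"
  proof (rule line_move.rescale)
    obtain d where "d \<noteq> 0" "x b = d *\<^sub>R cross3 (x a) (x c)"
      using perp_multiple[of "x a" "x c" "x b"] orthogonal_cross_nonzero[of "x a" "x c"] xx
      by (metis inner_commute)
    then have "cross3 (x a) (x c) = inverse d *\<^sub>R x b" "inverse d \<noteq> 0" by simp_all
    then show "\<exists>e. e \<noteq> 0 \<and> ?z (x a) v = e *\<^sub>R x v" for v
      by (intro exI[of _ "if v = b then inverse d else 1"]) auto
  qed (use x in \<open>simp add: polygon_def\<close>)
  ultimately show ?thesis by (rule converse_rtranclp_into_rtranclp[where r = "line_move {..<3} (cycle_edges 3) (cycle_edges 3)", rotated])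
qed

text \<open>Three turns about frame axes, as with Euler angles: first bring an axis into position \<open>z\<close>
  orthogonal to the old and the new third axis, then the third axis to its target, then the rest.\<close>

lemma polygon_3_connected: "line_connected {..<3} (cycle_edges 3) (cycle_edges 3)"
  unfolding line_connected_def polygon_def[symmetric]
proof (intro conjI allI impI)
  have abc: "{..<3::nat} = {0, 1, 2}" "{..<3::nat} = {2, 1, 0}" by auto
  note iff = polygon_3[OF abc(1), simplified]
  show "\<exists>x. polygon 3 x"
    by (intro exI[of _ "\<lambda>i. if i = 0 then axis 1 1 else if i = 1 then axis 2 1 else axis 3 1"])
      (auto simp: iff axis_eq_0_iff inner_axis_axis)
  fix x y assume x: "polygon 3 x" and y: "polygon 3 y"
  have y': "y 0 \<noteq> 0" "y 1 \<noteq> 0" "y 2 \<noteq> 0" "y 0 \<bullet> y 1 = 0" "y 0 \<bullet> y 2 = 0" "y 1 \<bullet> y 2 = 0"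
    using y iff by auto
  obtain z where z: "z \<noteq> 0" "z \<bullet> x 2 = 0" "z \<bullet> y 2 = 0"
  proof (cases "cross3 (x 2) (y 2) = 0")
    case True
    have "x 0 \<noteq> 0" "x 0 \<bullet> x 2 = 0" "x 2 \<noteq> 0" using x iff by auto
    with True y' that[of "x 0"] line_config_parallel_cong(1)[OF True, of "x 0"] show thesis
      by (simp add: inner_commute)
  next
    case False
    then show thesis using that dot_cross_self by metis
  qed
  define x1 where "x1 = x(0 := z, 1 := cross3 z (x 2))"
  have r1: "polygon_reach 3 x x1"
    unfolding x1_def using polygon_3_turn[OF abc(1) _ _ _ x] z by auto
  then have p1: "polygon 3 x1" using line_reach_config x by (auto simp: polygon_def)
  define x2 where "x2 = x1(2 := y 2, 1 := cross3 (y 2) (x1 0))"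
  have r2: "polygon_reach 3 x1 x2"
    unfolding x2_def using polygon_3_turn[OF abc(2) _ _ _ p1, of "y 2"] z y' by (auto simp: x1_def inner_commute)
  then have p2: "polygon 3 x2" using line_reach_config p1 by (auto simp: polygon_def)
  define x3 where "x3 = x2(0 := y 0, 1 := cross3 (y 0) (x2 2))"
  have r3: "polygon_reach 3 x2 x3"
    unfolding x3_def using polygon_3_turn[OF abc(1) _ _ _ p2, of "y 0"] y' by (auto simp: x2_def)
  then have p3: "polygon 3 x3" using line_reach_config p2 by (auto simp: polygon_def)
  have x3: "x3 0 = y 0" "x3 2 = y 2" "x3 1 = cross3 (y 0) (y 2)" by (simp_all add: x3_def x2_def)
  obtain d where d: "d \<noteq> 0" "y 1 = d *\<^sub>R cross3 (y 0) (y 2)"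
    using perp_multiple[of "y 0" "y 2" "y 1"] orthogonal_cross_nonzero[of "y 0" "y 2"] y'
    by (metis inner_commute)
  have "line_move {..<3} (cycle_edges 3) (cycle_edges 3) x3 y"
  proof (rule line_move.rescale)
    fix v :: nat assume "v \<in> {..<3}"
    then have "v = 0 \<or> v = 1 \<or> v = 2" by auto
    then show "\<exists>c. c \<noteq> 0 \<and> y v = c *\<^sub>R x3 v"
      using d x3 by (auto intro: exI[of _ 1])
  qed (use p3 in \<open>simp add: polygon_def\<close>)
  then show "polygon_reach 3 x y"
    using r1 r2 r3 by (meson rtranclp.rtrancl_into_rtrancl rtranclp_trans)
qed

lemma polygon_2_connected: "line_connected {..<2} (cycle_edges 2) (cycle_edges 2)"
proof -
  have e: "cycle_edges 2 = {{0, 1}}"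
    by (auto simp: cycle_edges_def less_2_cases_iff insert_commute)
  have "line_connected (insert 0 {}) (cycle_edges 2) (cycle_edges 2)"
    by (intro line_connected_insert line_connected_empty)
      (auto simp: extension_vertex_def e doubleton_eq_iff)
  then have "line_connected (insert 1 (insert 0 {})) (cycle_edges 2) (cycle_edges 2)"
    by (rule line_connected_insert[rotated]) (auto simp: extension_vertex_def e attached_def doubleton_eq_iff)
  moreover have "insert 1 (insert 0 {}) = {..<2::nat}" by auto
  ultimately show ?thesis by simp
qed

text \<open>Vertex \<open>k - 1\<close> has the neighbours \<open>0\<close> and \<open>k - 2\<close>, whose lines are to be made equal. If
  the neighbours \<open>1\<close> and \<open>k - 1\<close> of vertex \<open>0\<close> have equal lines, then vertex \<open>0\<close> is free to turn
  in the plane orthogonal to them; if the neighbours \<open>0\<close> and \<open>2\<close> of vertex \<open>1\<close> do, turning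
  vertex \<open>1\<close> leads to the previous case. Otherwise the line of \<open>1\<close> is determined by those of \<open>0\<close>
  and \<open>2\<close>. If the lines of \<open>2\<close> and \<open>k - 1\<close> are orthogonal, those of \<open>1\<close> and \<open>k - 1\<close> are both
  orthogonal to those of \<open>0\<close> and \<open>2\<close>, hence equal. If they are not, vertex \<open>0\<close> can turn freely about
  \<open>k - 1\<close>, because the line of \<open>2\<close> never becomes equal to the one of \<open>0\<close>, and vertex \<open>1\<close> follows
  as a cross product.\<close>

lemma polygon_fold:
  assumes k: "k \<ge> 4" and x: "polygon k x"
  shows "\<exists>y. polygon_reach k x y \<and> cross3 (y 0) (y (k - 2)) = 0"
proof -
  have k1: "k \<ge> 1" "k \<ge> 2" using k by auto
  note iff = polygon_iff[OF k1(1)]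
  have nz: "x i \<noteq> 0" if "i < k" for i using x that by (simp add: iff)
  have suc: "x i \<bullet> x (Suc i) = 0" if "Suc i < k" for i using x that by (simp add: iff)
  have last: "x (k - 1) \<bullet> x 0 = 0" using x by (simp add: iff)
  have e01: "x 0 \<bullet> x 1 = 0" using suc[of 0] k by simp
  have e12: "x 1 \<bullet> x 2 = 0" using suc[of 1] k by (simp add: numeral_2_eq_2)
  have e_last: "x (k - 2) \<bullet> x (k - 1) = 0" using suc[of "k - 2"] k by (simp add: Suc_diff_Suc numeral_2_eq_2)
  have A: "\<exists>y. polygon_reach k x y \<and> cross3 (y 0) (y (k - 2)) = 0"
    if x: "polygon k x" and par: "cross3 (x 1) (x (k - 1)) = 0" for x
  proof -
    have nz: "x i \<noteq> 0" if "i < k" for i using x that by (simp add: iff)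
    have suc: "x i \<bullet> x (Suc i) = 0" if "Suc i < k" for i using x that by (simp add: iff)
    have e: "x (k - 2) \<bullet> x (k - 1) = 0" using suc[of "k - 2"] k by (simp add: Suc_diff_Suc numeral_2_eq_2)
    then have e': "x (k - 2) \<bullet> x 1 = 0"
      using line_config_parallel_cong(1)[OF par, of "x (k - 2)"] nz k by (simp add: inner_commute)
    let ?y = "x(0 := x (k - 2))"
    have "polygon k ?y"
      unfolding iff using nz suc e e' k by (auto simp: inner_commute)
    then have "polygon_reach k x ?y" using polygon_vertex_reach x k by auto
    moreover have "cross3 (?y 0) (?y (k - 2)) = 0" using k by auto
    ultimately show ?thesis by blast
  qed
  have B: "\<exists>y. polygon_reach k x y \<and> cross3 (y 0) (y (k - 2)) = 0" if par: "cross3 (x 0) (x 2) = 0"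
  proof -
    have e': "x (k - 1) \<bullet> x 2 = 0"
      using line_config_parallel_cong(1)[OF par, of "x (k - 1)"] nz k last by (simp add: inner_commute)
    let ?y = "x(1 := x (k - 1))"
    have y: "polygon k ?y"
      unfolding iff using nz suc e' last k by (auto simp: inner_commute numeral_2_eq_2)
    then have "polygon_reach k x ?y" using polygon_vertex_reach x k by auto
    moreover have "cross3 (?y 1) (?y (k - 1)) = 0" using k by auto
    ultimately show ?thesis using A[OF y] by (meson rtranclp_trans)
  qed
  show ?thesis
  proof (cases "cross3 (x 0) (x 2) = 0")
    case True
    then show ?thesis by (rule B)
  next
    case ne: False
    show ?thesis
    proof (cases "x 2 \<bullet> x (k - 1) = 0")
      case True
      obtain c where c: "c \<noteq> 0" "x 1 = c *\<^sub>R cross3 (x 0) (x 2)"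
        using perp_multiple[OF ne, of "x 1"] nz[of 1] k e01 e12 by (metis inner_commute One_nat_def less_le_trans numeral_le_iff one_less_numeral_iff semiring_norm(68,76,71))
      obtain d where d: "d \<noteq> 0" "x (k - 1) = d *\<^sub>R cross3 (x 0) (x 2)"
        using perp_multiple[OF ne, of "x (k - 1)"] nz[of "k - 1"] k last True by (auto simp: inner_commute)
      have "cross3 (x 1) (x (k - 1)) = 0" 
        by (simp only: c(2) d(2) cross_mult_left cross_mult_right cross_refl scaleR_zero_right)
      then show ?thesis by (rule A[OF x])
    next
      case False
      \<comment> \<open>Hence vertex \<open>k - 2\<close> is different from \<open>2\<close> and not affected by the turn.\<close>
      have k5: "k \<ge> 5"
      proof (rule ccontr)
        assume "\<not> k \<ge> 5"
        with k have "k = 4" by simp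
        with False e_last show False by simp
      qed
      let ?S = "{r. r \<bullet> x (k - 1) = 0}"
      let ?z = "\<lambda>r. x(0 := r, 1 := cross3 r (x 2))"
      have z: "polygon k (?z r)" if r: "r \<in> ?S" "r \<noteq> 0" for r
      proof -
        have "cross3 r (x 2) \<noteq> 0"
          using line_config_parallel_cong(1)[of r "x 2" "x (k - 1)"] r False nz[of 2] k by auto
        moreover have "?z r i \<bullet> ?z r (Suc i) = 0" if "Suc i < k" for i
        proof -
          consider "i = 0" | "i = 1" | "i \<ge> 2" by linarith
          then show ?thesis
            using suc[OF that] by cases (auto simp: dot_cross_self numeral_2_eq_2)
        qed
        moreover have "?z r (k - 1) \<bullet> ?z r 0 = 0" using r k by (auto simp: inner_commute)
        ultimately show ?thesis unfolding iff using nz r by auto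
      qed
      have "polygon_reach k (?z (x 0)) (?z (x (k - 2)))"
      proof (rule pair_reach)
        show "subspace ?S" by (simp add: subspace_def inner_add_left)
      qed (use k nz z last e_last in \<open>auto simp: polygon_def[symmetric] inner_commute\<close>)
      moreover have "line_move {..<k} (cycle_edges k) (cycle_edges k) x (?z (x 0))"
      proof (rule line_move.rescale)
        have "x 1 \<noteq> 0" using nz k by simp
        then obtain d where "d \<noteq> 0" "x 1 = d *\<^sub>R cross3 (x 0) (x 2)"
          using perp_multiple[OF ne] e01 e12 by (metis inner_commute)
        then have "cross3 (x 0) (x 2) = inverse d *\<^sub>R x 1" "inverse d \<noteq> 0" by simp_all
        then show "\<exists>e. e \<noteq> 0 \<and> ?z (x 0) v = e *\<^sub>R x v" for v
          by (intro exI[of _ "if v = 1 then inverse d else 1"]) auto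
      qed (use x in \<open>simp add: polygon_def\<close>)
      ultimately have "polygon_reach k x (?z (x (k - 2)))"
        by (rule converse_rtranclp_into_rtranclp[where r = "line_move {..<k} (cycle_edges k) (cycle_edges k)", rotated])
      moreover have "cross3 (?z (x (k - 2)) 0) (?z (x (k - 2)) (k - 2)) = 0" using k5 by simp
      ultimately show ?thesis by blast
    qed
  qed
qed

lemma line_connected_cong:
  assumes conn: "line_connected F E N"
    and eq: "\<And>u v. \<lbrakk>u \<in> F; v \<in> F\<rbrakk> \<Longrightarrow> ({u, v} \<in> E \<longleftrightarrow> {u, v} \<in> E') \<and> ({u, v} \<in> N \<longleftrightarrow> {u, v} \<in> N')"
  shows "line_connected F E' N'"
proof -
  have c: "line_config F E N x \<longleftrightarrow> line_config F E' N' x" for x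
    using eq line_config_weaken[of F E E' N N' x] line_config_weaken[of F E' E N' N x] by blast
  have "line_reach F E' N' x y" if "line_reach F E N x y" for x y
    using eq that by (intro line_reach_weaken[of F E' E N' N]) auto
  with conn c show ?thesis by (auto simp: line_connected_def)
qed

text \<open>The polygons with equal lines at \<open>0\<close> and \<open>k - 2\<close> are the configurations of the graph with an
  additional parallel edge between these vertices and the implied orthogonal edge between \<open>k - 3\<close>
  and \<open>0\<close>. This graph arises from the cycle with \<open>k - 2\<close> vertices by attaching two vertices to \<open>0\<close>.\<close>

lemma polygon_connected: "k \<ge> 2 \<Longrightarrow> line_connected {..<k} (cycle_edges k) (cycle_edges k)"
proof (induction k rule: less_induct)
  case (less k)
  consider "k = 2" | "k = 3" | "k \<ge> 4" using less.prems by linarith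
  then show ?case
  proof cases
    case k: 3
    \<comment> \<open>For \<open>k = 4\<close> the inserted edge of \<open>N\<close> is already an edge of the cycle.\<close>
    define N where "N = insert {k - 3, 0} (cycle_edges k)"
    define E where "E = insert {0, k - 2} N"
    have suc: "Suc i mod k = (if Suc i = k then 0 else Suc i)" if "i < k" for i using that by auto
    have suc': "Suc i mod (k - 2) = (if Suc i = k - 2 then 0 else Suc i)" if "i < k - 2" for i
      using that by auto
    have N: "{u, v} \<in> N \<longleftrightarrow> v = Suc u \<or> u = Suc v \<or> (u = k - 1 \<and> v = 0) \<or> (u = 0 \<and> v = k - 1)
        \<or> (u = k - 3 \<and> v = 0) \<or> (u = 0 \<and> v = k - 3)" if "u < k" "v < k" for u v
      using that k by (auto simp: N_def cycle_edges_iff suc doubleton_eq_iff)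
    have E: "{u, v} \<in> E \<longleftrightarrow> {u, v} \<in> N \<or> (u = k - 2 \<and> v = 0) \<or> (u = 0 \<and> v = k - 2)" for u v
      by (auto simp: E_def doubleton_eq_iff)
    have C: "{u, v} \<in> cycle_edges (k - 2) \<longleftrightarrow> v = Suc u \<or> u = Suc v \<or> (u = k - 3 \<and> v = 0) \<or> (u = 0 \<and> v = k - 3)"
      if "u < k - 2" "v < k - 2" for u v
      using that k by (auto simp: cycle_edges_iff suc')
    have "line_connected {..<k - 2} (cycle_edges (k - 2)) (cycle_edges (k - 2))"
      using k by (intro less.IH) auto
    then have "line_connected {..<k - 2} E N"
      by (rule line_connected_cong) (auto simp: E N C)
    moreover have "{v} \<notin> E" for v
      using k cycle_edges_loop[of k v] by (auto simp: E_def N_def doubleton_eq_iff)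
    moreover have "attached {..<k - 2} E N 0 (k - 2)"
      using k by (auto simp: attached_def E N)
    moreover have "attached (insert (k - 2) {..<k - 2}) E N 0 (k - 1)"
      using k by (auto simp: attached_def E N)
    ultimately have "line_connected (insert (k - 1) (insert (k - 2) {..<k - 2})) E N"
      using k by (intro line_connected_insert) (auto simp: extension_vertex_def)
    moreover have "insert (k - 1) (insert (k - 2) {..<k - 2}) = {..<k}" using k by auto
    ultimately have conn: "line_connected {..<k} E N" by simp
    have weak: "{u, v} \<in> E \<and> ({u, v} \<in> cycle_edges k \<longleftrightarrow> {u, v} \<in> N)" if "{u, v} \<in> cycle_edges k" for u v
      using that by (simp add: E_def N_def)
    have folded: "line_config {..<k} E N x" if x: "polygon k x" "cross3 (x 0) (x (k - 2)) = 0" for x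
    proof -
      have k1: "k \<ge> 1" using k by simp
      note xx = x(1)[unfolded polygon_iff[OF k1]]
      have "Suc (k - 3) = k - 2" using k by simp
      then have "x (k - 3) \<bullet> x (k - 2) = 0" using xx k by (metis diff_less less_le_trans zero_less_numeral)
      then have e: "x (k - 3) \<bullet> x 0 = 0"
        using line_config_parallel_cong(1)[OF x(2), of "x (k - 3)"] xx k by (simp add: inner_commute)
      show ?thesis
      proof (rule line_configI)
        fix u v assume uv: "u \<in> {..<k}" "v \<in> {..<k}" "{u, v} \<in> E" "{u, v} \<in> N"
        then have "v = Suc u \<or> u = Suc v \<or> (u = k - 1 \<and> v = 0) \<or> (u = 0 \<and> v = k - 1)
          \<or> (u = k - 3 \<and> v = 0) \<or> (u = 0 \<and> v = k - 3)" by (simp add: N)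
        with xx e uv show "x u \<bullet> x v = 0" by (auto simp: inner_commute)
      next
        fix u v assume uv: "u \<in> {..<k}" "v \<in> {..<k}" "{u, v} \<in> E" "{u, v} \<notin> N"
        then have "(u = k - 2 \<and> v = 0) \<or> (u = 0 \<and> v = k - 2)" by (simp add: E)
        with x(2) cross_skew[of "x 0" "x (k - 2)"] show "cross3 (x u) (x v) = 0" by auto
      qed (use xx in auto)
    qed
    have reach: "polygon_reach k x y" if "polygon k x" "cross3 (x 0) (x (k - 2)) = 0"
      "polygon k y" "cross3 (y 0) (y (k - 2)) = 0" for x y
      using conn folded that weak
      by (intro line_reach_weaken[of "{..<k}" "cycle_edges k" E "cycle_edges k" N]) (auto simp: line_connected_def)
    show ?thesis
      unfolding line_connected_def polygon_def[symmetric]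
    proof (intro conjI allI impI)
      obtain x where "line_config {..<k} E N x" using conn by (auto simp: line_connected_def)
      then have "polygon k x"
        unfolding polygon_def by (rule line_config_weaken[rotated]) (use weak in auto)
      then show "\<exists>x. polygon k x" by blast
    next
      fix x y assume xy: "polygon k x" "polygon k y"
      obtain x' where x': "polygon_reach k x x'" "cross3 (x' 0) (x' (k - 2)) = 0"
        using polygon_fold[OF k xy(1)] by blast
      obtain y' where y': "polygon_reach k y y'" "cross3 (y' 0) (y' (k - 2)) = 0"
        using polygon_fold[OF k xy(2)] by blast
      have "polygon k x'" "polygon k y'"
        using x' y' xy line_reach_config unfolding polygon_def by blast+
      then have "polygon_reach k x' y'" using reach x' y' by blast
      with x'(1) line_reach_sym[OF y'(1)] show "polygon_reach k x y" by (meson rtranclp_trans)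
    qed
  qed (use polygon_2_connected polygon_3_connected in simp_all)
qed

section \<open>Trees and cycles\<close>

lemma finite_simple_graphD:
  assumes "finite_simple_graph V E"
  shows "finite V" "e \<in> E \<Longrightarrow> e \<subseteq> V" "{v} \<notin> E" "finite E"
proof -
  show f: "finite V" using assms by (simp add: finite_simple_graph_def)
  show "e \<in> E \<Longrightarrow> e \<subseteq> V" "{v} \<notin> E" using assms by (auto simp: finite_simple_graph_def)
  have "E \<subseteq> Pow V" using assms by (auto simp: finite_simple_graph_def)
  then show "finite E" using f by (meson finite_Pow_iff finite_subset)
qed

text \<open>If all vertices of \<open>F\<close> had two neighbours in \<open>F\<close>, then the neighbours of the first vertex of a
  longest path would lie on the path, and one of them at distance at least two closes a cycle.\<close>

lemma acyclic_thin:
  assumes G: "finite_simple_graph V E" and acyc: "\<not> (\<exists>V'\<subseteq>V. \<exists>E'\<subseteq>E. cycle_graph V' E')"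
  shows "thin V E"
  unfolding thin_def
proof (intro allI impI, rule ccontr)
  fix F assume F: "F \<subseteq> V" "F \<noteq> {}"
    and "\<not> (\<exists>v\<in>F. \<forall>u\<in>F. \<forall>w\<in>F. {u, v} \<in> E \<longrightarrow> {w, v} \<in> E \<longrightarrow> u = w)"
  then have deg: "\<exists>u\<in>F. \<exists>w\<in>F. {u, v} \<in> E \<and> {w, v} \<in> E \<and> u \<noteq> w" if "v \<in> F" for v
    using that by simp
  note g = finite_simple_graphD[OF G]
  have finF: "finite F" using F g(1) finite_subset by blast
  define P where "P = {p. p \<noteq> [] \<and> distinct p \<and> set p \<subseteq> F \<and> (\<forall>i. Suc i < length p \<longrightarrow> {p ! i, p ! Suc i} \<in> E)}"
  obtain v0 where "v0 \<in> F" using F by blast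
  then have v0: "[v0] \<in> P" by (simp add: P_def)
  have bound: "length p \<le> card F" if "p \<in> P" for p
  proof -
    have "length p = card (set p)" "set p \<subseteq> F" using that by (simp_all add: P_def distinct_card)
    then show ?thesis using card_mono[OF finF] by simp
  qed
  have "\<exists>p. p \<in> P \<and> (\<forall>q. q \<in> P \<longrightarrow> length q \<le> length p)"
    by (rule ex_has_greatest_nat[of "\<lambda>p. p \<in> P" "[v0]" length "Suc (card F)"])
      (simp_all add: v0 bound less_Suc_eq_le)
  then obtain p where p: "p \<in> P" and max: "\<And>q. q \<in> P \<Longrightarrow> length q \<le> length p" by auto
  have p': "p \<noteq> []" "distinct p" "set p \<subseteq> F" "\<And>i. Suc i < length p \<Longrightarrow> {p ! i, p ! Suc i} \<in> E"
    using p by (auto simp: P_def)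
  then have "p ! 0 \<in> F" by (cases p) auto
  from deg[OF this] obtain u w
    where uw: "u \<in> F" "w \<in> F" "{u, p ! 0} \<in> E" "{w, p ! 0} \<in> E" "u \<noteq> w" by auto
  have inp: "u \<in> set p" if "u \<in> F" "{u, p ! 0} \<in> E" for u
  proof (rule ccontr)
    assume "u \<notin> set p"
    have "{(u # p) ! i, (u # p) ! Suc i} \<in> E" if "Suc i < length (u # p)" for i
      using that p'(4) \<open>{u, p ! 0} \<in> E\<close> by (cases i) auto
    then have "u # p \<in> P" using p' \<open>u \<in> F\<close> \<open>u \<notin> set p\<close> by (simp add: P_def)
    from max[OF this] show False by simp
  qed
  obtain i where i: "i < length p" "u = p ! i" using inp[OF uw(1,3)] by (auto simp: in_set_conv_nth)
  obtain j where j: "j < length p" "w = p ! j" using inp[OF uw(2,4)] by (auto simp: in_set_conv_nth)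
  note ij = i(1) j(1) i(2) j(2)
  have "i \<noteq> 0" using uw(3) g(3)[of "p ! 0"] ij by (intro notI) simp
  moreover have "j \<noteq> 0" using uw(4) g(3)[of "p ! 0"] ij by (intro notI) simp
  moreover have "i \<noteq> j" using uw(5) ij by (intro notI) simp
  ultimately have "i \<ge> 2 \<or> j \<ge> 2" by linarith
  moreover have "{p ! i, p ! 0} \<in> E" "{p ! j, p ! 0} \<in> E" using uw ij by simp_all
  ultimately obtain m where m: "m \<ge> 2" "m < length p" "{p ! m, p ! 0} \<in> E" using ij(1,2) by blast
  define vs where "vs = take (Suc m) p"
  have vs: "distinct vs" "length vs = Suc m" "set vs \<subseteq> V"
    using p' m F set_take_subset[of "Suc m" p] by (auto simp: vs_def)
  have "{vs ! i, vs ! (Suc i mod length vs)} \<in> E" if "i < length vs" for i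
  proof (cases "i = m")
    case True
    then show ?thesis using m by (simp add: vs_def)
  next
    case False
    then have "Suc i < Suc m" using that vs by simp
    then show ?thesis using p'(4)[of i] m vs(2) by (simp add: vs_def)
  qed
  then have "{{vs ! i, vs ! (Suc i mod length vs)} |i. i < length vs} \<subseteq> E" by blast
  moreover have "cycle_graph (set vs) {{vs ! i, vs ! (Suc i mod length vs)} |i. i < length vs}"
    unfolding cycle_graph_def using vs m by (intro exI[of _ vs] conjI refl) simp_all
  ultimately show False using acyc vs(3) by simp
qed

text \<open>Going around the cycle one leaves the nonempty proper subset \<open>F'\<close> at some vertex; only its
  predecessor can be a neighbour of it in \<open>F'\<close>.\<close>

lemma cycle_proper_subset_thin:
  assumes vs: "distinct vs" "3 \<le> length vs"
    and E: "E = {{vs ! i, vs ! (Suc i mod length vs)} |i. i < length vs}"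
    and F: "F \<subset> set vs"
  shows "thin F E"
  unfolding thin_def
proof (intro allI impI)
  fix F' assume F': "F' \<subseteq> F" "F' \<noteq> {}"
  let ?n = "length vs"
  have "\<exists>i<?n. vs ! i \<in> F' \<and> vs ! (Suc i mod ?n) \<notin> F'"
  proof (rule ccontr)
    assume "\<not> ?thesis"
    then have step: "vs ! (Suc i mod ?n) \<in> F'" if "i < ?n" "vs ! i \<in> F'" for i using that by blast
    obtain i where i: "i < ?n" "vs ! i \<in> F'"
    proof -
      obtain v where "v \<in> F'" "v \<in> set vs" using F' F by blast
      then show thesis using that by (auto simp: in_set_conv_nth)
    qed
    have "vs ! ((i + j) mod ?n) \<in> F'" for j
    proof (induction j)
      case (Suc j)
      have "(i + j) mod ?n < ?n" using i(1) by (intro mod_less_divisor) linarith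
      from step[OF this Suc] show ?case by (simp add: mod_Suc_eq)
    qed (use i in simp)
    note all = this
    have "vs ! j \<in> F'" if "j < ?n" for j
    proof -
      have "i + (j + ?n - i) = j + ?n" using i(1) by simp
      then show ?thesis using all[of "j + ?n - i"] that by simp
    qed
    then have "set vs \<subseteq> F'" by (auto simp: in_set_conv_nth)
    with F F' show False by blast
  qed
  then obtain i where i: "i < ?n" "vs ! i \<in> F'" "vs ! (Suc i mod ?n) \<notin> F'" by blast
  have nbr: "u = vs ! ((i + ?n - 1) mod ?n)" if u: "u \<in> F'" "{u, vs ! i} \<in> E" for u
  proof -
    obtain j where j: "j < ?n" "{u, vs ! i} = {vs ! j, vs ! (Suc j mod ?n)}" using u E by blast
    have uj: "u = vs ! j \<and> vs ! i = vs ! (Suc j mod ?n)"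
    proof (rule ccontr)
      assume "\<not> ?thesis"
      then have e: "vs ! i = vs ! j" "u = vs ! (Suc j mod ?n)" using j(2) by (auto simp: doubleton_eq_iff)
      then have "i = j" using nth_eq_iff_index_eq[OF vs(1) i(1) j(1)] by simp
      with e i(3) u(1) show False by simp
    qed
    have "Suc j mod ?n < ?n" using vs(2) by (intro mod_less_divisor) linarith
    then have "i = Suc j mod ?n" using uj nth_eq_iff_index_eq[OF vs(1) i(1)] by simp
    then have "(i + ?n - 1) mod ?n = j"
      using j(1) vs(2) by (cases "Suc j = ?n") auto
    with uj show ?thesis by simp
  qed
  show "\<exists>v\<in>F'. \<forall>u\<in>F'. \<forall>w\<in>F'. {u, v} \<in> E \<longrightarrow> {w, v} \<in> E \<longrightarrow> u = w"
    using i(2) nbr by blast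
qed

text \<open>Used to start the numbering of a cycle right after a chosen edge.\<close>

lemma cycle_rotate:
  assumes vs: "distinct vs" "3 \<le> length vs" and m: "m < length vs"
  defines "e \<equiv> \<lambda>vs i. {vs ! i, vs ! (Suc i mod length vs)}"
  shows "\<exists>ws. distinct ws \<and> length ws = length vs \<and> set ws = set vs \<and>
    {e ws i |i. i < length ws} = {e vs i |i. i < length vs} \<and> e ws (length ws - 1) = e vs m"
proof (intro exI conjI)
  let ?n = "length vs" and ?ws = "rotate (Suc m) vs"
  show "distinct ?ws" "length ?ws = ?n" "set ?ws = set vs" using vs by simp_all
  have ei: "e ?ws i = e vs ((Suc m + i) mod ?n)" if "i < ?n" for i
  proof -
    have "0 < ?n" using vs by linarith
    then have "Suc i mod ?n < ?n" by simp
    then have "?ws ! (Suc i mod ?n) = vs ! ((Suc m + Suc i mod ?n) mod ?n)" by (rule nth_rotate)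
    also have "(Suc m + Suc i mod ?n) mod ?n = Suc ((Suc m + i) mod ?n) mod ?n"
      by (simp only: mod_add_right_eq mod_Suc_eq add_Suc_right)
    finally show ?thesis unfolding e_def using that by (simp add: nth_rotate[of i vs "Suc m"] del: rotate_Suc)
  qed
  have "e ?ws (?n - 1) = e vs ((Suc m + (?n - 1)) mod ?n)" using vs by (intro ei) linarith
  also have "Suc m + (?n - 1) = m + ?n" using m by linarith
  also have "(m + ?n) mod ?n = m" using m by simp
  finally show "e ?ws (length ?ws - 1) = e vs m" by simp
  have pos: "0 < ?n" using m by linarith
  have onto: "i \<in> (\<lambda>i. (Suc m + i) mod ?n) ` {..<?n}" if "i < ?n" for i
  proof (rule image_eqI)
    have "(Suc m + (i + ?n - Suc m) mod ?n) mod ?n = (Suc m + (i + ?n - Suc m)) mod ?n"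
      by (rule mod_add_right_eq)
    also have "Suc m + (i + ?n - Suc m) = i + ?n" using m by simp
    finally show "i = (Suc m + (i + ?n - Suc m) mod ?n) mod ?n" using that by simp
    show "(i + ?n - Suc m) mod ?n \<in> {..<?n}" using pos by simp
  qed
  have "(\<lambda>i. (Suc m + i) mod ?n) ` {..<?n} = {..<?n}"
  proof
    show "(\<lambda>i. (Suc m + i) mod ?n) ` {..<?n} \<subseteq> {..<?n}" using pos by auto
    show "{..<?n} \<subseteq> (\<lambda>i. (Suc m + i) mod ?n) ` {..<?n}" by (rule subsetI, rule onto) simp
  qed
  then have "e vs ` {..<?n} = e vs ` (\<lambda>i. (Suc m + i) mod ?n) ` {..<?n}" by simp
  also have "\<dots> = (\<lambda>i. e vs ((Suc m + i) mod ?n)) ` {..<?n}" by (rule image_image)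
  also have "\<dots> = e ?ws ` {..<?n}" by (intro image_cong) (simp_all add: ei del: rotate_Suc)
  finally have "e vs ` {..<?n} = e ?ws ` {..<?n}" .
  note img = this[symmetric]
  have S: "{e us i |i. i < l} = e us ` {..<l}" for us l by auto
  show "{e ?ws i |i. i < length ?ws} = {e vs i |i. i < ?n}"
    unfolding S length_rotate by (rule img)
qed

text \<open>Since the last edge lies in \<open>N\<close>, the number \<open>c i\<close> of edges of \<open>N\<close> before vertex \<open>i\<close> runs
  from \<open>0\<close> to \<open>k - 1\<close>. Vertices with the same number are joined by edges outside \<open>N\<close>, so they
  have equal lines, and \<open>c\<close> exhibits the configuration as the pullback of a polygon with \<open>k\<close> vertices.
  As all \<open>n \<ge> 3\<close> vertices lie on edges of \<open>N\<close>, a single edge does not suffice and \<open>k \<ge> 2\<close>.\<close>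

lemma full_cycle_line_connected:
  assumes vs: "distinct vs" "3 \<le> length vs"
    and E: "E = {{vs ! i, vs ! (Suc i mod length vs)} |i. i < length vs}"
    and N: "N \<subseteq> E" "set vs \<subseteq> \<Union>N" and last: "{vs ! (length vs - 1), vs ! 0} \<in> N"
  shows "line_connected (set vs) E N"
proof -
  define n where "n = length vs"
  define e where "e i = {vs ! i, vs ! (Suc i mod n)}" for i
  define c where "c i = card {j. j < i \<and> e j \<in> N}" for i
  define k where "k = c n"
  have n: "n \<ge> 3" using vs by (simp add: n_def)
  have "Suc (n - 1) mod n = 0" using n by simp
  then have e_last: "e (n - 1) \<in> N" using last by (simp only: e_def flip: n_def)
  have c0: "c 0 = 0" by (simp add: c_def)
  have cSuc: "c (Suc i) = (if e i \<in> N then Suc (c i) else c i)" for i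
  proof -
    have "{j. j < Suc i \<and> e j \<in> N} = (if e i \<in> N then insert i {j. j < i \<and> e j \<in> N} else {j. j < i \<and> e j \<in> N})"
      by (auto simp: less_Suc_eq)
    then show ?thesis by (simp add: c_def)
  qed
  have mono: "c i \<le> c j" if "i \<le> j" for i j
    unfolding c_def using that by (intro card_mono) auto
  have k_Suc: "k = Suc (c (n - 1))"
    using cSuc[of "n - 1"] e_last n by (simp add: k_def)
  have ck: "c i < k" if "i < n" for i
  proof -
    have "i \<le> n - 1" using that by linarith
    from mono[OF this] show ?thesis by (simp add: k_Suc less_Suc_eq_le)
  qed
  have edge: "e i \<in> E" if "i < n" for i
    using that unfolding E e_def n_def by blast
  have edge': "\<exists>i<n. {u, v} = e i" if "{u, v} \<in> E" for u v
    using that unfolding E e_def n_def by blast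
  have k2: "k \<ge> 2"
  proof -
    have "1 < length vs" using vs(2) by linarith
    then have "vs ! 1 \<in> set vs" by (rule nth_mem)
    then have "vs ! 1 \<in> \<Union>N" using N(2) by (rule subsetD[rotated])
    then obtain j where j: "j < n" "e j \<in> N" "vs ! 1 \<in> e j"
      using N(1) unfolding E e_def n_def by blast
    have "1 < length vs" "n - 1 < length vs" "0 < length vs" "1 \<noteq> n - 1"
      using n unfolding n_def by linarith+
    then have ne: "vs ! 1 \<noteq> vs ! (n - 1)" "vs ! 1 \<noteq> vs ! 0"
      using nth_eq_iff_index_eq[OF vs(1), of 1 "n - 1"] nth_eq_iff_index_eq[OF vs(1), of 1 0] by simp_all
    have "j \<noteq> n - 1"
    proof
      assume "j = n - 1"
      moreover have "Suc (n - 1) mod n = 0" using n by simp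
      ultimately have "vs ! 1 \<in> {vs ! (n - 1), vs ! 0}" using j(3) unfolding e_def by simp
      with ne show False by simp
    qed
    then have "Suc j \<le> n - 1" using j(1) by simp
    then have "c (Suc j) \<le> c (n - 1)" by (rule mono)
    then show ?thesis using j(2) by (simp add: cSuc k_Suc)
  qed
  have ex: "\<exists>i<m. e i \<in> N \<and> c i = j" if "j < c m" for j m
    using that
  proof (induction m)
    case (Suc m)
    then show ?case
      by (cases "j < c m") (auto simp: cSuc less_Suc_eq split: if_splits)
  qed (simp add: c0)
  \<comment> \<open>The last vertex of the block of vertices with number \<open>j\<close>.\<close>
  define g where "g j = (SOME i. i < n \<and> e i \<in> N \<and> c i = j)" for j
  have g: "g j < n \<and> e (g j) \<in> N \<and> c (g j) = j" if "j < k" for j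
  proof -
    have "j < c n" using that by (simp only: k_def)
    from someI_ex[OF ex[OF this]] show ?thesis by (simp only: g_def)
  qed
  define f where "f v = c (THE i. i < n \<and> vs ! i = v)" for v
  have f: "f (vs ! i) = c i" if "i < n" for i
  proof -
    have "(THE j. j < n \<and> vs ! j = vs ! i) = i"
      using that nth_eq_iff_index_eq[OF vs(1)] by (intro the_equality) (auto simp: n_def)
    then show ?thesis by (simp add: f_def)
  qed
  have inV: "vs ! i \<in> set vs" if "i < n" for i using that by (simp add: n_def)
  have inV': "\<exists>i<n. v = vs ! i" if "v \<in> set vs" for v using that by (auto simp: in_set_conv_nth n_def)
  show ?thesis
  proof (rule line_connected_pullback[OF polygon_connected[OF k2]])
    show "f ` set vs \<subseteq> {..<k}" using f ck inV' by fastforce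
  next
    fix u v assume "u \<in> set vs" "v \<in> set vs" "{u, v} \<in> E"
    then obtain i where i: "i < n" "{u, v} = e i" using edge' by blast
    have "Suc i mod n < n" using n by simp
    then have "f ` e i = {c i, c (Suc i mod n)}" using f i(1) by (simp add: e_def)
    then have img: "{f u, f v} = {c i, c (Suc i mod n)}" by (simp flip: i(2))
    have wrap: "c (Suc i mod n) = (if e i \<in> N then Suc (c i) mod k else c i)"
    proof (cases "Suc i = n")
      case True
      then show ?thesis using e_last k_Suc by (auto simp: c0)
    next
      case False
      then have "Suc i < n" using i by simp
      then show ?thesis using cSuc[of i] ck[of "Suc i"] by (cases "e i \<in> N") simp_all
    qed
    show "if {u, v} \<in> N then {f u, f v} \<in> cycle_edges k \<and> {f u, f v} \<in> cycle_edges k else f u = f v"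
    proof (cases "{u, v} \<in> N")
      case True
      have "{c i, Suc (c i) mod k} \<in> cycle_edges k"
        unfolding cycle_edges_def using ck[OF i(1)] by blast
      with True show ?thesis by (simp add: img wrap flip: i(2))
    next
      case False
      then have "{f u, f v} = {c i}" using img wrap i(2) by simp
      then have "f u = c i" "f v = c i" by blast+
      with False show ?thesis by simp
    qed
  next
    fix x assume x: "line_config (set vs) E N x"
    have nz: "x (vs ! i) \<noteq> 0" if "i < n" for i using line_configD(1)[OF x inV[OF that]] .
    have perp: "x (vs ! i) \<bullet> x (vs ! (Suc i mod n)) = 0" if i: "i < n" "e i \<in> N" for i
    proof -
      have "Suc i mod n < n" using n by simp
      then show ?thesis using line_configD(2)[OF x] i inV edge[OF i(1)] by (simp add: e_def)
    qed
    have par: "\<exists>a. a \<noteq> 0 \<and> x (vs ! (i + d)) = a *\<^sub>R x (vs ! i)" if "i + d < n" "c i = c (i + d)" for i d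
      using that
    proof (induction d)
      case 0
      show ?case by (rule exI[of _ 1]) simp
    next
      case (Suc d)
      have "c i \<le> c (i + d)" "c (i + d) \<le> c (Suc (i + d))" by (simp_all add: mono)
      then have eq: "c i = c (i + d)" "c (Suc (i + d)) = c (i + d)" using Suc.prems by simp_all
      then have nN: "e (i + d) \<notin> N" by (simp add: cSuc split: if_splits)
      have lt: "i + d < n" "Suc (i + d) < n" using Suc.prems by simp_all
      have "e (i + d) = {vs ! (i + d), vs ! Suc (i + d)}" using lt by (simp add: e_def)
      then have "cross3 (x (vs ! (i + d))) (x (vs ! Suc (i + d))) = 0"
        using line_configD(3)[OF x inV inV] edge[OF lt(1)] lt nN by simp
      then obtain b where b: "b \<noteq> 0" "x (vs ! Suc (i + d)) = b *\<^sub>R x (vs ! (i + d))"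
        using nz[OF lt(1)] nz[OF lt(2)] by (rule parallel_multiple)
      obtain a where "a \<noteq> 0" "x (vs ! (i + d)) = a *\<^sub>R x (vs ! i)" using Suc.IH lt(1) eq(1) by blast
      with b show ?case by (intro exI[of _ "b * a"]) simp
    qed
    have par': "\<exists>a. a \<noteq> 0 \<and> x (vs ! j) = a *\<^sub>R x (vs ! i)" if ij: "i < n" "j < n" "c i = c j" for i j
    proof (cases "i \<le> j")
      case True
      then show ?thesis using par[of i "j - i"] ij by simp
    next
      case False
      then obtain a where "a \<noteq> 0" "x (vs ! i) = a *\<^sub>R x (vs ! j)" using par[of j "i - j"] ij by auto
      then show ?thesis by (intro exI[of _ "inverse a"]) simp
    qed
    define y where "y j = x (vs ! g j)" for j
    have "polygon k y"
      unfolding polygon_iff[OF order_trans[OF one_le_numeral k2]]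
    proof (intro conjI allI impI)
      fix j assume "j < k"
      then show "y j \<noteq> 0" using nz g by (simp add: y_def)
    next
      fix j assume j: "Suc j < k"
      note gj = g[OF Suc_lessD[OF j]] and gj' = g[OF j]
      have "g j \<noteq> n - 1" using gj j k_Suc by auto
      then have lt: "Suc (g j) < n" using gj by linarith
      have "c (Suc (g j)) = c (g (Suc j))" using gj gj' by (simp add: cSuc)
      then obtain a where a: "x (vs ! g (Suc j)) = a *\<^sub>R x (vs ! Suc (g j))" using par' lt gj' by blast
      have "x (vs ! g j) \<bullet> x (vs ! Suc (g j)) = 0" using perp[of "g j"] gj lt by simp
      then show "y j \<bullet> y (Suc j) = 0" by (simp add: y_def a)
    next
      have k1: "k - 1 < k" "0 < k" using k2 by simp_all
      note gl = g[OF k1(1)] and g0 = g[OF k1(2)]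
      have "g (k - 1) = n - 1"
      proof (rule ccontr)
        assume "g (k - 1) \<noteq> n - 1"
        then have "Suc (g (k - 1)) < n" using gl by linarith
        then have "c (Suc (g (k - 1))) < k" by (rule ck)
        then show False using gl by (simp add: cSuc)
      qed
      then have "x (vs ! g (k - 1)) \<bullet> x (vs ! 0) = 0" using perp[of "n - 1"] e_last n by simp
      moreover obtain a where "x (vs ! g 0) = a *\<^sub>R x (vs ! 0)" using par'[of 0 "g 0"] g0 n by (auto simp: c0)
      ultimately show "y (k - 1) \<bullet> y 0 = 0" by (simp add: y_def)
    qed
    moreover have "\<exists>a. a \<noteq> 0 \<and> y (f v) = a *\<^sub>R x v" if v: "v \<in> set vs" for v
    proof -
      obtain i where i: "i < n" "v = vs ! i" using inV'[OF v] by blast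
      then show ?thesis using par'[of i "g (c i)"] g[OF ck[OF i(1)]] f by (simp add: y_def)
    qed
    ultimately show "\<exists>y. line_config {..<k} (cycle_edges k) (cycle_edges k) y \<and>
        (\<forall>v\<in>set vs. \<exists>c. c \<noteq> 0 \<and> y (f v) = c *\<^sub>R x v)"
      unfolding polygon_def by blast
  qed
qed

text \<open>Either the graph on \<open>\<Union>N\<close> is thin, or \<open>\<Union>N\<close> consists of all vertices of a cycle.\<close>

lemma tree_or_cycle_line_connected:
  assumes G: "finite_simple_graph V E" and tc: "tree_graph V E \<or> cycle_graph V E" and N: "N \<subseteq> E"
  shows "line_connected (\<Union>N) E N"
proof -
  note g = finite_simple_graphD[OF G]
  have sub: "\<Union>N \<subseteq> V" using N g(2) by blast
  have fin: "finite (\<Union>N)" using sub g(1) by (rule finite_subset)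
  show ?thesis
  proof (cases "thin (\<Union>N) E")
    case True
    then show ?thesis using thin_line_connected[OF fin] g(3) by blast
  next
    case False
    then have "\<not> thin V E" using sub unfolding thin_def by (meson subset_trans)
    then have "\<not> tree_graph V E" using acyclic_thin[OF G] unfolding tree_graph_def by auto
    then have "cycle_graph V E" using tc by simp
    then obtain vs where vs: "distinct vs" "3 \<le> length vs" "V = set vs"
      and E: "E = {{vs ! i, vs ! (Suc i mod length vs)} |i. i < length vs}"
      unfolding cycle_graph_def by auto
    have full: "\<Union>N = set vs"
      using cycle_proper_subset_thin[OF vs(1,2) E] False sub vs(3) by (auto simp: psubset_eq)
    have "vs ! 0 \<in> set vs" using vs(2) by (intro nth_mem) linarith
    then have "vs ! 0 \<in> \<Union>N" using full by simp
    then obtain m where m: "m < length vs" "{vs ! m, vs ! (Suc m mod length vs)} \<in> N"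
      using N unfolding E by blast
    obtain ws where ws: "distinct ws" "length ws = length vs" "set ws = set vs"
      "{{ws ! i, ws ! (Suc i mod length ws)} |i. i < length ws} = E"
      "{ws ! (length ws - 1), ws ! (Suc (length ws - 1) mod length ws)} = {vs ! m, vs ! (Suc m mod length vs)}"
      using cycle_rotate[OF vs(1,2) m(1)] unfolding E by auto
    have "Suc (length ws - 1) = length ws" using ws(2) vs(2) by linarith
    then have "Suc (length ws - 1) mod length ws = 0" by (simp only: mod_self)
    then have "{ws ! (length ws - 1), ws ! 0} \<in> N" using ws(5) m(2) by simp
    then have "line_connected (set ws) E N"
      using ws vs(2) N full by (intro full_cycle_line_connected) simp_all
    then show ?thesis using full ws(3) by simp
  qed
qed

section \<open>Strata of commuting tuples\<close>

lemma connected_components_of_open_partition: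
  assumes cover: "\<Union>\<U> = topspace X"
    and U: "\<And>U. U \<in> \<U> \<Longrightarrow> openin X U \<and> connectedin X U \<and> U \<noteq> {}"
    and disj: "\<And>U W x. \<lbrakk>U \<in> \<U>; W \<in> \<U>; x \<in> U; x \<in> W\<rbrakk> \<Longrightarrow> U = W"
  shows "connected_components_of X = \<U>"
proof -
  have sub: "U \<subseteq> topspace X" if "U \<in> \<U>" for U using that by (simp add: Union_upper flip: cover)
  have comp: "connected_component_of_set X x = U" if UU: "U \<in> \<U>" and x: "x \<in> U" for x U
  proof
    have U': "openin X U" "connectedin X U" using U[OF UU] by simp_all
    have "topspace X - U \<subseteq> \<Union>(\<U> - {U})" unfolding cover[symmetric] by auto
    moreover have "\<Union>(\<U> - {U}) \<subseteq> topspace X - U"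
    proof
      fix y assume "y \<in> \<Union>(\<U> - {U})"
      then obtain W where W: "W \<in> \<U>" "W \<noteq> U" "y \<in> W" by auto
      then have "y \<notin> U" using disj[OF W(1) UU W(3)] by auto
      then show "y \<in> topspace X - U" using sub[OF W(1)] W(3) by auto
    qed
    ultimately have "topspace X - U = \<Union>(\<U> - {U})" by (rule equalityI)
    moreover have "openin X (\<Union>(\<U> - {U}))" by (rule openin_Union) (simp add: U)
    ultimately have "openin X (topspace X - U)" by simp
    then have clo: "closedin X U" using sub[OF UU] by (simp only: closedin_def simp_thms)
    have "connected_component_of_set X x \<subseteq> U \<or> disjnt (connected_component_of_set X x) U"
      by (rule connectedin_clopen_cases[OF connectedin_connected_component_of clo U'(1)])
    moreover have "x \<in> connected_component_of_set X x"
      using subsetD[OF sub[OF UU] x] by (simp add: connected_component_of_refl)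
    ultimately show "connected_component_of_set X x \<subseteq> U" using x by (auto simp: disjnt_iff)
    show "U \<subseteq> connected_component_of_set X x" by (rule connected_component_of_maximal[OF U'(2) x])
  qed
  show ?thesis
  proof
    show "connected_components_of X \<subseteq> \<U>"
    proof
      fix C assume "C \<in> connected_components_of X"
      then obtain x where x: "x \<in> topspace X" "C = connected_component_of_set X x"
        by (auto simp: connected_components_of_def)
      then obtain W where W: "W \<in> \<U>" "x \<in> W" by (auto simp flip: cover)
      then show "C \<in> \<U>" using comp[OF W] x(2) by simp
    qed
    show "\<U> \<subseteq> connected_components_of X"
    proof
      fix W assume W: "W \<in> \<U>"
      then obtain x where x: "x \<in> W" using U[OF W] by auto
      have "x \<in> topspace X" using subsetD[OF sub[OF W] x] .
      then show "W \<in> connected_components_of X"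
        unfolding connected_components_of_def using comp[OF W x] by (intro image_eqI[of _ _ x]) simp_all
    qed
  qed
qed

lemma card_connected_components_of_homeomorphic:
  assumes "homeomorphic_map X Y f"
  shows "card (connected_components_of X) = card (connected_components_of Y)"
proof -
  have "inj_on ((`) f) (Pow (topspace X))"
    using homeomorphic_imp_injective_map[OF assms] by (rule inj_on_image_Pow)
  then have "inj_on ((`) f) (connected_components_of X)"
    by (rule inj_on_subset) (use connected_components_of_subset in blast)
  then show ?thesis
    by (simp add: homeomorphic_map_connected_components_of[OF assms] card_image)
qed

text \<open>Lifts of commuting tuples for which \<open>N\<close> is the set of edges with anticommuting lifts.\<close>

definition quat_config :: "'v set \<Rightarrow> 'v set set \<Rightarrow> 'v set set \<Rightarrow> ('v \<Rightarrow> real \<times> (real^3)) \<Rightarrow> bool" where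
  "quat_config V E N q \<longleftrightarrow> (\<forall>v\<in>V. q v \<noteq> 0) \<and>
     (\<forall>u\<in>V. \<forall>v\<in>V. {u, v} \<in> E \<longrightarrow>
        ({u, v} \<in> N \<longrightarrow> fst (q u) = 0 \<and> fst (q v) = 0 \<and> snd (q u) \<bullet> snd (q v) = 0) \<and>
        ({u, v} \<notin> N \<longrightarrow> cross3 (snd (q u)) (snd (q v)) = 0))"

definition rotation_tuple :: "'v set \<Rightarrow> ('v \<Rightarrow> real \<times> (real^3)) \<Rightarrow> 'v \<Rightarrow> real^3^3" where
  "rotation_tuple V q = (\<lambda>v\<in>V. rotq (q v))"

definition stratum :: "'v set \<Rightarrow> 'v set set \<Rightarrow> 'v set set \<Rightarrow> ('v \<Rightarrow> real^3^3) set" where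
  "stratum V E N = rotation_tuple V ` {q. quat_config V E N q}"

lemma quat_configD:
  assumes "quat_config V E N q"
  shows "v \<in> V \<Longrightarrow> q v \<noteq> 0"
    and "\<lbrakk>u \<in> V; v \<in> V; {u, v} \<in> E; {u, v} \<in> N\<rbrakk> \<Longrightarrow> fst (q u) = 0 \<and> fst (q v) = 0 \<and> snd (q u) \<bullet> snd (q v) = 0"
    and "\<lbrakk>u \<in> V; v \<in> V; {u, v} \<in> E; {u, v} \<notin> N\<rbrakk> \<Longrightarrow> cross3 (snd (q u)) (snd (q v)) = 0"
  using assms unfolding quat_config_def by blast+

lemma quat_configI:
  assumes "\<And>v. v \<in> V \<Longrightarrow> q v \<noteq> 0"
    and "\<And>u v. \<lbrakk>u \<in> V; v \<in> V; {u, v} \<in> E; {u, v} \<in> N\<rbrakk> \<Longrightarrow> fst (q u) = 0 \<and> fst (q v) = 0 \<and> snd (q u) \<bullet> snd (q v) = 0"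
    and "\<And>u v. \<lbrakk>u \<in> V; v \<in> V; {u, v} \<in> E; {u, v} \<notin> N\<rbrakk> \<Longrightarrow> cross3 (snd (q u)) (snd (q v)) = 0"
  shows "quat_config V E N q"
  unfolding quat_config_def using assms by simp

lemma stratum_commuting: "stratum V E N \<subseteq> commuting_tuples V E SO3"
proof
  fix g assume "g \<in> stratum V E N"
  then obtain q where q: "quat_config V E N q" and g: "g = rotation_tuple V q"
    by (auto simp: stratum_def)
  show "g \<in> commuting_tuples V E SO3"
    unfolding commuting_tuples_def
  proof (intro CollectI conjI ballI impI)
    show "g \<in> V \<rightarrow>\<^sub>E carrier SO3"
      using rotq_in_SO3 quat_configD(1)[OF q] by (auto simp: g rotation_tuple_def)
    fix u v assume uv: "u \<in> V" "v \<in> V" "{u, v} \<in> E"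
    have "rotq (q u) ** rotq (q v) = rotq (q v) ** rotq (q u)"
      by (rule rotq_commute_if) (use quat_configD(2,3)[OF q uv] in blast)
    then show "g u \<otimes>\<^bsub>SO3\<^esub> g v = g v \<otimes>\<^bsub>SO3\<^esub> g u"
      using uv by (simp add: g rotation_tuple_def SO3_def)
  qed
qed

text \<open>Choose lifts and let \<open>N\<close> consist of the edges along which they anticommute.\<close>

lemma commuting_in_stratum:
  assumes "finite_simple_graph V E" "g \<in> commuting_tuples V E SO3"
  obtains N where "N \<subseteq> E" "g \<in> stratum V E N"
proof -
  have g: "g \<in> V \<rightarrow>\<^sub>E carrier SO3"
    and comm: "\<And>u v. \<lbrakk>u \<in> V; v \<in> V; {u, v} \<in> E\<rbrakk> \<Longrightarrow> g u ** g v = g v ** g u"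
    using assms(2) by (auto simp: commuting_tuples_def SO3_def)
  have "\<exists>q. q \<noteq> 0 \<and> g v = rotq q" if "v \<in> V" for v
    using rotq_surj[of "g v"] g that by blast
  then obtain q where q: "\<And>v. v \<in> V \<Longrightarrow> q v \<noteq> 0 \<and> g v = rotq (q v)" by metis
  define anti where "anti u v \<longleftrightarrow> fst (q u) = 0 \<and> fst (q v) = 0 \<and> snd (q u) \<bullet> snd (q v) = 0" for u v
  have anti_sym: "anti u v \<longleftrightarrow> anti v u" for u v by (auto simp: anti_def inner_commute)
  define N where "N = {e \<in> E. \<exists>u v. e = {u, v} \<and> anti u v}"
  have "quat_config V E N q"
  proof (rule quat_configI)
    fix u v assume "u \<in> V" "v \<in> V" "{u, v} \<in> E" "{u, v} \<in> N"
    then have "anti u v" using anti_sym by (auto simp: N_def doubleton_eq_iff)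
    then show "fst (q u) = 0 \<and> fst (q v) = 0 \<and> snd (q u) \<bullet> snd (q v) = 0" by (simp add: anti_def)
  next
    fix u v assume uv: "u \<in> V" "v \<in> V" "{u, v} \<in> E" "{u, v} \<notin> N"
    then have "\<not> anti u v" by (auto simp: N_def)
    moreover have "rotq (q u) ** rotq (q v) = rotq (q v) ** rotq (q u)"
      using comm[OF uv(1-3)] q uv by simp
    ultimately show "cross3 (snd (q u)) (snd (q v)) = 0"
      using rotq_commute_cases[of "q u" "q v"] q uv unfolding anti_def by blast
  qed (use q in blast)
  moreover have "g = rotation_tuple V q"
    using g q by (auto simp: rotation_tuple_def PiE_def extensional_def restrict_def fun_eq_iff)
  ultimately have "g \<in> stratum V E N" by (auto simp: stratum_def)
  moreover have "N \<subseteq> E" by (auto simp: N_def)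
  ultimately show thesis by (rule that[rotated])
qed

text \<open>A continuous function of the pair of rotations on an edge that detects whether their lifts
  anticommute.\<close>

definition edge_trace :: "(real^3^3) \<times> (real^3^3) \<Rightarrow> real" where
  "edge_trace p = trace (fst p) + trace (snd p) + trace (fst p ** snd p)"

lemma stratum_edge_trace:
  assumes g: "g \<in> stratum V E N" and uv: "u \<in> V" "v \<in> V" "{u, v} \<in> E"
  shows "{u, v} \<in> N \<Longrightarrow> edge_trace (g u, g v) < -2" "{u, v} \<notin> N \<Longrightarrow> edge_trace (g u, g v) > -2"
proof -
  obtain q where q: "quat_config V E N q" and g: "g = rotation_tuple V q"
    using assms(1) by (auto simp: stratum_def)
  have e: "edge_trace (g u, g v) = trace (rotq (q u)) + trace (rotq (q v)) + trace (rotq (q u) ** rotq (q v))"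
    using uv by (simp add: edge_trace_def g rotation_tuple_def)
  have nz: "q u \<noteq> 0" "q v \<noteq> 0" using quat_configD(1)[OF q] uv by auto
  show "edge_trace (g u, g v) < -2" if "{u, v} \<in> N"
    using trace_sum_anticommuting[OF nz] quat_configD(2)[OF q uv that] e by simp
  show "edge_trace (g u, g v) > -2" if "{u, v} \<notin> N"
    using trace_sum_common_axis[OF nz] quat_configD(3)[OF q uv that] e by simp
qed

lemma finite_simple_graph_edgeE:
  assumes "finite_simple_graph V E" "e \<in> E"
  obtains u v where "u \<in> V" "v \<in> V" "e = {u, v}"
proof -
  have "card e = 2" "e \<subseteq> V" using assms by (auto simp: finite_simple_graph_def)
  then show thesis using that by (auto simp: card_2_iff)
qed

text \<open>The right-hand side is the description that shows openness.\<close>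

lemma stratum_eq:
  assumes G: "finite_simple_graph V E" and N: "N \<subseteq> E"
  shows "stratum V E N = {g \<in> commuting_tuples V E SO3. \<forall>u\<in>V. \<forall>v\<in>V. {u, v} \<in> E \<longrightarrow>
     ({u, v} \<in> N \<longrightarrow> edge_trace (g u, g v) < -2) \<and> ({u, v} \<notin> N \<longrightarrow> edge_trace (g u, g v) > -2)}"
    (is "_ = ?R")
proof
  show "stratum V E N \<subseteq> ?R"
    using stratum_commuting stratum_edge_trace by fast
  show "?R \<subseteq> stratum V E N"
  proof
    fix g assume g: "g \<in> ?R"
    then obtain N' where N': "N' \<subseteq> E" "g \<in> stratum V E N'" using commuting_in_stratum[OF G] by blast
    have "e \<in> N \<longleftrightarrow> e \<in> N'" if e: "e \<in> E" for e
    proof -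
      obtain u v where uv: "u \<in> V" "v \<in> V" "e = {u, v}" using finite_simple_graph_edgeE[OF G e] .
      have "(e \<in> N \<longrightarrow> edge_trace (g u, g v) < -2) \<and> (e \<notin> N \<longrightarrow> edge_trace (g u, g v) > -2)"
        using g uv e by simp
      moreover have "(e \<in> N' \<longrightarrow> edge_trace (g u, g v) < -2) \<and> (e \<notin> N' \<longrightarrow> edge_trace (g u, g v) > -2)"
        using stratum_edge_trace[OF N'(2) uv(1,2)] e uv(3) by simp
      ultimately show ?thesis by linarith
    qed
    then have "N = N'" using N N'(1) by blast
    with N' show "g \<in> stratum V E N" by simp
  qed
qed

lemma strata_disjoint:
  assumes G: "finite_simple_graph V E" and "N \<subseteq> E" "N' \<subseteq> E" "g \<in> stratum V E N" "g \<in> stratum V E N'"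
  shows "N = N'"
proof -
  have "e \<in> N \<longleftrightarrow> e \<in> N'" if e: "e \<in> E" for e
  proof -
    obtain u v where uv: "u \<in> V" "v \<in> V" "e = {u, v}" using finite_simple_graph_edgeE[OF G e] .
    show ?thesis
      using stratum_edge_trace[OF assms(4) uv(1,2)] stratum_edge_trace[OF assms(5) uv(1,2)] e uv(3)
      by fastforce
  qed
  then show ?thesis using assms by blast
qed

lemma openin_stratum:
  assumes G: "finite_simple_graph V E" and N: "N \<subseteq> E"
  shows "openin (subtopology (product_topology (\<lambda>_. SO3_topology) V) (commuting_tuples V E SO3)) (stratum V E N)"
proof -
  define T where "T = subtopology (product_topology (\<lambda>_. SO3_topology) V) (commuting_tuples V E SO3)"
  have top: "topspace T = commuting_tuples V E SO3"
    by (auto simp: T_def SO3_topology_def commuting_tuples_def)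
  have "continuous_map euclidean euclideanreal edge_trace"
    unfolding edge_trace_def trace_def matrix_matrix_mult_def
    by (simp, intro continuous_intros)
  then have ct: "continuous_map T euclideanreal (\<lambda>g. edge_trace (g u, g v))" if "u \<in> V" "v \<in> V" for u v
  proof -
    have 1: "continuous_map T euclidean (\<lambda>g. g u)" if "u \<in> V" for u
      using continuous_map_from_subtopology[OF continuous_map_product_projection[OF that, of "\<lambda>_. SO3_topology"]]
      unfolding T_def SO3_topology_def by (rule continuous_map_into_fulltopology)
    have "continuous_map T euclidean (\<lambda>g. (g u, g v))"
      using continuous_map_pairedI[OF 1[OF that(1)] 1[OF that(2)]]
      by simp
    then show ?thesis
      using continuous_map_compose[of T euclidean _ euclideanreal edge_trace] \<open>continuous_map euclidean euclideanreal edge_trace\<close>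
      by (simp add: o_def)
  qed
  define B where "B u v = {g \<in> topspace T. {u, v} \<in> E \<longrightarrow>
     ({u, v} \<in> N \<longrightarrow> edge_trace (g u, g v) < -2) \<and> ({u, v} \<notin> N \<longrightarrow> edge_trace (g u, g v) > -2)}" for u v
  have B: "openin T (B u v)" if "u \<in> V" "v \<in> V" for u v
  proof -
    have "openin T {g \<in> topspace T. edge_trace (g u, g v) \<in> {..< -2}}"
      "openin T {g \<in> topspace T. edge_trace (g u, g v) \<in> {-2 <..}}"
      by (rule openin_continuous_map_preimage[OF ct[OF that]]; simp)+
    moreover have "B u v = topspace T" if "{u, v} \<notin> E" using that by (simp add: B_def)
    ultimately show ?thesis
      by (cases "{u, v} \<in> E"; cases "{u, v} \<in> N") (simp_all add: B_def)
  qed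
  have fin: "finite V" using finite_simple_graphD[OF G] by blast
  have "stratum V E N = topspace T \<inter> (\<Inter>p\<in>V \<times> V. B (fst p) (snd p))"
    unfolding stratum_eq[OF G N] B_def top by auto
  also have "openin T \<dots>"
  proof (cases "V = {}")
    case False
    have "openin T (\<Inter>p\<in>V \<times> V. B (fst p) (snd p))"
      by (rule openin_INT2) (use fin False B in auto)
    then show ?thesis by (intro openin_Int openin_topspace)
  qed simp
  finally show ?thesis by (simp only: T_def)
qed

section \<open>Connectedness of the strata\<close>

text \<open>Being in the same component of a stratum, expressed in the ambient product space.\<close>

definition joined :: "'v set \<Rightarrow> 'v set set \<Rightarrow> 'v set set \<Rightarrow> ('v \<Rightarrow> real^3^3) \<Rightarrow> ('v \<Rightarrow> real^3^3) \<Rightarrow> bool" where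
  "joined V E N g h \<longleftrightarrow> (\<exists>S. connectedin (product_topology (\<lambda>_. SO3_topology) V) S \<and>
     S \<subseteq> stratum V E N \<and> g \<in> S \<and> h \<in> S)"

lemma stratum_subset_topspace:
  "stratum V E N \<subseteq> topspace (product_topology (\<lambda>_. SO3_topology) V)"
  using stratum_commuting[of V E N] by (auto simp: SO3_topology_def commuting_tuples_def)

lemma joined_refl: "g \<in> stratum V E N \<Longrightarrow> joined V E N g g"
  unfolding joined_def using stratum_subset_topspace[of V E N] by (intro exI[of _ "{g}"]) auto

lemma joined_sym: "joined V E N g h \<Longrightarrow> joined V E N h g"
  unfolding joined_def by blast

lemma joined_trans:
  assumes "joined V E N g h" "joined V E N h k"
  shows "joined V E N g k"
proof -
  obtain S where S: "connectedin (product_topology (\<lambda>_. SO3_topology) V) S" "S \<subseteq> stratum V E N" "g \<in> S" "h \<in> S"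
    using assms(1) unfolding joined_def by blast
  obtain S' where S': "connectedin (product_topology (\<lambda>_. SO3_topology) V) S'" "S' \<subseteq> stratum V E N" "h \<in> S'" "k \<in> S'"
    using assms(2) unfolding joined_def by blast
  have "connectedin (product_topology (\<lambda>_. SO3_topology) V) (S \<union> S')"
    using S S' by (intro connectedin_Un) auto
  then show ?thesis unfolding joined_def using S S' by (intro exI[of _ "S \<union> S'"]) auto
qed

lemma connectedin_stratum_if_joined:
  assumes g: "g \<in> stratum V E N" and j: "\<And>h. h \<in> stratum V E N \<Longrightarrow> joined V E N g h"
  shows "connectedin (product_topology (\<lambda>_. SO3_topology) V) (stratum V E N)"
proof -
  let ?\<U> = "{S. connectedin (product_topology (\<lambda>_. SO3_topology) V) S \<and> S \<subseteq> stratum V E N \<and> g \<in> S}"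
  have "connectedin (product_topology (\<lambda>_. SO3_topology) V) (\<Union>?\<U>)"
    by (rule connectedin_Union) auto
  moreover have "\<Union>?\<U> = stratum V E N"
    using j unfolding joined_def by blast
  ultimately show ?thesis by simp
qed

lemma joined_segment:
  assumes seg: "\<And>t. 0 \<le> t \<Longrightarrow> t \<le> 1 \<Longrightarrow> quat_config V E N (\<lambda>v. (1 - t) *\<^sub>R p v + t *\<^sub>R q v)"
  shows "joined V E N (rotation_tuple V p) (rotation_tuple V q)"
proof -
  define \<gamma> where "\<gamma> t = rotation_tuple V (\<lambda>v. (1 - t) *\<^sub>R p v + t *\<^sub>R q v)" for t
  let ?P = "product_topology (\<lambda>_. SO3_topology) V"
  have nz: "(1 - t) *\<^sub>R p v + t *\<^sub>R q v \<noteq> 0" if "t \<in> {0..1}" "v \<in> V" for t v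
    using quat_configD(1)[OF seg that(2), of t] that(1) by simp
  have "continuous_map (top_of_set {0..1}) ?P \<gamma>"
    unfolding continuous_map_componentwise
  proof (intro conjI ballI)
    show "\<gamma> ` topspace (top_of_set {0..1}) \<subseteq> extensional V"
      by (auto simp: \<gamma>_def rotation_tuple_def)
    fix v assume v: "v \<in> V"
    have "continuous_on {0..1} (\<lambda>t. rotq ((1 - t) *\<^sub>R p v + t *\<^sub>R q v))"
      by (rule continuous_on_compose2[OF continuous_on_rotq]) (use nz[OF _ v] in \<open>auto intro!: continuous_intros\<close>)
    moreover have "rotq ((1 - t) *\<^sub>R p v + t *\<^sub>R q v) \<in> carrier SO3" if "t \<in> {0..1}" for t
      using nz[OF that v] by (rule rotq_in_SO3)
    ultimately show "continuous_map (top_of_set {0..1}) SO3_topology (\<lambda>t. \<gamma> t v)"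
      using v by (simp add: \<gamma>_def rotation_tuple_def SO3_topology_def continuous_map_in_subtopology image_subset_iff)
  qed
  then have "connectedin ?P (\<gamma> ` {0..1})"
    by (rule connectedin_continuous_map_image) (simp add: connectedin_subtopology)
  moreover have "\<gamma> ` {0..1} \<subseteq> stratum V E N"
    unfolding stratum_def \<gamma>_def using seg by auto
  moreover have "rotation_tuple V p = \<gamma> 0" "rotation_tuple V q = \<gamma> 1" by (simp_all add: \<gamma>_def)
  ultimately show ?thesis unfolding joined_def by (intro exI[of _ "\<gamma> ` {0..1}"]) auto
qed

text \<open>Half turns about the given lines on \<open>F\<close>, the trivial rotation elsewhere.\<close>

definition line_rotations :: "'v set \<Rightarrow> ('v \<Rightarrow> real^3) \<Rightarrow> 'v \<Rightarrow> real \<times> (real^3)" where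
  "line_rotations F x v = (if v \<in> F then (0, x v) else (1, 0))"

lemma quat_config_line_rotations:
  assumes x: "line_config (\<Union>N) E N x"
  shows "quat_config V E N (line_rotations (\<Union>N) x)"
proof (rule quat_configI)
  show "line_rotations (\<Union>N) x v \<noteq> 0" for v
    using line_configD(1)[OF x, of v] by (auto simp: line_rotations_def zero_prod_def)
next
  fix u v assume uv: "{u, v} \<in> E" "{u, v} \<in> N"
  then have "u \<in> \<Union>N" "v \<in> \<Union>N" by blast+
  with line_configD(2)[OF x this uv]
  show "fst (line_rotations (\<Union>N) x u) = 0 \<and> fst (line_rotations (\<Union>N) x v) = 0
      \<and> snd (line_rotations (\<Union>N) x u) \<bullet> snd (line_rotations (\<Union>N) x v) = 0"
    unfolding line_rotations_def by simp
next
  fix u v assume uv: "{u, v} \<in> E" "{u, v} \<notin> N"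
  show "cross3 (snd (line_rotations (\<Union>N) x u)) (snd (line_rotations (\<Union>N) x v)) = 0"
  proof (cases "u \<in> \<Union>N \<and> v \<in> \<Union>N")
    case True
    then show ?thesis using line_configD(3)[OF x _ _ uv] unfolding line_rotations_def by simp
  next
    case False
    then show ?thesis unfolding line_rotations_def by auto
  qed
qed

lemma line_config_segment:
  assumes x: "line_config F E N x" and y: "line_config F E N y" and xy: "line_config F E N (\<lambda>v. x v + y v)"
    and pos: "\<And>v. v \<in> F \<Longrightarrow> x v \<bullet> y v > 0" and t: "0 \<le> t" "t \<le> 1"
  shows "line_config F E N (\<lambda>v. (1 - t) *\<^sub>R x v + t *\<^sub>R y v)"
proof (rule line_configI)
  fix v assume v: "v \<in> F"
  have xx: "x v \<bullet> x v > 0" using line_configD(1)[OF x v] by simp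
  have "(1 - t) * (x v \<bullet> x v) + t * (x v \<bullet> y v) > 0"
  proof (cases "t = 0")
    case False
    then show ?thesis using t xx pos[OF v] by (intro add_nonneg_pos) auto
  qed (use xx in simp)
  then have "x v \<bullet> ((1 - t) *\<^sub>R x v + t *\<^sub>R y v) > 0" by (simp add: inner_add_right)
  then show "(1 - t) *\<^sub>R x v + t *\<^sub>R y v \<noteq> 0" by auto
next
  fix u v assume uv: "u \<in> F" "v \<in> F" "{u, v} \<in> E" "{u, v} \<in> N"
  note z = line_configD(2)[OF x uv] line_configD(2)[OF y uv]
  have "x u \<bullet> y v = - (y u \<bullet> x v)"
    using line_configD(2)[OF xy uv] z by (simp add: inner_add_left inner_add_right)
  with z show "((1 - t) *\<^sub>R x u + t *\<^sub>R y u) \<bullet> ((1 - t) *\<^sub>R x v + t *\<^sub>R y v) = 0"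
    by (simp add: inner_add_left inner_add_right)
next
  fix u v assume uv: "u \<in> F" "v \<in> F" "{u, v} \<in> E" "{u, v} \<notin> N"
  note z = line_configD(3)[OF x uv] line_configD(3)[OF y uv]
  have "cross3 (x u) (y v) + cross3 (y u) (x v) = 0"
    using line_configD(3)[OF xy uv] z by (simp add: cross_add_left cross_add_right add.commute)
  then have "cross3 (x u) (y v) = - cross3 (y u) (x v)" by (simp add: eq_neg_iff_add_eq_0)
  with z show "cross3 ((1 - t) *\<^sub>R x u + t *\<^sub>R y u) ((1 - t) *\<^sub>R x v + t *\<^sub>R y v) = 0"
    by (simp add: cross_add_left cross_add_right cross_mult_left cross_mult_right)
qed

lemma rotation_tuple_rescale:
  assumes "\<And>v. v \<in> V \<Longrightarrow> \<exists>c. c \<noteq> 0 \<and> q v = c *\<^sub>R p v"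
  shows "rotation_tuple V q = rotation_tuple V p"
  unfolding rotation_tuple_def
proof (rule restrict_ext)
  fix v assume "v \<in> V"
  then obtain c where "c \<noteq> 0" "q v = c *\<^sub>R p v" using assms by blast
  then show "rotq (q v) = rotq (p v)" by (simp add: rotq_scale)
qed

lemma joined_line_move:
  assumes "line_move (\<Union>N) E N x y"
  shows "joined V E N (rotation_tuple V (line_rotations (\<Union>N) x)) (rotation_tuple V (line_rotations (\<Union>N) y))"
  using assms
proof cases
  case rescale
  have "\<exists>c. c \<noteq> 0 \<and> line_rotations (\<Union>N) y v = c *\<^sub>R line_rotations (\<Union>N) x v" for v
  proof (cases "v \<in> \<Union>N")
    case True
    from rescale(2)[OF this] obtain c where "c \<noteq> 0" "y v = c *\<^sub>R x v" by blast
    with True show ?thesis unfolding line_rotations_def by (intro exI[of _ c]) simp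
  next
    case False
    then show ?thesis unfolding line_rotations_def by (intro exI[of _ 1]) simp
  qed
  then have "rotation_tuple V (line_rotations (\<Union>N) y) = rotation_tuple V (line_rotations (\<Union>N) x)"
    by (rule rotation_tuple_rescale)
  moreover have "rotation_tuple V (line_rotations (\<Union>N) x) \<in> stratum V E N"
    unfolding stratum_def using quat_config_line_rotations[OF rescale(1)] by blast
  ultimately show ?thesis by (simp add: joined_refl)
next
  case segment
  show ?thesis
  proof (rule joined_segment)
    fix t :: real assume t: "0 \<le> t" "t \<le> 1"
    have "(\<lambda>v. (1 - t) *\<^sub>R line_rotations (\<Union>N) x v + t *\<^sub>R line_rotations (\<Union>N) y v)
        = line_rotations (\<Union>N) (\<lambda>v. (1 - t) *\<^sub>R x v + t *\<^sub>R y v)"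
      by (rule ext) (simp add: line_rotations_def)
    then show "quat_config V E N (\<lambda>v. (1 - t) *\<^sub>R line_rotations (\<Union>N) x v + t *\<^sub>R line_rotations (\<Union>N) y v)"
      using quat_config_line_rotations[OF line_config_segment[OF segment t]] by simp
  qed
qed

lemma joined_line_reach:
  assumes "line_reach (\<Union>N) E N x y" and x: "line_config (\<Union>N) E N x"
  shows "joined V E N (rotation_tuple V (line_rotations (\<Union>N) x)) (rotation_tuple V (line_rotations (\<Union>N) y))"
  using assms(1)
proof (induction rule: rtranclp_induct)
  case base
  show ?case
    by (rule joined_refl) (use quat_config_line_rotations[OF x] in \<open>auto simp: stratum_def\<close>)
next
  case (step y z)
  from step.IH joined_line_move[OF step.hyps(2)] show ?case by (rule joined_trans)
qed

text \<open>Vertices in \<open>\<Union>N\<close> have imaginary quaternions already. At the others, choose the lift with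
  nonnegative real part and move it straight to \<open>1\<close>: the imaginary part only shrinks, so it stays
  parallel to those of the neighbours, and the real part is positive from then on.\<close>

lemma quat_config_to_lines:
  assumes G: "finite_simple_graph V E" and N: "N \<subseteq> E" and q: "quat_config V E N q"
  shows "line_config (\<Union>N) E N (\<lambda>v. snd (q v))"
    and "joined V E N (rotation_tuple V q) (rotation_tuple V (line_rotations (\<Union>N) (\<lambda>v. snd (q v))))"
proof -
  let ?F = "\<Union>N"
  have FV: "v \<in> V" if "v \<in> ?F" for v using that N finite_simple_graphD(2)[OF G] by blast
  have fst0: "fst (q v) = 0" if v: "v \<in> ?F" for v
  proof -
    obtain e where e: "e \<in> N" "v \<in> e" using v by blast
    obtain a b where ab: "a \<in> V" "b \<in> V" "e = {a, b}"
      using finite_simple_graph_edgeE[OF G, of e] e N by blast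
    have "fst (q a) = 0 \<and> fst (q b) = 0" using quat_configD(2)[OF q ab(1,2)] e(1) N ab(3) by blast
    then show ?thesis using e(2) ab(3) by auto
  qed
  have snd0: "snd (q v) \<noteq> 0" if "v \<in> ?F" for v
    using quat_configD(1)[OF q FV[OF that]] fst0[OF that] by (metis prod.collapse zero_prod_def)
  show "line_config ?F E N (\<lambda>v. snd (q v))"
    by (rule line_configI) (use snd0 quat_configD(2,3)[OF q FV FV] in blast)+
  \<comment> \<open>The representative of the line through \<open>q v\<close> whose segment to \<open>1\<close> avoids zero.\<close>
  define p where "p v = (if v \<notin> ?F \<and> fst (q v) < 0 then -1 else 1) *\<^sub>R q v" for v
  have "rotation_tuple V p = rotation_tuple V q"
    by (rule rotation_tuple_rescale) (auto simp: p_def intro: exI[of _ 1] exI[of _ "-1"])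
  moreover have "joined V E N (rotation_tuple V p) (rotation_tuple V (line_rotations ?F (\<lambda>v. snd (q v))))"
  proof (rule joined_segment)
    fix t :: real assume t: "0 \<le> t" "t \<le> 1"
    let ?z = "\<lambda>v. (1 - t) *\<^sub>R p v + t *\<^sub>R line_rotations ?F (\<lambda>v. snd (q v)) v"
    have inF: "?z v = q v" if v: "v \<in> ?F" for v
    proof -
      have "(0, snd (q v)) = q v" using fst0[OF v] by (metis prod.collapse)
      then have "line_rotations ?F (\<lambda>v. snd (q v)) v = q v" using v by (simp add: line_rotations_def)
      moreover have "p v = q v" using v by (simp add: p_def)
      ultimately show ?thesis by (simp flip: scaleR_add_left)
    qed
    have fst_out: "fst (?z v) = (1 - t) * \<bar>fst (q v)\<bar> + t" if "v \<notin> ?F" for v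
      using that by (simp add: p_def line_rotations_def)
    have snd_par: "\<exists>c. snd (?z v) = c *\<^sub>R snd (q v)" for v
    proof (cases "v \<in> ?F")
      case True
      then show ?thesis using inF by (intro exI[of _ 1]) simp
    next
      case False
      then have "snd (?z v) = ((1 - t) * (if fst (q v) < 0 then -1 else 1)) *\<^sub>R snd (q v)"
        by (simp add: p_def line_rotations_def)
      then show ?thesis by blast
    qed
    show "quat_config V E N ?z"
    proof (rule quat_configI)
      fix v assume v: "v \<in> V"
      show "?z v \<noteq> 0"
      proof (cases "v \<in> ?F")
        case True
        then show ?thesis using inF quat_configD(1)[OF q v] by simp
      next
        case False
        show ?thesis
        proof (cases "t = 0")
          case True
          then show ?thesis using quat_configD(1)[OF q v] by (simp add: p_def)
        next
          case t0: False
          have "(1 - t) * \<bar>fst (q v)\<bar> \<ge> 0" using t by simp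
          then have "fst (?z v) > 0" using fst_out[OF False] t t0 by linarith
          then show ?thesis by (metis fst_zero less_irrefl)
        qed
      qed
    next
      fix u v assume uv: "u \<in> V" "v \<in> V" "{u, v} \<in> E" "{u, v} \<in> N"
      then have "u \<in> ?F" "v \<in> ?F" by blast+
      then show "fst (?z u) = 0 \<and> fst (?z v) = 0 \<and> snd (?z u) \<bullet> snd (?z v) = 0"
        using quat_configD(2)[OF q uv] by (simp only: inF)
    next
      fix u v assume uv: "u \<in> V" "v \<in> V" "{u, v} \<in> E" "{u, v} \<notin> N"
      obtain c d where "snd (?z u) = c *\<^sub>R snd (q u)" "snd (?z v) = d *\<^sub>R snd (q v)"
        using snd_par by blast
      then show "cross3 (snd (?z u)) (snd (?z v)) = 0"
        using quat_configD(3)[OF q uv] by (simp only: cross_mult_left cross_mult_right scaleR_zero_right)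
    qed
  qed
  ultimately show "joined V E N (rotation_tuple V q) (rotation_tuple V (line_rotations ?F (\<lambda>v. snd (q v))))"
    by simp
qed

lemma stratum_connected:
  assumes G: "finite_simple_graph V E" and N: "N \<subseteq> E" and conn: "line_connected (\<Union>N) E N"
  shows "stratum V E N \<noteq> {}" "connectedin (product_topology (\<lambda>_. SO3_topology) V) (stratum V E N)"
proof -
  obtain x where x: "line_config (\<Union>N) E N x" using conn by (auto simp: line_connected_def)
  let ?g = "rotation_tuple V (line_rotations (\<Union>N) x)"
  have g: "?g \<in> stratum V E N"
    unfolding stratum_def using quat_config_line_rotations[OF x] by blast
  then show "stratum V E N \<noteq> {}" by blast
  show "connectedin (product_topology (\<lambda>_. SO3_topology) V) (stratum V E N)"
  proof (rule connectedin_stratum_if_joined[OF g])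
    fix h assume "h \<in> stratum V E N"
    then obtain q where q: "quat_config V E N q" "h = rotation_tuple V q" by (auto simp: stratum_def)
    note y = quat_config_to_lines[OF G N q(1)]
    have "line_reach (\<Union>N) E N x (\<lambda>v. snd (q v))" using conn x y(1) by (simp add: line_connected_def)
    from joined_line_reach[OF this x] joined_sym[OF y(2)] show "joined V E N ?g h"
      unfolding q(2) by (rule joined_trans)
  qed
qed

theorem theorem2:
  fixes V :: "'a set" and E :: "'a set set"
  assumes "finite_simple_graph V E"
    and "tree_graph V E \<or> cycle_graph V E"
  shows "card (connected_components_of (raag_rep_space V E SO3 SO3_topology)) = 2 ^ card E"
proof -
  let ?T = "subtopology (product_topology (\<lambda>_. SO3_topology) V) (commuting_tuples V E SO3)"
  let ?\<S> = "stratum V E ` Pow E"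
  have top: "topspace ?T = commuting_tuples V E SO3"
    by (auto simp: SO3_topology_def commuting_tuples_def)
  note S = stratum_connected[OF assms(1) _ tree_or_cycle_line_connected[OF assms]]
  have "connected_components_of ?T = ?\<S>"
  proof (rule connected_components_of_open_partition)
    have "commuting_tuples V E SO3 \<subseteq> \<Union>?\<S>" using commuting_in_stratum[OF assms(1)] by blast
    moreover have "\<Union>?\<S> \<subseteq> commuting_tuples V E SO3" using stratum_commuting by fast
    ultimately show "\<Union>?\<S> = topspace ?T" unfolding top by (rule equalityI[rotated])
  next
    fix U assume "U \<in> ?\<S>"
    then obtain N where N: "N \<subseteq> E" "U = stratum V E N" by blast
    show "openin ?T U \<and> connectedin ?T U \<and> U \<noteq> {}"
      unfolding N(2) connectedin_subtopology
      using openin_stratum[OF assms(1) N(1)] S[OF N(1) N(1)] stratum_commuting by blast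
  next
    fix U W g assume "U \<in> ?\<S>" "W \<in> ?\<S>" "g \<in> U" "g \<in> W"
    then show "U = W" using strata_disjoint[OF assms(1)] by blast
  qed
  moreover have "inj_on (stratum V E) (Pow E)"
  proof (rule inj_onI)
    fix N N' assume NN: "N \<in> Pow E" "N' \<in> Pow E" "stratum V E N = stratum V E N'"
    then obtain g where "g \<in> stratum V E N" using S(1)[of N] by blast
    then show "N = N'" using strata_disjoint[OF assms(1), of N N' g] NN by simp
  qed
  ultimately have "card (connected_components_of ?T) = 2 ^ card E"
    using finite_simple_graphD(4)[OF assms(1)] by (simp add: card_image card_Pow)
  moreover have "homeomorphic_map (raag_rep_space V E SO3 SO3_topology) ?T (\<lambda>f. \<lambda>v\<in>V. f (raag_gen V E v))"
    using raag_rep_space_homeomorphic_commuting_tuples[OF topological_group_SO3]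
    by (rule homeomorphic_maps_imp_map)
  ultimately show ?thesis by (simp only: card_connected_components_of_homeomorphic)
qed

end
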